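(* Let $\Phi=(A;E_0,\ldots,E_d;A^*;E^*_0,\ldots,E^*_d)$ be a Leonard system in $\mathcal A$ with eigenvalue sequence $\theta_0,\ldots,\theta_d$, dual eigenvalue sequence $\theta^*_0,\ldots,\theta^*_d$, first split sequence $\varphi_1,\ldots,\varphi_d$ and second split sequence $\phi_1,\ldots,\phi_d$; put $\varphi=\varphi_1\cdots\varphi_d$, $\phi=\phi_1\cdots\phi_d$. Let $\eta_0,\eta_d,\eta^*_0,\eta^*_d$, the scalars $\varepsilon_0,\varepsilon_d,\varepsilon^*_0,\varepsilon^*_d$, the scalar $q$, and the bases $\lbrack g\rbrack$ ($g\in S_4$) be as described in the context. Let $wxyz\in S_4$. Then: the transition matrix from $\lbrack wxyz\rbrack$ to $\lbrack wxzy\rbrack$ is the matrix $Z$ with $Z_{ij}=1$ if $i+j=d$ and $Z_{ij}=0$ otherwise; the transition matrix from $\lbrack wxyz\rbrack$ to $\lbrack xwyz\rbrack$ is diagonal, and the transition matrix from $\lbrack wxyz\rbrack$ to $\lbrack wyxz\rbrack$ is lower triangular. Their entries are given below: for each $wxyz$ we list first the $(i,i)$ entry ($0\le i\le d$) of the diagonal matrix, then the $(i,j)$ entry ($0\le j\le i\le d$) of the lower triangular matrix. Write $K_{ij}=\dfrac{1}{(\theta_j-\theta_0)\cdots(\theta_j-\theta_{j-1})}\cdot\dfrac{1}{(\theta_j-\theta_{j+1})\cdots(\theta_j-\theta_i)}$, $K'_{ij}=\dfrac{1}{(\theta_{d-j}-\theta_d)\cdots(\theta_{d-j}-\theta_{d-j+1})}\cdot\dfrac{1}{(\theta_{d-j}-\theta_{d-j-1})\cdots(\theta_{d-j}-\theta_{d-i})}$,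 and let $K^*_{ij}$, $K'^*_{ij}$ be the same expressions with every $\theta_h$ replaced by $\theta^*_h$. Write $b_{ij}=\lbrack j,i-j,d-i\rbrack_q$ and $M_{ij}=(\theta_d-\theta_0)\cdots(\theta_d-\theta_{i-j-1})\,b_{ij}$, $N_{ij}=(\theta_0-\theta_d)\cdots(\theta_0-\theta_{d-i+j+1})\,b_{ij}$, $M^*_{ij}=(\theta^*_d-\theta^*_0)\cdots(\theta^*_d-\theta^*_{i-j-1})\,b_{ij}$, $N^*_{ij}=(\theta^*_0-\theta^*_d)\cdots(\theta^*_0-\theta^*_{d-i+j+1})\,b_{ij}$. $d^*00^*d$: $\frac{1}{\varphi_1\cdots\varphi_i}\frac{\varepsilon_d\varphi}{\varepsilon^*_0}$; $K_{ij}$ $0d^*0^*d$: $\varphi_1\cdots\varphi_i\frac{\varepsilon^*_0}{\varepsilon_d\varphi}$; $M^*_{ij}$ $d^*0d0^*$: $\varphi_d\cdots\varphi_{d-i+1}\frac{\varepsilon_d}{\varepsilon^*_0}$; $N_{ij}$ $0d^*d0^*$: $\frac{1}{\varphi_d\cdots\varphi_{d-i+1}}\frac{\varepsilon^*_0}{\varepsilon_d}$; $K'^*_{ij}$ $d0^*0d^*$: $\frac{1}{\varphi_1\cdots\varphi_i}\frac{\varepsilon^*_d\varphi}{\varepsilon_0}$; $K^*_{ij}$ $0^*d0d^*$: $\varphi_1\cdots\varphi_i\frac{\varepsilon_0}{\varepsilon^*_d\varphi}$; $M_{ij}$ $d0^*d^*0$: $\varphi_d\cdots\varphi_{d-i+1}\frac{\varepsilon^*_d}{\varepsilon_0}$;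 $N^*_{ij}$ $0^*dd^*0$: $\frac{1}{\varphi_d\cdots\varphi_{d-i+1}}\frac{\varepsilon_0}{\varepsilon^*_d}$; $K'_{ij}$ $dd^*00^*$: $\frac{1}{\phi_d\cdots\phi_{d-i+1}}\frac{\varepsilon^*_0\phi}{\varepsilon_0}$; $K'^*_{ij}$ $d^*d00^*$: $\phi_d\cdots\phi_{d-i+1}\frac{\varepsilon_0}{\varepsilon^*_0\phi}$; $M_{ij}$ $dd^*0^*0$: $\phi_1\cdots\phi_i\frac{\varepsilon^*_0}{\varepsilon_0}$; $M^*_{ij}$ $d^*d0^*0$: $\frac{1}{\phi_1\cdots\phi_i}\frac{\varepsilon_0}{\varepsilon^*_0}$; $K'_{ij}$ $00^*dd^*$: $\frac{1}{\phi_1\cdots\phi_i}\frac{\varepsilon^*_d}{\varepsilon_d}$; $K^*_{ij}$ $0^*0dd^*$: $\phi_1\cdots\phi_i\frac{\varepsilon_d}{\varepsilon^*_d}$; $N_{ij}$ $00^*d^*d$: $\phi_d\cdots\phi_{d-i+1}\frac{\varepsilon^*_d}{\varepsilon_d\phi}$; $N^*_{ij}$ $0^*0d^*d$: $\frac{1}{\phi_d\cdots\phi_{d-i+1}}\frac{\varepsilon_d\phi}{\varepsilon^*_d}$; $K_{ij}$ $d^*0^*0d$: $\frac{\phi_d\cdots\phi_{d-i+1}}{\varphi_1\cdots\varphi_i}\frac{\varepsilon^*_d\varphi}{\varepsilon^*_0\phi}$; $(\theta_i-\theta_0)\cdots(\theta_i-\theta_{j-1})$ $0^*d^*0d$: $\frac{\varphi_1\cdots\varphi_i}{\phi_d\cdots\phi_{d-i+1}}\frac{\varepsilon^*_0\phi}{\varepsilon^*_d\varphi}$;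 $(\theta_i-\theta_0)\cdots(\theta_i-\theta_{j-1})$ $d^*0^*d0$: $\frac{\varphi_d\cdots\varphi_{d-i+1}}{\phi_1\cdots\phi_i}\frac{\varepsilon^*_d}{\varepsilon^*_0}$; $(\theta_{d-i}-\theta_d)\cdots(\theta_{d-i}-\theta_{d-j+1})$ $0^*d^*d0$: $\frac{\phi_1\cdots\phi_i}{\varphi_d\cdots\varphi_{d-i+1}}\frac{\varepsilon^*_0}{\varepsilon^*_d}$; $(\theta_{d-i}-\theta_d)\cdots(\theta_{d-i}-\theta_{d-j+1})$ $d00^*d^*$: $\frac{\phi_1\cdots\phi_i}{\varphi_1\cdots\varphi_i}\frac{\varepsilon_d\varphi}{\varepsilon_0}$; $(\theta^*_i-\theta^*_0)\cdots(\theta^*_i-\theta^*_{j-1})$ $0d0^*d^*$: $\frac{\varphi_1\cdots\varphi_i}{\phi_1\cdots\phi_i}\frac{\varepsilon_0}{\varepsilon_d\varphi}$; $(\theta^*_i-\theta^*_0)\cdots(\theta^*_i-\theta^*_{j-1})$ $d0d^*0^*$: $\frac{\varphi_d\cdots\varphi_{d-i+1}}{\phi_d\cdots\phi_{d-i+1}}\frac{\varepsilon_d\phi}{\varepsilon_0}$; $(\theta^*_{d-i}-\theta^*_d)\cdots(\theta^*_{d-i}-\theta^*_{d-j+1})$ $0dd^*0^*$: $\frac{\phi_d\cdots\phi_{d-i+1}}{\varphi_d\cdots\varphi_{d-i+1}}\frac{\varepsilon_0}{\varepsilon_d\phi}$; $(\theta^*_{d-i}-\theta^*_d)\cdots(\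theta^*_{d-i}-\theta^*_{d-j+1})$
   Context: Let $\mathbb K$ be an arbitrary field with algebraic closure $\tilde{\mathbb K}$, and $d\ge 0$ an integer. $\mathrm{Mat}_{d+1}(\mathbb K)$ is the $\mathbb K$-algebra of $(d+1)\times(d+1)$ matrices over $\mathbb K$, rows and columns indexed by $0,1,\ldots,d$; $\mathcal A$ is a $\mathbb K$-algebra isomorphic to it, with identity $I$. An element of $\mathcal A$ is multiplicity-free if it has $d+1$ distinct eigenvalues (roots of its minimal polynomial), all in $\mathbb K$. If $X\in\mathcal A$ is multiplicity-free with eigenvalues $\xi_0,\ldots,\xi_d$, the primitive idempotent of $X$ associated with $\xi_i$ is $\prod_{j\ne i}(X-\xi_jI)/(\xi_i-\xi_j)$. A Leonard system in $\mathcal A$ is a sequence $\Phi=(A;E_0,\ldots,E_d;A^*;E^*_0,\ldots,E^*_d)$ such that: (i) $A,A^*\in\mathcal A$ are both multiplicity-free; (ii) $E_0,\ldots,E_d$ is an ordering of the primitive idempotents of $A$; (iii) $E^*_0,\ldots,E^*_d$ is an ordering of the primitive idempotents of $A^*$; (iv) $E_iA^*E_j$ is $0$ if $|i-j|>1$ and nonzero if $|i-j|=1$; (v) $E^*_iAE^*_j$ is $0$ if $|i-j|>1$ and nonzero if $|i-j|=1$ ($0\le i,j\le d$). ($A^*$ is just a name, not a conjugate-transpose.) $\theta_i$ (resp. $\theta^*_i$) denotes the eigenvalue of $A$ (resp. $A^*$) associated with $E_i$ (resp. $E^*_i$); these form the eigenvalue (resp. dual eigenvalue) sequence. $V$ is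 the irreducible left $\mathcal A$-module, of dimension $d+1$. Split sequences. For $0\le i\le d$ let $U_i=(E^*_0V+\cdots+E^*_iV)\cap(E_iV+\cdots+E_dV)$; it is known that $\dim U_i=1$ and that, for $1\le i\le d$, $(A-\theta_{i-1}I)(A^*-\theta^*_iI)$ acts on $U_i$ as multiplication by a nonzero scalar $\varphi_i\in\mathbb K$. The sequence $\varphi_1,\ldots,\varphi_d$ is the first split sequence of $\Phi$. The second split sequence $\phi_1,\ldots,\phi_d$ of $\Phi$ is the first split sequence of the Leonard system $(A;E_d,\ldots,E_0;A^*;E^*_0,\ldots,E^*_d)$; that is, $\phi_i$ (also nonzero) is the scalar by which $(A-\theta_{d-i+1}I)(A^*-\theta^*_iI)$ acts on the one-dimensional space $(E^*_0V+\cdots+E^*_iV)\cap(E_{d-i}V+\cdots+E_0V)$. $S_4$ is identified with the set of linear orderings $wxyz$ of the four symbols $0,d,0^*,d^*$. The 24 bases. Fix nonzero vectors $\eta_0\in E_0V$, $\eta_d\in E_dV$, $\eta^*_0\in E^*_0V$, $\eta^*_d\in E^*_dV$. For $0\le i\le d$ put $\tau_i=\prod_{h=0}^{i-1}(A-\theta_hI)$, $\sigma_i=\prod_{h=d-i+1}^{d}(A-\theta_hI)$, $\tau^*_i=\prod_{h=0}^{i-1}(A^*-\theta^*_hI)$, $\sigma^*_i=\prod_{h=d-i+1}^{d}(A^*-\theta^*_hI)$ (empty products are $I$). For $g\in S_4$, $\lbrack g\rbrack$ is the ordered basis $v_0,\ldots,v_d$ of $V$ with $v_i$ as follows: $d^*00^*d$: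 $\tau_i\eta^*_0$; $0d^*0^*d$: $\sigma^*_{d-i}\eta_d$; $d^*0d0^*$: $\tau_{d-i}\eta^*_0$; $0d^*d0^*$: $\sigma^*_i\eta_d$; $d0^*0d^*$: $\tau^*_i\eta_0$; $0^*d0d^*$: $\sigma_{d-i}\eta^*_d$; $d0^*d^*0$: $\tau^*_{d-i}\eta_0$; $0^*dd^*0$: $\sigma_i\eta^*_d$; $dd^*00^*$: $\sigma^*_i\eta_0$; $d^*d00^*$: $\sigma_{d-i}\eta^*_0$; $dd^*0^*0$: $\sigma^*_{d-i}\eta_0$; $d^*d0^*0$: $\sigma_i\eta^*_0$; $00^*dd^*$: $\tau^*_i\eta_d$; $0^*0dd^*$: $\tau_{d-i}\eta^*_d$; $00^*d^*d$: $\tau^*_{d-i}\eta_d$; $0^*0d^*d$: $\tau_i\eta^*_d$; $d^*0^*0d$: $E_i\eta^*_0$; $0^*d^*0d$: $E_i\eta^*_d$; $d^*0^*d0$: $E_{d-i}\eta^*_0$; $0^*d^*d0$: $E_{d-i}\eta^*_d$; $d00^*d^*$: $E^*_i\eta_0$; $0d0^*d^*$: $E^*_i\eta_d$; $d0d^*0^*$: $E^*_{d-i}\eta_0$; $0dd^*0^*$: $E^*_{d-i}\eta_d$. (It is known that each of these sequences is a basis for $V$.) The scalars $\varepsilon$. Let $\tilde E_0=\prod_{h=1}^d(A-\theta_hI)$, $\tilde E_d=\prod_{h=0}^{d-1}(A-\theta_hI)$, $\tilde E^*_0=\prod_{h=1}^d(A^*-\theta^*_hI)$, $\tilde E^*_d=\prod_{h=0}^{d-1}(A^*-\theta^*_hI)$.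 The scalars $\varepsilon_0,\varepsilon_d,\varepsilon^*_0,\varepsilon^*_d$ are nonzero elements of $\mathbb K$ such that $\tilde E_d\eta^*_0/\varepsilon^*_0=\eta_d/\varepsilon_d$, $\tilde E_d\eta^*_d/\varepsilon^*_d=\eta_d/\varepsilon_d$, $\tilde E^*_0\eta_0/\varepsilon_0=\eta^*_0/\varepsilon^*_0$, $\tilde E^*_0\eta_d/\varepsilon_d=\varphi\,\eta^*_0/\varepsilon^*_0$, $\tilde E^*_d\eta_0/\varepsilon_0=\eta^*_d/\varepsilon^*_d$, $\tilde E^*_d\eta_d/\varepsilon_d=\phi\,\eta^*_d/\varepsilon^*_d$, $\tilde E_0\eta^*_0/\varepsilon^*_0=\phi\,\eta_0/\varepsilon_0$, $\tilde E_0\eta^*_d/\varepsilon^*_d=\varphi\,\eta_0/\varepsilon_0$. (It is known that such scalars exist.) The transition matrix from a basis $u_0,\ldots,u_d$ to a basis $v_0,\ldots,v_d$ is the matrix $T$ with $v_j=\sum_{i=0}^dT_{ij}u_i$. The scalar $q$. It is known that the expressions $\frac{\theta_{i-2}-\theta_{i+1}}{\theta_{i-1}-\theta_i}$ and $\frac{\theta^*_{i-2}-\theta^*_{i+1}}{\theta^*_{i-1}-\theta^*_i}$ are equal and independent of $i$ for $2\le i\le d-1$. If $d\ge3$, $q$ is a nonzero element of $\tilde{\mathbb K}$ such that $q+q^{-1}+1$ is this common value; if $d\le2$, $q$ is any nonzero element of $\tilde{\mathbb K}$. The brackets. For an odd integer $n$, $\lbrack n\rbrack_q=\frac{q^{n/2}-q^{-n/2}}{q^{1/2}-q^{-1/2}}$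 if $q\ne1$ and $\lbrack n\rbrack_q=n$ if $q=1$. For an even integer $n$, $\lbrack n\rbrack_q=\frac{q^{n/2}-q^{-n/2}}{q-q^{-1}}$ if $q\ne\pm1$, $\lbrack n\rbrack_q=n/2$ if $q=1$, and $\lbrack n\rbrack_q=(-1)^{n/2-1}n/2$ if $q=-1$; if $\mathbb K$ has characteristic $2$ and $q=1$, then $n/2$ is interpreted as $1$ if $n\equiv2\pmod4$ and $0$ if $n\equiv0\pmod4$. Put $\lbrack n\rbrack!_q=\lbrack1\rbrack_q\cdots\lbrack n\rbrack_q$, $\lbrack0\rbrack!_q=1$. For nonnegative integers $r,s,t$ put $(r,s,t)_q=q+q^{-1}+2$ if $r,s,t$ are all odd and $(r,s,t)_q=1$ otherwise, and, provided $\lbrack i\rbrack_q\ne0$ for $1\le i\le r+s+t$, $$\lbrack r,s,t\rbrack_q=\frac{\lbrack r+s\rbrack!_q\,\lbrack r+t\rbrack!_q\,\lbrack s+t\rbrack!_q\,(r,s,t)_q}{\lbrack r\rbrack!_q\,\lbrack s\rbrack!_q\,\lbrack t\rbrack!_q\,\lbrack r+s+t\rbrack!_q}.$$ (It is known that $\lbrack i\rbrack_q\neq0$ for $1\le i\le d$ when $q$ is a nonzero element of $\tilde{\mathbb K}$ such that, if $d\ge3$, $q+q^{-1}+1$ equals the common value of $\frac{\theta_{i-2}-\theta_{i+1}}{\theta_{i-1}-\theta_i}$ and $\frac{\theta^*_{i-2}-\theta^*_{i+1}}{\theta^*_{i-1}-\theta^*_i}$ for $2\le i\le d-1$.) Empty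 products of scalars equal $1$. Products written with dots run over consecutive indices: e.g. $(\theta_j-\theta_0)\cdots(\theta_j-\theta_{j-1})=\prod_{h=0}^{j-1}(\theta_j-\theta_h)$, $(\theta_j-\theta_{j+1})\cdots(\theta_j-\theta_i)=\prod_{h=j+1}^{i}(\theta_j-\theta_h)$, $(\theta_{d-j}-\theta_{d-j-1})\cdots(\theta_{d-j}-\theta_{d-i})=\prod_{h=d-i}^{d-j-1}(\theta_{d-j}-\theta_h)$, $(\theta_0-\theta_d)\cdots(\theta_0-\theta_{d-i+j+1})=\prod_{h=d-i+j+1}^{d}(\theta_0-\theta_h)$, $\varphi_d\cdots\varphi_{d-i+1}=\prod_{h=d-i+1}^d\varphi_h$. *)

theory Defs
  imports
    "HOL-Algebra.Algebraic_Closure_Type"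
    "Jordan_Normal_Form.Matrix"
begin

section \<open>The algebra and its irreducible module\<close>

text \<open>The algebra is the type \<open>'a\<close>; its structure over the field is given by
  the scalar multiplication \<open>scl\<close>.\<close>

definition is_algebra :: "('k::field \<Rightarrow> 'a::ring_1 \<Rightarrow> 'a) \<Rightarrow> bool" where
  "is_algebra scl \<longleftrightarrow> vector_space scl \<and>
     (\<forall>c a b. scl c (a * b) = scl c a * b \<and> scl c (a * b) = a * scl c b)"

definition iso_to_Mat :: "nat \<Rightarrow> ('k::field \<Rightarrow> 'a::ring_1 \<Rightarrow> 'a) \<Rightarrow> bool" where
  "iso_to_Mat n scl \<longleftrightarrow> (\<exists>\<Psi> :: 'a \<Rightarrow> 'k mat.
     bij_betw \<Psi> UNIV (carrier_mat n n) \<and> \<Psi> 1 = 1\<^sub>m n \<and>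
     (\<forall>a b. \<Psi> (a + b) = \<Psi> a + \<Psi> b) \<and> (\<forall>a b. \<Psi> (a * b) = \<Psi> a * \<Psi> b) \<and>
     (\<forall>c a. \<Psi> (scl c a) = c \<cdot>\<^sub>m \<Psi> a))"

definition left_module :: "('a::ring_1 \<Rightarrow> 'v::ab_group_add \<Rightarrow> 'v) \<Rightarrow> bool" where
  "left_module act \<longleftrightarrow>
     (\<forall>a u v. act a (u + v) = act a u + act a v) \<and>
     (\<forall>a b v. act (a + b) v = act a v + act b v) \<and>
     (\<forall>a b v. act (a * b) v = act a (act b v)) \<and>
     (\<forall>v. act 1 v = v)"

definition submodule :: "('a::ring_1 \<Rightarrow> 'v::ab_group_add \<Rightarrow> 'v) \<Rightarrow> 'v set \<Rightarrow> bool" where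
  "submodule act W \<longleftrightarrow> 0 \<in> W \<and> (\<forall>u\<in>W. \<forall>v\<in>W. u + v \<in> W) \<and> (\<forall>a. \<forall>v\<in>W. act a v \<in> W)"

definition irreducible_module :: "('a::ring_1 \<Rightarrow> 'v::ab_group_add \<Rightarrow> 'v) \<Rightarrow> bool" where
  "irreducible_module act \<longleftrightarrow> left_module act \<and> (UNIV :: 'v set) \<noteq> {0} \<and>
     (\<forall>W. submodule act W \<longrightarrow> W = {0} \<or> W = UNIV)"

text \<open>The vector space structure that a module over the algebra carries: \<open>c v = (c I) v\<close>.\<close>

definition vscl :: "('k \<Rightarrow> 'a::ring_1 \<Rightarrow> 'a) \<Rightarrow> ('a \<Rightarrow> 'v \<Rightarrow> 'v) \<Rightarrow> 'k \<Rightarrow> 'v \<Rightarrow> 'v" where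
  "vscl scl act c v = act (scl c 1) v"


section \<open>Leonard systems\<close>

definition aeval :: "('k::field \<Rightarrow> 'a::ring_1 \<Rightarrow> 'a) \<Rightarrow> 'k poly \<Rightarrow> 'a \<Rightarrow> 'a" where
  "aeval scl p a = (\<Sum>i\<le>degree p. scl (poly.coeff p i) (a ^ i))"

definition min_poly :: "('k::field \<Rightarrow> 'a::ring_1 \<Rightarrow> 'a) \<Rightarrow> 'a \<Rightarrow> 'k poly" where
  "min_poly scl a = (THE p. lead_coeff p = 1 \<and> aeval scl p a = 0 \<and>
     (\<forall>r. r \<noteq> 0 \<longrightarrow> aeval scl r a = 0 \<longrightarrow> degree p \<le> degree r))"

definition eigenvalues :: "('k::field \<Rightarrow> 'a::ring_1 \<Rightarrow> 'a) \<Rightarrow> 'a \<Rightarrow> 'k alg_closure set" where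
  "eigenvalues scl a = {x. poly (map_poly to_ac (min_poly scl a)) x = 0}"

definition multiplicity_free :: "nat \<Rightarrow> ('k::field \<Rightarrow> 'a::ring_1 \<Rightarrow> 'a) \<Rightarrow> 'a \<Rightarrow> bool" where
  "multiplicity_free d scl a \<longleftrightarrow>
     card (eigenvalues scl a) = d + 1 \<and> eigenvalues scl a \<subseteq> range to_ac"

text \<open>The product of the \<open>a - \<xi>\<^sub>h I\<close> over a list of indices. The factors commute, but the
  type of the algebra does not, so \<^const>\<open>prod\<close> is not available.\<close>

definition lin_prod :: "('k::field \<Rightarrow> 'a::ring_1 \<Rightarrow> 'a) \<Rightarrow> 'a \<Rightarrow> (nat \<Rightarrow> 'k) \<Rightarrow> nat list \<Rightarrow> 'a" where
  "lin_prod scl a \<xi> hs = prod_list (map (\<lambda>h. a - scl (\<xi> h) 1) hs)"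

definition prim_idem ::
  "nat \<Rightarrow> ('k::field \<Rightarrow> 'a::ring_1 \<Rightarrow> 'a) \<Rightarrow> 'a \<Rightarrow> (nat \<Rightarrow> 'k) \<Rightarrow> nat \<Rightarrow> 'a" where
  "prim_idem d scl a \<xi> i =
     prod_list (map (\<lambda>j. scl (1 / (\<xi> i - \<xi> j)) (a - scl (\<xi> j) 1)) [j \<leftarrow> [0..<d+1]. j \<noteq> i])"

text \<open>\<open>\<xi>\<^sub>0, \<dots>, \<xi>\<^sub>d\<close> is an ordering of the eigenvalues of \<open>a\<close>, and \<open>F\<^sub>0, \<dots>, F\<^sub>d\<close> are the
  primitive idempotents associated with them.\<close>

definition eigenvalue_seq ::
  "nat \<Rightarrow> ('k::field \<Rightarrow> 'a::ring_1 \<Rightarrow> 'a) \<Rightarrow> 'a \<Rightarrow> (nat \<Rightarrow> 'a) \<Rightarrow> (nat \<Rightarrow> 'k) \<Rightarrow> bool" where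
  "eigenvalue_seq d scl a F \<xi> \<longleftrightarrow>
     inj_on \<xi> {0..d} \<and> to_ac ` \<xi> ` {0..d} = eigenvalues scl a \<and>
     (\<forall>i\<le>d. F i = prim_idem d scl a \<xi> i)"

definition leonard_system ::
  "nat \<Rightarrow> ('k::field \<Rightarrow> 'a::ring_1 \<Rightarrow> 'a) \<Rightarrow> 'a \<Rightarrow> (nat \<Rightarrow> 'a) \<Rightarrow> 'a \<Rightarrow> (nat \<Rightarrow> 'a) \<Rightarrow> bool" where
  "leonard_system d scl A E As Es \<longleftrightarrow>
     multiplicity_free d scl A \<and> multiplicity_free d scl As \<and>
     (\<exists>\<theta>. eigenvalue_seq d scl A E \<theta>) \<and>
     (\<exists>\<theta>s. eigenvalue_seq d scl As Es \<theta>s) \<and>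
     (\<forall>i\<le>d. \<forall>j\<le>d. (\<bar>int i - int j\<bar> > 1 \<longrightarrow> E i * As * E j = 0) \<and>
                   (\<bar>int i - int j\<bar> = 1 \<longrightarrow> E i * As * E j \<noteq> 0)) \<and>
     (\<forall>i\<le>d. \<forall>j\<le>d. (\<bar>int i - int j\<bar> > 1 \<longrightarrow> Es i * A * Es j = 0) \<and>
                   (\<bar>int i - int j\<bar> = 1 \<longrightarrow> Es i * A * Es j \<noteq> 0))"

definition sum_of_images ::
  "('a \<Rightarrow> 'v::ab_group_add \<Rightarrow> 'v) \<Rightarrow> (nat \<Rightarrow> 'a) \<Rightarrow> nat set \<Rightarrow> 'v set" where
  "sum_of_images act F H = {\<Sum>h\<in>H. act (F h) (x h) | x. True}"

definition split_space ::
  "nat \<Rightarrow> ('a \<Rightarrow> 'v::ab_group_add \<Rightarrow> 'v) \<Rightarrow> (nat \<Rightarrow> 'a) \<Rightarrow> (nat \<Rightarrow> 'a) \<Rightarrow> nat \<Rightarrow> 'v set" where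
  "split_space d act E Es i = sum_of_images act Es {0..i} \<inter> sum_of_images act E {i..d}"

definition first_split_seq ::
  "nat \<Rightarrow> ('k::field \<Rightarrow> 'a::ring_1 \<Rightarrow> 'a) \<Rightarrow> ('a \<Rightarrow> 'v::ab_group_add \<Rightarrow> 'v) \<Rightarrow>
   'a \<Rightarrow> (nat \<Rightarrow> 'a) \<Rightarrow> (nat \<Rightarrow> 'k) \<Rightarrow> 'a \<Rightarrow> (nat \<Rightarrow> 'a) \<Rightarrow> (nat \<Rightarrow> 'k) \<Rightarrow> (nat \<Rightarrow> 'k) \<Rightarrow> bool" where
  "first_split_seq d scl act A E \<theta> As Es \<theta>s \<phi> \<longleftrightarrow>
     (\<forall>i\<in>{1..d}. \<forall>u \<in> split_space d act E Es i.
        act ((A - scl (\<theta> (i - 1)) 1) * (As - scl (\<theta>s i) 1)) u = vscl scl act (\<phi> i) u)"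

definition second_split_seq ::
  "nat \<Rightarrow> ('k::field \<Rightarrow> 'a::ring_1 \<Rightarrow> 'a) \<Rightarrow> ('a \<Rightarrow> 'v::ab_group_add \<Rightarrow> 'v) \<Rightarrow>
   'a \<Rightarrow> (nat \<Rightarrow> 'a) \<Rightarrow> (nat \<Rightarrow> 'k) \<Rightarrow> 'a \<Rightarrow> (nat \<Rightarrow> 'a) \<Rightarrow> (nat \<Rightarrow> 'k) \<Rightarrow> (nat \<Rightarrow> 'k) \<Rightarrow> bool" where
  "second_split_seq d scl act A E \<theta> As Es \<theta>s \<phi> \<longleftrightarrow>
     first_split_seq d scl act A (\<lambda>i. E (d - i)) (\<lambda>i. \<theta> (d - i)) As Es \<theta>s \<phi>"


section \<open>The 24 bases\<close>

text \<open>The symbols \<open>0\<close>, \<open>d\<close>, \<open>0\<^sup>*\<close>, \<open>d\<^sup>*\<close>. An element \<open>wxyz\<close> of the symmetric group is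
  a quadruple of distinct symbols; the tables below are irrelevant at other quadruples.\<close>

datatype sym4 = S0 | Sd | S0s | Sds

fun basis24 ::
  "nat \<Rightarrow> ('k::field \<Rightarrow> 'a::ring_1 \<Rightarrow> 'a) \<Rightarrow> ('a \<Rightarrow> 'v::ab_group_add \<Rightarrow> 'v) \<Rightarrow>
   'a \<Rightarrow> (nat \<Rightarrow> 'a) \<Rightarrow> (nat \<Rightarrow> 'k) \<Rightarrow> 'a \<Rightarrow> (nat \<Rightarrow> 'a) \<Rightarrow> (nat \<Rightarrow> 'k) \<Rightarrow>
   'v \<Rightarrow> 'v \<Rightarrow> 'v \<Rightarrow> 'v \<Rightarrow> sym4 \<times> sym4 \<times> sym4 \<times> sym4 \<Rightarrow> nat \<Rightarrow> 'v" where
  "basis24 d scl act A E \<theta> As Es \<theta>s \<eta>0 \<eta>d \<eta>s0 \<eta>sd g i =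
    (let \<tau> = (\<lambda>i. lin_prod scl A \<theta> [0..<i]);
         \<sigma> = (\<lambda>i. lin_prod scl A \<theta> [d+1-i..<d+1]);
         \<tau>s = (\<lambda>i. lin_prod scl As \<theta>s [0..<i]);
         \<sigma>s = (\<lambda>i. lin_prod scl As \<theta>s [d+1-i..<d+1])
     in case g of
       (Sds, S0, S0s, Sd) \<Rightarrow> act (\<tau> i) \<eta>s0
     | (S0, Sds, S0s, Sd) \<Rightarrow> act (\<sigma>s (d - i)) \<eta>d
     | (Sds, S0, Sd, S0s) \<Rightarrow> act (\<tau> (d - i)) \<eta>s0
     | (S0, Sds, Sd, S0s) \<Rightarrow> act (\<sigma>s i) \<eta>d
     | (Sd, S0s, S0, Sds) \<Rightarrow> act (\<tau>s i) \<eta>0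
     | (S0s, Sd, S0, Sds) \<Rightarrow> act (\<sigma> (d - i)) \<eta>sd
     | (Sd, S0s, Sds, S0) \<Rightarrow> act (\<tau>s (d - i)) \<eta>0
     | (S0s, Sd, Sds, S0) \<Rightarrow> act (\<sigma> i) \<eta>sd
     | (Sd, Sds, S0, S0s) \<Rightarrow> act (\<sigma>s i) \<eta>0
     | (Sds, Sd, S0, S0s) \<Rightarrow> act (\<sigma> (d - i)) \<eta>s0
     | (Sd, Sds, S0s, S0) \<Rightarrow> act (\<sigma>s (d - i)) \<eta>0
     | (Sds, Sd, S0s, S0) \<Rightarrow> act (\<sigma> i) \<eta>s0
     | (S0, S0s, Sd, Sds) \<Rightarrow> act (\<tau>s i) \<eta>d
     | (S0s, S0, Sd, Sds) \<Rightarrow> act (\<tau> (d - i)) \<eta>sd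
     | (S0, S0s, Sds, Sd) \<Rightarrow> act (\<tau>s (d - i)) \<eta>d
     | (S0s, S0, Sds, Sd) \<Rightarrow> act (\<tau> i) \<eta>sd
     | (Sds, S0s, S0, Sd) \<Rightarrow> act (E i) \<eta>s0
     | (S0s, Sds, S0, Sd) \<Rightarrow> act (E i) \<eta>sd
     | (Sds, S0s, Sd, S0) \<Rightarrow> act (E (d - i)) \<eta>s0
     | (S0s, Sds, Sd, S0) \<Rightarrow> act (E (d - i)) \<eta>sd
     | (Sd, S0, S0s, Sds) \<Rightarrow> act (Es i) \<eta>0
     | (S0, Sd, S0s, Sds) \<Rightarrow> act (Es i) \<eta>d
     | (Sd, S0, Sds, S0s) \<Rightarrow> act (Es (d - i)) \<eta>0
     | (S0, Sd, Sds, S0s) \<Rightarrow> act (Es (d - i)) \<eta>d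
     | _ \<Rightarrow> undefined)"

definition is_basis :: "('k::field \<Rightarrow> 'v::ab_group_add \<Rightarrow> 'v) \<Rightarrow> nat \<Rightarrow> (nat \<Rightarrow> 'v) \<Rightarrow> bool" where
  "is_basis s d u \<longleftrightarrow> inj_on u {0..d} \<and> \<not> module.dependent s (u ` {0..d}) \<and>
     module.span s (u ` {0..d}) = UNIV"

definition transition_matrix ::
  "('k::field \<Rightarrow> 'v::ab_group_add \<Rightarrow> 'v) \<Rightarrow> nat \<Rightarrow> (nat \<Rightarrow> 'v) \<Rightarrow> (nat \<Rightarrow> 'v) \<Rightarrow> 'k mat \<Rightarrow> bool" where
  "transition_matrix s d u v T \<longleftrightarrow> is_basis s d u \<and> is_basis s d v \<and>
     T \<in> carrier_mat (d+1) (d+1) \<and> (\<forall>j\<le>d. v j = (\<Sum>i\<le>d. s (T $$ (i, j)) (u i)))"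


section \<open>The brackets\<close>

text \<open>For odd \<open>n\<close> the value does not depend on which square root of \<open>q\<close> is chosen.
  In characteristic 2 the convention for \<open>n/2\<close> at \<open>q = 1\<close> (it is 1 if \<open>n \<equiv> 2\<close> and
  0 if \<open>n \<equiv> 0\<close> modulo 4) is the image of the integer \<open>n/2\<close> in the field.\<close>

definition qbracket :: "'c::alg_closed_field \<Rightarrow> int \<Rightarrow> 'c" where
  "qbracket q n =
    (if odd n then
       if q = 1 then of_int n
       else let s = (SOME s. s ^ 2 = q) in (s powi n - s powi (- n)) / (s - inverse s)
     else
       if q = 1 then of_int (n div 2)
       else if q = - 1 then (- 1) powi (n div 2 - 1) * of_int (n div 2)
       else (q powi (n div 2) - q powi (- (n div 2))) / (q - inverse q))"

definition qfact :: "'c::alg_closed_field \<Rightarrow> nat \<Rightarrow> 'c" where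
  "qfact q n = (\<Prod>k = 1..n. qbracket q (int k))"

definition qpar :: "'c::alg_closed_field \<Rightarrow> nat \<Rightarrow> nat \<Rightarrow> nat \<Rightarrow> 'c" where
  "qpar q r s t = (if odd r \<and> odd s \<and> odd t then q + inverse q + 2 else 1)"

definition qtri :: "'c::alg_closed_field \<Rightarrow> nat \<Rightarrow> nat \<Rightarrow> nat \<Rightarrow> 'c" where
  "qtri q r s t =
     (qfact q (r + s) * qfact q (r + t) * qfact q (s + t) * qpar q r s t) /
     (qfact q r * qfact q s * qfact q t * qfact q (r + s + t))"


section \<open>The entries of the transition matrices\<close>

definition entK :: "(nat \<Rightarrow> 'k::field) \<Rightarrow> nat \<Rightarrow> nat \<Rightarrow> 'k" where
  "entK \<theta> i j = 1 / (\<Prod>h<j. \<theta> j - \<theta> h) * (1 / (\<Prod>h=j+1..i. \<theta> j - \<theta> h))"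

definition entK' :: "nat \<Rightarrow> (nat \<Rightarrow> 'k::field) \<Rightarrow> nat \<Rightarrow> nat \<Rightarrow> 'k" where
  "entK' d \<theta> i j = 1 / (\<Prod>h=d-j+1..d. \<theta> (d - j) - \<theta> h) *
                   (1 / (\<Prod>h\<in>{d-i..<d-j}. \<theta> (d - j) - \<theta> h))"

definition entM :: "nat \<Rightarrow> 'k::field alg_closure \<Rightarrow> (nat \<Rightarrow> 'k) \<Rightarrow> nat \<Rightarrow> nat \<Rightarrow> 'k alg_closure" where
  "entM d q \<theta> i j = to_ac (\<Prod>h<i-j. \<theta> d - \<theta> h) * qtri q j (i - j) (d - i)"

definition entN :: "nat \<Rightarrow> 'k::field alg_closure \<Rightarrow> (nat \<Rightarrow> 'k) \<Rightarrow> nat \<Rightarrow> nat \<Rightarrow> 'k alg_closure" where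
  "entN d q \<theta> i j = to_ac (\<Prod>h=d-i+j+1..d. \<theta> 0 - \<theta> h) * qtri q j (i - j) (d - i)"

definition ent_up :: "(nat \<Rightarrow> 'k::field) \<Rightarrow> nat \<Rightarrow> nat \<Rightarrow> 'k" where
  "ent_up \<theta> i j = (\<Prod>h<j. \<theta> i - \<theta> h)"

definition ent_down :: "nat \<Rightarrow> (nat \<Rightarrow> 'k::field) \<Rightarrow> nat \<Rightarrow> nat \<Rightarrow> 'k" where
  "ent_down d \<theta> i j = (\<Prod>h=d-j+1..d. \<theta> (d - i) - \<theta> h)"

text \<open>Here \<open>\<phi>1\<close> and \<open>\<phi>2\<close> are the first and the second split sequence, \<open>f1\<close>, \<open>f2\<close> their
  initial products of length \<open>i\<close>, and \<open>r1\<close>, \<open>r2\<close> their final products of length \<open>i\<close>.\<close>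

fun diag_entry ::
  "nat \<Rightarrow> (nat \<Rightarrow> 'k::field) \<Rightarrow> (nat \<Rightarrow> 'k) \<Rightarrow> 'k \<Rightarrow> 'k \<Rightarrow> 'k \<Rightarrow> 'k \<Rightarrow>
   sym4 \<times> sym4 \<times> sym4 \<times> sym4 \<Rightarrow> nat \<Rightarrow> 'k" where
  "diag_entry d \<phi>1 \<phi>2 \<epsilon>0 \<epsilon>d \<epsilon>s0 \<epsilon>sd g i =
    (let p1 = (\<Prod>h=1..d. \<phi>1 h); p2 = (\<Prod>h=1..d. \<phi>2 h);
         f1 = (\<Prod>h=1..i. \<phi>1 h); f2 = (\<Prod>h=1..i. \<phi>2 h);
         r1 = (\<Prod>h=d-i+1..d. \<phi>1 h); r2 = (\<Prod>h=d-i+1..d. \<phi>2 h)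
     in case g of
       (Sds, S0, S0s, Sd) \<Rightarrow> (1 / f1) * (\<epsilon>d * p1 / \<epsilon>s0)
     | (S0, Sds, S0s, Sd) \<Rightarrow> f1 * (\<epsilon>s0 / (\<epsilon>d * p1))
     | (Sds, S0, Sd, S0s) \<Rightarrow> r1 * (\<epsilon>d / \<epsilon>s0)
     | (S0, Sds, Sd, S0s) \<Rightarrow> (1 / r1) * (\<epsilon>s0 / \<epsilon>d)
     | (Sd, S0s, S0, Sds) \<Rightarrow> (1 / f1) * (\<epsilon>sd * p1 / \<epsilon>0)
     | (S0s, Sd, S0, Sds) \<Rightarrow> f1 * (\<epsilon>0 / (\<epsilon>sd * p1))
     | (Sd, S0s, Sds, S0) \<Rightarrow> r1 * (\<epsilon>sd / \<epsilon>0)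
     | (S0s, Sd, Sds, S0) \<Rightarrow> (1 / r1) * (\<epsilon>0 / \<epsilon>sd)
     | (Sd, Sds, S0, S0s) \<Rightarrow> (1 / r2) * (\<epsilon>s0 * p2 / \<epsilon>0)
     | (Sds, Sd, S0, S0s) \<Rightarrow> r2 * (\<epsilon>0 / (\<epsilon>s0 * p2))
     | (Sd, Sds, S0s, S0) \<Rightarrow> f2 * (\<epsilon>s0 / \<epsilon>0)
     | (Sds, Sd, S0s, S0) \<Rightarrow> (1 / f2) * (\<epsilon>0 / \<epsilon>s0)
     | (S0, S0s, Sd, Sds) \<Rightarrow> (1 / f2) * (\<epsilon>sd / \<epsilon>d)
     | (S0s, S0, Sd, Sds) \<Rightarrow> f2 * (\<epsilon>d / \<epsilon>sd)
     | (S0, S0s, Sds, Sd) \<Rightarrow> r2 * (\<epsilon>sd / (\<epsilon>d * p2))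
     | (S0s, S0, Sds, Sd) \<Rightarrow> (1 / r2) * (\<epsilon>d * p2 / \<epsilon>sd)
     | (Sds, S0s, S0, Sd) \<Rightarrow> (r2 / f1) * (\<epsilon>sd * p1 / (\<epsilon>s0 * p2))
     | (S0s, Sds, S0, Sd) \<Rightarrow> (f1 / r2) * (\<epsilon>s0 * p2 / (\<epsilon>sd * p1))
     | (Sds, S0s, Sd, S0) \<Rightarrow> (r1 / f2) * (\<epsilon>sd / \<epsilon>s0)
     | (S0s, Sds, Sd, S0) \<Rightarrow> (f2 / r1) * (\<epsilon>s0 / \<epsilon>sd)
     | (Sd, S0, S0s, Sds) \<Rightarrow> (f2 / f1) * (\<epsilon>d * p1 / \<epsilon>0)
     | (S0, Sd, S0s, Sds) \<Rightarrow> (f1 / f2) * (\<epsilon>0 / (\<epsilon>d * p1))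
     | (Sd, S0, Sds, S0s) \<Rightarrow> (r1 / r2) * (\<epsilon>d * p2 / \<epsilon>0)
     | (S0, Sd, Sds, S0s) \<Rightarrow> (r2 / r1) * (\<epsilon>0 / (\<epsilon>d * p2))
     | _ \<Rightarrow> undefined)"

text \<open>The entries on and below the diagonal, as elements of the algebraic closure, where
  \<open>q\<close> lives.\<close>

fun lower_entry ::
  "nat \<Rightarrow> 'k::field alg_closure \<Rightarrow> (nat \<Rightarrow> 'k) \<Rightarrow> (nat \<Rightarrow> 'k) \<Rightarrow>
   sym4 \<times> sym4 \<times> sym4 \<times> sym4 \<Rightarrow> nat \<Rightarrow> nat \<Rightarrow> 'k alg_closure" where
  "lower_entry d q \<theta> \<theta>s g i j = (case g of
       (Sds, S0, S0s, Sd) \<Rightarrow> to_ac (entK \<theta> i j)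
     | (S0, Sds, S0s, Sd) \<Rightarrow> entM d q \<theta>s i j
     | (Sds, S0, Sd, S0s) \<Rightarrow> entN d q \<theta> i j
     | (S0, Sds, Sd, S0s) \<Rightarrow> to_ac (entK' d \<theta>s i j)
     | (Sd, S0s, S0, Sds) \<Rightarrow> to_ac (entK \<theta>s i j)
     | (S0s, Sd, S0, Sds) \<Rightarrow> entM d q \<theta> i j
     | (Sd, S0s, Sds, S0) \<Rightarrow> entN d q \<theta>s i j
     | (S0s, Sd, Sds, S0) \<Rightarrow> to_ac (entK' d \<theta> i j)
     | (Sd, Sds, S0, S0s) \<Rightarrow> to_ac (entK' d \<theta>s i j)
     | (Sds, Sd, S0, S0s) \<Rightarrow> entM d q \<theta> i j
     | (Sd, Sds, S0s, S0) \<Rightarrow> entM d q \<theta>s i j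
     | (Sds, Sd, S0s, S0) \<Rightarrow> to_ac (entK' d \<theta> i j)
     | (S0, S0s, Sd, Sds) \<Rightarrow> to_ac (entK \<theta>s i j)
     | (S0s, S0, Sd, Sds) \<Rightarrow> entN d q \<theta> i j
     | (S0, S0s, Sds, Sd) \<Rightarrow> entN d q \<theta>s i j
     | (S0s, S0, Sds, Sd) \<Rightarrow> to_ac (entK \<theta> i j)
     | (Sds, S0s, S0, Sd) \<Rightarrow> to_ac (ent_up \<theta> i j)
     | (S0s, Sds, S0, Sd) \<Rightarrow> to_ac (ent_up \<theta> i j)
     | (Sds, S0s, Sd, S0) \<Rightarrow> to_ac (ent_down d \<theta> i j)
     | (S0s, Sds, Sd, S0) \<Rightarrow> to_ac (ent_down d \<theta> i j)
     | (Sd, S0, S0s, Sds) \<Rightarrow> to_ac (ent_up \<theta>s i j)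
     | (S0, Sd, S0s, Sds) \<Rightarrow> to_ac (ent_up \<theta>s i j)
     | (Sd, S0, Sds, S0s) \<Rightarrow> to_ac (ent_down d \<theta>s i j)
     | (S0, Sd, Sds, S0s) \<Rightarrow> to_ac (ent_down d \<theta>s i j)
     | _ \<Rightarrow> undefined)"

end

theory Submission
  imports Defs
begin

text \<open>For a vector \<open>x\<close> with all components \<open>E\<^sub>i x\<close> nonzero, the vectors \<open>\<tau>\<^sub>i x\<close>, \<open>\<sigma>\<^sub>i x\<close> and \<open>E\<^sub>i x\<close>
  are images of \<open>x\<close> under polynomials in \<open>A\<close>. The lower triangular matrices therefore express
  identities between polynomials, checked at the eigenvalues; reversing the eigenvalue sequence
  halves the work. The bracket entries are the Newton coefficients \<open>c(m,k)\<close> of \<open>\<sigma>\<^sub>m\<close> in the basis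
  of the \<open>\<tau>\<^sub>k\<close>: these satisfy \<open>c(m+1,k) = c(m,k-1) + (\<theta>(k) - \<theta>(d-m)) c(m,k)\<close>, and the closed form
  obeys the same recurrence because \<open>(\<theta>(i) - \<theta>(n-i)) / (\<theta>(0) - \<theta>(n))\<close> is a quotient of brackets.

  For the diagonal matrices, \<open>A\<^sup>* - \<theta>\<^sup>*(i)\<close> maps \<open>\<tau>\<^sub>i \<eta>\<close> to \<open>\<phi>(i) \<tau>(i-1) \<eta>\<close> for \<open>\<eta> = \<eta>\<^sup>*(0)\<close>, so that
  applying \<open>\<sigma>\<^sup>*(d-i)\<close> to a multiple of \<open>\<tau>\<^sub>d \<eta>\<close> gives a multiple of \<open>\<tau>\<^sub>i \<eta>\<close>. The vectors \<open>E\<^sub>i \<eta>\<^sup>*(0)\<close>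
  and \<open>E\<^sub>i \<eta>\<^sup>*(d)\<close> are compared through \<open>\<sigma>\<^sup>*(d-i) \<eta>(d)\<close> and \<open>\<tau>\<^sup>*(d-i) \<eta>(d)\<close>. These two have the same
  \<open>E\<^sub>i\<close> component, since both arise from a monic polynomial of degree \<open>d - i\<close> in \<open>A\<^sup>*\<close>, which is
  tridiagonal with respect to the \<open>E\<^sub>j\<close>.\<close>

section \<open>Identities for the brackets\<close>

text \<open>On the bracket side the obstacle is that \<open>qbracket\<close> is defined by cases,
  with a square root of \<open>q\<close> and special values at \<open>1\<close> and
  \<open>-1\<close>. The proof leaves the definition early: for every nonzero \<open>q\<close>, in
  every characteristic, the even brackets S(k) = [2k] satisfy S(k + 2) = (q + 1/q) S(k + 1) - S(k),
  and [2k + 1] = S(k) + S(k + 1). Consecutive differences of eigenvalues obey the same recurrence,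
  which is why brackets measure eigenvalue gaps at all. On the module side everything is phrased for
  operators on V, in locales that are symmetric under exchange of the two operators and under
  reversal of an eigenvalue order; the matrix algebra enters through its faithful action. The 24
  diagonal matrices come from six relations, each used forwards, backwards, and with
  \<open>i\<close> replaced by \<open>d - i\<close>. Some of the six rest on the equality of the
  split sequences of a system and of its dual. The definition of a split sequence is not symmetric
  in the two operators, so this needs an argument of its own: the split basis of the one is paired
  with that of the other through \<open>E 0\<close>.\<close>

lemma qbracket_even_0: "qbracket q 0 = 0"
  by (simp add: qbracket_def)

lemma qbracket_2: "q \<noteq> 0 \<Longrightarrow> qbracket q 2 = 1"
proof -
  assume q: "q \<noteq> 0"
  have "q - inverse q \<noteq> 0" if "q \<noteq> 1" "q \<noteq> -1"
  proof
    assume "q - inverse q = 0"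
    then have "q ^ 2 = 1" using q by (simp add: field_simps power2_eq_square)
    then show False using that by (simp add: power2_eq_1_iff)
  qed
  then show ?thesis by (auto simp: qbracket_def)
qed

text \<open>A Chebyshev recurrence without denominators. It is uniform in the three cases of the
  definition, so later identities can be derived from it and never return to powers of
  \<open>q\<close>.\<close>

lemma qbracket_even_rec:
  assumes "q \<noteq> 0"
  shows "qbracket q (2 * (a + 1)) + qbracket q (2 * (a - 1)) = (q + inverse q) * qbracket q (2 * a)"
proof -
  consider "q = 1" | "q \<noteq> 1" "q = -1" | "q \<noteq> 1" "q \<noteq> -1" by blast
  then show ?thesis
  proof cases
    case 1
    then show ?thesis by (simp add: qbracket_def algebra_simps)
  next
    case 2
    have m: "(-1 :: 'a) powi (a - 1) = - ((-1) powi a)" "(-1 :: 'a) powi (a - 2) = (-1) powi a"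
      by (simp_all add: power_int_diff)
    show ?thesis using 2 by (simp add: qbracket_def algebra_simps m)
  next
    case 3
    have *: "q powi (a + 1) = q powi a * q" "q powi (a - 1) = q powi a * inverse q"
       "q powi (- (a + 1)) = q powi (- a) * inverse q" "q powi (- (a - 1)) = q powi (- a) * q"
      using assms by (simp_all add: power_int_add power_int_diff power_int_minus field_simps)
    have e: "qbracket q (2 * k) = (q powi k - q powi (- k)) / (q - inverse q)" for k
      using 3 by (simp add: qbracket_def)
    show ?thesis unfolding e * add_divide_distrib[symmetric] by (simp add: algebra_simps)
  qed
qed

text \<open>With s^2 = q one has q - 1/q = (s - 1/s)(s + 1/s), and the factor s + 1/s cancels. This
  removes the chosen square root from all further computations.\<close>

lemma qbracket_odd:
  assumes "q \<noteq> 0"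
  shows "qbracket q (2 * a + 1) = qbracket q (2 * a) + qbracket q (2 * (a + 1))"
proof (cases "q = 1")
  case True
  then show ?thesis by (simp add: qbracket_def)
next
  case False
  define s where "s = (SOME s. s ^ 2 = q)"
  have "\<exists>s. s ^ 2 = q" using nth_root_exists[of 2 q] by auto
  then have s: "s ^ 2 = q" unfolding s_def by (rule someI_ex)
  then have s0: "s \<noteq> 0" using assms by auto
  have pw: "s powi (2 * k) = q powi k" for k
    unfolding s[symmetric] by (simp add: power_int_mult)
  have l: "qbracket q (2 * a + 1) = (s powi (2 * a + 1) - s powi (- (2 * a + 1))) / (s - inverse s)"
    using False unfolding qbracket_def s_def[symmetric] by (simp add: Let_def)
  have m: "s powi (2 * a + 1) = q powi a * s" "s powi (- (2 * a + 1)) = q powi (- a) * inverse s"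
    using s0 pw[of a] by (simp_all add: power_int_add power_int_minus power_int_diff field_simps)
  show ?thesis
  proof (cases "q = -1")
    case True
    have i: "inverse s = - s" using s s0 True by (simp add: field_simps power2_eq_square)
    have mm: "(-1 :: 'a) powi (a - 1) = - ((-1) powi a)" "(-1 :: 'a) powi (- a) = (-1) powi a"
      by (simp_all add: power_int_diff power_int_minus flip: power_int_inverse)
    \<comment> \<open>In characteristic 2 the value \<open>-1\<close> is \<open>1\<close>, a case
      already excluded; so \<open>s - inverse s = s + s\<close> may be divided by.\<close>
    have "(2::'a) \<noteq> 0" using False True by (metis add_eq_0_iff one_add_one)
    then have "s + s \<noteq> 0" using s0 by (simp flip: mult_2)
    then have "qbracket q (2 * a + 1) = (-1) powi a"
      unfolding l m i unfolding True mm by (simp add: field_simps)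
    moreover have "qbracket q (2 * a) + qbracket q (2 * (a + 1)) = (-1) powi a"
      using False True by (simp add: qbracket_def mm algebra_simps)
    ultimately show ?thesis by simp
  next
    case q1: False
    have e: "qbracket q (2 * k) = (q powi k - q powi (- k)) / (q - inverse q)" for k
      using q1 False by (simp add: qbracket_def)
    have *: "q powi (a + 1) = q powi a * q" "q powi (- (a + 1)) = q powi (- a) * inverse q"
      using assms by (simp_all add: power_int_add power_int_diff power_int_minus field_simps)
    have qq: "q = s * s" using s by (simp add: power2_eq_square)
    have i: "inverse q = inverse s * inverse s" by (simp add: qq)
    have ss: "s * inverse s = 1" using s0 by simp
    have f: "q - inverse q = (s - inverse s) * (s + inverse s)"
      unfolding i unfolding qq by (simp add: algebra_simps)
    have "q ^ 2 \<noteq> 1" using q1 False by (simp add: power2_eq_1_iff)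
    then have nz: "q - inverse q \<noteq> 0" using assms by (simp add: field_simps power2_eq_square)
    then have nz': "s - inverse s \<noteq> 0" "s + inverse s \<noteq> 0" unfolding f by auto
    have g: "q powi a - q powi (- a) + (q powi a * q - q powi (- a) * inverse q)
       = (q powi a * s - q powi (- a) * inverse s) * (s + inverse s)" 
      (is "?x - ?y + _ = _")
    proof -
      have "(?x * s - ?y * inverse s) * (s + inverse s)
        = ?x * (s * s) + ?x * (s * inverse s) - ?y * (s * inverse s) - ?y * (inverse s * inverse s)"
        by (simp add: algebra_simps)
      then show ?thesis unfolding ss i unfolding qq by (simp add: algebra_simps)
    qed
    show ?thesis unfolding l m e * add_divide_distrib[symmetric] g
      unfolding f using nz' by simp
  qed
qed

lemma rec2_unique:
  fixes f g :: "nat \<Rightarrow> 'a::comm_ring_1"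
  assumes "\<And>n. f (n + 2) = c * f (n + 1) - f n" and "\<And>n. g (n + 2) = c * g (n + 1) - g n"
    and "f 0 = g 0" and "f 1 = g 1"
  shows "f n = g n"
proof -
  have "f n = g n \<and> f (n + 1) = g (n + 1)"
    by (induction n) (use assms in simp_all)
  then show ?thesis by blast
qed

text \<open>Both sides solve the recurrence in \<open>n\<close> and agree at \<open>0\<close> and
  \<open>1\<close>. The formula expresses a bracket of a sum through two consecutive values at each
  summand, so that identities in several variables become polynomial identities.\<close>

lemma qbracket_even_add:
  assumes "q \<noteq> 0"
  shows "qbracket q (2 * (a + int n)) = qbracket q (2 * a) * qbracket q (2 * (int n + 1))
     + qbracket q (2 * (a + 1)) * qbracket q (2 * int n)
     - (q + inverse q) * qbracket q (2 * a) * qbracket q (2 * int n)"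
proof -
  define S where "S = (\<lambda>k. qbracket q (2 * k))"
  define c where "c = q + inverse q"
  have S: "S 0 = 0" "S 1 = 1" by (simp_all add: S_def qbracket_even_0 qbracket_2[OF assms])
  have rec: "S (k + 2) = c * S (k + 1) - S k" for k
    using qbracket_even_rec[OF assms, of "k + 1"] by (simp add: S_def c_def algebra_simps)
  have "S (a + int n) = S a * S (int n + 1) + S (a + 1) * S (int n) - c * S a * S (int n)"
  proof (rule rec2_unique[where c = c])
    fix n
    show "S (a + int (n + 2)) = c * S (a + int (n + 1)) - S (a + int n)"
      using rec[of "a + int n"] by (simp add: algebra_simps)
    have *: "S (int (n + 2) + 1) = c * S (int (n + 1) + 1) - S (int n + 1)"
      "S (int (n + 2)) = c * S (int (n + 1)) - S (int n)"
      using rec[of "int n + 1"] rec[of "int n"] by (simp_all add: ac_simps)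
    show "S a * S (int (n + 2) + 1) + S (a + 1) * S (int (n + 2)) - c * S a * S (int (n + 2)) =
      c * (S a * S (int (n + 1) + 1) + S (a + 1) * S (int (n + 1)) - c * S a * S (int (n + 1)))
      - (S a * S (int n + 1) + S (a + 1) * S (int n) - c * S a * S (int n))"
      unfolding * by (simp add: algebra_simps)
  qed (use rec[of 0] in \<open>simp_all add: S\<close>)
  then show ?thesis by (simp add: S_def c_def)
qed

lemma qbracket_even_diff:
  assumes "q \<noteq> 0"
  shows "qbracket q (2 * (a - int n)) = qbracket q (2 * a) * qbracket q (2 * (int n + 1))
     - qbracket q (2 * (a + 1)) * qbracket q (2 * int n)"
proof -
  define S where "S = (\<lambda>k. qbracket q (2 * k))"
  define c where "c = q + inverse q"
  have S: "S 0 = 0" "S 1 = 1" by (simp_all add: S_def qbracket_even_0 qbracket_2[OF assms])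
  have rec: "S (k + 2) = c * S (k + 1) - S k" for k
    using qbracket_even_rec[OF assms, of "k + 1"] by (simp add: S_def c_def algebra_simps)
  have "S (a - int n) = S a * S (int n + 1) - S (a + 1) * S (int n)"
  proof (rule rec2_unique[where c = c])
    fix n
    show "S (a - int (n + 2)) = c * S (a - int (n + 1)) - S (a - int n)"
      using rec[of "a - int n - 2"] by (simp add: algebra_simps)
    have *: "S (int (n + 2) + 1) = c * S (int (n + 1) + 1) - S (int n + 1)"
      "S (int (n + 2)) = c * S (int (n + 1)) - S (int n)"
      using rec[of "int n + 1"] rec[of "int n"] by (simp_all add: ac_simps)
    show "S a * S (int (n + 2) + 1) - S (a + 1) * S (int (n + 2)) =
      c * (S a * S (int (n + 1) + 1) - S (a + 1) * S (int (n + 1)))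
      - (S a * S (int n + 1) - S (a + 1) * S (int n))"
      unfolding * by (simp add: algebra_simps)
  qed (use rec[of 0] rec[of "a - 1"] in \<open>simp_all add: S algebra_simps\<close>)
  then show ?thesis by (simp add: S_def c_def)
qed

text \<open>This is what remains of \<open>qtri_recurrence\<close> after the common factorials are
  cancelled. Since \<open>qpar\<close> sees only parities, the eight parity classes of
  \<open>r\<close>, \<open>s\<close>, \<open>t\<close> are treated separately; in each, the addition
  and difference formulas leave a polynomial identity in \<open>c\<close> and the values of
  \<open>S\<close> at two consecutive integers for each of the three halves.\<close>

lemma qbracket_triple:
  fixes r s t :: nat
  assumes q: "q \<noteq> 0" and r: "r \<ge> 1"
  shows "qbracket q (int (s + t + 1)) * qbracket q (int r) * qpar q (r - 1) (s + 1) t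
       - qbracket q (int (r + s + 1)) * qbracket q (int t) * qpar q r (s + 1) (t - 1)
       = qbracket q (int r - int t) * qbracket q (int (s + 1)) * qpar q r s t"
proof -
  define S where "S = (\<lambda>k. qbracket q (2 * k))"
  define c where "c = q + inverse q"
  have S: "S 0 = 0" "S 1 = 1" by (simp_all add: S_def qbracket_even_0 qbracket_2[OF q])
  have rec: "S (k + 2) = c * S (k + 1) - S k" for k
    using qbracket_even_rec[OF q, of "k + 1"] by (simp add: S_def c_def algebra_simps)
  have ev: "qbracket q n = S k" if "n = 2 * k" for n k using that by (simp add: S_def)
  have od: "qbracket q n = S k + S (k + 1)" if "n = 2 * k + 1" for n k
    using that qbracket_odd[OF q, of k] by (simp add: S_def)
  have add: "S (a + int n) = S a * S (int n + 1) + S (a + 1) * S (int n) - c * S a * S (int n)" for a n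
    using qbracket_even_add[OF q, of a n] by (simp add: S_def c_def)
  have dif: "S (a - int n) = S a * S (int n + 1) - S (a + 1) * S (int n)" for a n
    using qbracket_even_diff[OF q, of a n] by (simp add: S_def)
  obtain a \<alpha> where ra: "r = 2 * a + \<alpha>" "\<alpha> < 2" using mod_less_divisor[of 2 r] mult_div_mod_eq[of 2 r] by (metis zero_less_numeral)
  obtain b \<beta> where sb: "s = 2 * b + \<beta>" "\<beta> < 2" using mod_less_divisor[of 2 s] mult_div_mod_eq[of 2 s] by (metis zero_less_numeral)
  obtain e \<gamma> where te: "t = 2 * e + \<gamma>" "\<gamma> < 2" using mod_less_divisor[of 2 t] mult_div_mod_eq[of 2 t] by (metis zero_less_numeral)
  let ?a = "int a" and ?b = "int b" and ?e = "int e"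
  have st0: "S (?b + ?e) = S ?b * S (?e + 1) + S (?b + 1) * S ?e - c * S ?b * S ?e"
    and rs0: "S (?a + ?b) = S ?a * S (?b + 1) + S (?a + 1) * S ?b - c * S ?a * S ?b"
    and rt0: "S (?a - ?e) = S ?a * S (?e + 1) - S (?a + 1) * S ?e"
    using add dif by simp_all
  have st1: "S (?b + ?e + 1) = S (?b + 1) * S (?e + 1) - S ?b * S ?e"
    using add[of "?b + 1" e] rec[of ?b] by (simp add: algebra_simps)
  have rs1: "S (?a + ?b + 1) = S (?a + 1) * S (?b + 1) - S ?a * S ?b"
    using add[of "?a + 1" b] rec[of ?a] by (simp add: algebra_simps)
  have st2: "S (?b + ?e + 2) = c * S (?b + ?e + 1) - S (?b + ?e)"
    and rs2: "S (?a + ?b + 2) = c * S (?a + ?b + 1) - S (?a + ?b)"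
    using rec by simp_all
  have rtm: "S (?a - ?e - 1) = c * S (?a - ?e) - S (?a - ?e + 1)"
    using rec[of "?a - ?e - 1"] by (simp add: algebra_simps)
  have rt1: "S (?a - ?e + 1) = S (?a + 1) * S (?e + 1) - S (?a + 2) * S ?e"
    using dif[of "?a + 1" e] by (simp add: algebra_simps)
  have b2: "S (?b + 2) = c * S (?b + 1) - S ?b" and a2: "S (?a + 2) = c * S (?a + 1) - S ?a"
    using rec by simp_all
  have par: "qpar q i j k = (if odd i \<and> odd j \<and> odd k then c + 2 else 1)" for i j k
    by (simp add: qpar_def c_def)
  have al: "\<alpha> = 0 \<or> \<alpha> = 1" and be: "\<beta> = 0 \<or> \<beta> = 1" and ga: "\<gamma> = 0 \<or> \<gamma> = 1"
    using ra sb te by auto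
  consider "\<alpha> = 0" "\<beta> = 0" "\<gamma> = 0" | "\<alpha> = 0" "\<beta> = 0" "\<gamma> = 1" | "\<alpha> = 0" "\<beta> = 1" "\<gamma> = 0" | "\<alpha> = 0" "\<beta> = 1" "\<gamma> = 1"
    | "\<alpha> = 1" "\<beta> = 0" "\<gamma> = 0" | "\<alpha> = 1" "\<beta> = 0" "\<gamma> = 1" | "\<alpha> = 1" "\<beta> = 1" "\<gamma> = 0" | "\<alpha> = 1" "\<beta> = 1" "\<gamma> = 1"
    using al be ga by (elim disjE) (simp_all only:)
  then show ?thesis
  proof cases
    case 1
    have p: "qpar q (r - 1) (s + 1) t = 1" "qpar q r (s + 1) (t - 1) = 1" "qpar q r s t = 1"
      using 1 ra sb te r by (auto simp: par)
    have "qbracket q (int (s + t + 1)) = S (?b + ?e) + S (?b + ?e + 1)" "qbracket q (int r) = S ?a"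
      "qbracket q (int (r + s + 1)) = S (?a + ?b) + S (?a + ?b + 1)" "qbracket q (int t) = S ?e"
      "qbracket q (int r - int t) = S (?a - ?e)" "qbracket q (int (s + 1)) = S ?b + S (?b + 1)"
      using 1 ra sb te by (auto intro!: ev od)
    then show ?thesis by (simp only: p st2 rs2 st1 rs1 st0 rs0 rt1 rt0 b2 a2) (simp add: algebra_simps)
  next
    case 2
    have p: "qpar q (r - 1) (s + 1) t = c + 2" "qpar q r (s + 1) (t - 1) = 1" "qpar q r s t = 1"
      using 2 ra sb te r by (auto simp: par)
    have "qbracket q (int (s + t + 1)) = S (?b + ?e + 1)" "qbracket q (int r) = S ?a"
      "qbracket q (int (r + s + 1)) = S (?a + ?b) + S (?a + ?b + 1)" "qbracket q (int t) = S ?e + S (?e + 1)"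
      "qbracket q (int (s + 1)) = S ?b + S (?b + 1)"
      using 2 ra sb te by (auto intro!: ev od)
    moreover have "qbracket q (int r - int t) = S (?a - ?e - 1) + S (?a - ?e)"
      using od[of "int r - int t" "?a - ?e - 1"] 2 ra te by simp
    ultimately show ?thesis by (simp only: p rtm st2 rs2 st1 rs1 st0 rs0 rt1 rt0 b2 a2) (simp add: algebra_simps)
  next
    case 3
    have p: "qpar q (r - 1) (s + 1) t = 1" "qpar q r (s + 1) (t - 1) = 1" "qpar q r s t = 1"
      using 3 ra sb te r by (auto simp: par)
    have "qbracket q (int (s + t + 1)) = S (?b + ?e + 1)" "qbracket q (int r) = S ?a"
      "qbracket q (int (r + s + 1)) = S (?a + ?b + 1)" "qbracket q (int t) = S ?e"
      "qbracket q (int (s + 1)) = S (?b + 1)" "qbracket q (int r - int t) = S (?a - ?e)"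
      using 3 ra sb te by (auto intro!: ev od)
    then show ?thesis by (simp only: p st2 rs2 st1 rs1 st0 rs0 rt1 rt0 b2 a2) (simp add: algebra_simps)
  next
    case 4
    have p: "qpar q (r - 1) (s + 1) t = 1" "qpar q r (s + 1) (t - 1) = 1" "qpar q r s t = 1"
      using 4 ra sb te r by (auto simp: par)
    have "qbracket q (int r) = S ?a"
      "qbracket q (int (r + s + 1)) = S (?a + ?b + 1)" "qbracket q (int t) = S ?e + S (?e + 1)"
      "qbracket q (int (s + 1)) = S (?b + 1)"
      using 4 ra sb te by (auto intro!: ev od)
    moreover have "qbracket q (int r - int t) = S (?a - ?e - 1) + S (?a - ?e)"
      using od[of "int r - int t" "?a - ?e - 1"] 4 ra te by simp
    moreover have "qbracket q (int (s + t + 1)) = S (?b + ?e + 1) + S (?b + ?e + 2)"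
      using od[of "int (s + t + 1)" "?b + ?e + 1"] 4 sb te by (simp add: ac_simps)
    ultimately show ?thesis by (simp only: p rtm st2 rs2 st1 rs1 st0 rs0 rt1 rt0 b2 a2) (simp add: algebra_simps)
  next
    case 5
    have p: "qpar q (r - 1) (s + 1) t = 1" "qpar q r s t = 1"
      using 5 ra sb te r by (auto simp: par)
    \<comment> \<open>For \<open>t = 0\<close> the truncated \<open>t - 1\<close> is even instead of
      odd, so \<open>qpar\<close> alone would have the wrong value; the factor
      \<open>S 0 = 0\<close> hides this.\<close>
    have p': "S ?e * qpar q r (s + 1) (t - 1) = S ?e * (c + 2)"
      using 5 ra sb te r S by (cases e) (auto simp: par)
    have "qbracket q (int (s + t + 1)) = S (?b + ?e) + S (?b + ?e + 1)" "qbracket q (int r) = S ?a + S (?a + 1)"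
      "qbracket q (int (r + s + 1)) = S (?a + ?b + 1)" "qbracket q (int t) = S ?e"
      "qbracket q (int (s + 1)) = S ?b + S (?b + 1)" "qbracket q (int r - int t) = S (?a - ?e) + S (?a - ?e + 1)"
      using 5 ra sb te by (auto intro!: ev od)
    then show ?thesis by (simp only: p p' mult.assoc st2 rs2 st1 rs1 st0 rs0 rt1 rt0 b2 a2) (simp add: algebra_simps)
  next
    case 6
    have p: "qpar q (r - 1) (s + 1) t = 1" "qpar q r (s + 1) (t - 1) = 1" "qpar q r s t = 1"
      using 6 ra sb te r by (auto simp: par)
    have "qbracket q (int (s + t + 1)) = S (?b + ?e + 1)" "qbracket q (int r) = S ?a + S (?a + 1)"
      "qbracket q (int (r + s + 1)) = S (?a + ?b + 1)" "qbracket q (int t) = S ?e + S (?e + 1)"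
      "qbracket q (int (s + 1)) = S ?b + S (?b + 1)" "qbracket q (int r - int t) = S (?a - ?e)"
      using 6 ra sb te by (auto intro!: ev od)
    then show ?thesis by (simp only: p st2 rs2 st1 rs1 st0 rs0 rt1 rt0 b2 a2) (simp add: algebra_simps)
  next
    case 7
    have p: "qpar q (r - 1) (s + 1) t = 1" "qpar q r (s + 1) (t - 1) = 1" "qpar q r s t = 1"
      using 7 ra sb te r by (auto simp: par)
    have "qbracket q (int (s + t + 1)) = S (?b + ?e + 1)" "qbracket q (int r) = S ?a + S (?a + 1)"
      "qbracket q (int t) = S ?e"
      "qbracket q (int (s + 1)) = S (?b + 1)" "qbracket q (int r - int t) = S (?a - ?e) + S (?a - ?e + 1)"
      using 7 ra sb te by (auto intro!: ev od)
    moreover have "qbracket q (int (r + s + 1)) = S (?a + ?b + 1) + S (?a + ?b + 2)"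
      using od[of "int (r + s + 1)" "?a + ?b + 1"] 7 ra sb by (simp add: ac_simps)
    ultimately show ?thesis by (simp only: p st2 rs2 st1 rs1 st0 rs0 rt1 rt0 b2 a2) (simp add: algebra_simps)
  next
    case 8
    have p: "qpar q (r - 1) (s + 1) t = 1" "qpar q r (s + 1) (t - 1) = 1" "qpar q r s t = c + 2"
      using 8 ra sb te r by (auto simp: par)
    have "qbracket q (int r) = S ?a + S (?a + 1)"
      "qbracket q (int t) = S ?e + S (?e + 1)"
      "qbracket q (int (s + 1)) = S (?b + 1)" "qbracket q (int r - int t) = S (?a - ?e)"
      using 8 ra sb te by (auto intro!: ev od)
    moreover have "qbracket q (int (s + t + 1)) = S (?b + ?e + 1) + S (?b + ?e + 2)"
      using od[of "int (s + t + 1)" "?b + ?e + 1"] 8 sb te by (simp add: ac_simps)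
    moreover have "qbracket q (int (r + s + 1)) = S (?a + ?b + 1) + S (?a + ?b + 2)"
      using od[of "int (r + s + 1)" "?a + ?b + 1"] 8 ra sb by (simp add: ac_simps)
    ultimately show ?thesis by (simp only: p st2 rs2 st1 rs1 st0 rs0 rt1 rt0 b2 a2) (simp add: algebra_simps)
  qed
qed

lemma qbracket_minus:
  assumes "q \<noteq> 0"
  shows "qbracket q (- n) = - qbracket q n"
proof -
  have p: "qbracket q (2 * (- int k)) = - qbracket q (2 * int k)" for k
    using qbracket_even_diff[OF assms, of 0 k] by (simp add: qbracket_even_0 qbracket_2[OF assms])
  have ev: "qbracket q (2 * (- k)) = - qbracket q (2 * k)" for k
  proof (cases "k \<ge> 0")
    case True
    then show ?thesis using p[of "nat k"] by simp
  next
    case False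
    then show ?thesis using p[of "nat (- k)"] by simp
  qed
  show ?thesis
  proof (cases "even n")
    case True
    then show ?thesis using ev by (auto elim!: evenE)
  next
    case False
    then obtain k where k: "n = 2 * k + 1" by (elim oddE)
    have "- n = 2 * (- k - 1) + 1" using k by simp
    then have "qbracket q (- n) = qbracket q (2 * (- k - 1)) + qbracket q (2 * (- k))"
      using qbracket_odd[OF assms, of "- k - 1"] by simp
    moreover have "qbracket q (2 * (- k - 1)) = - qbracket q (2 * (k + 1))"
      using ev[of "k + 1"] by (simp only: minus_add_distrib) simp
    ultimately show ?thesis unfolding k qbracket_odd[OF assms] using ev[of k] by simp
  qed
qed

text \<open>The division-free form of the three-term recurrence that ties \<open>q\<close> to the eigenvalues.\<close>

definition beta_recurrent :: "nat \<Rightarrow> 'c::field \<Rightarrow> (nat \<Rightarrow> 'c) \<Rightarrow> bool" where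
  "beta_recurrent d q t \<longleftrightarrow>
     (\<forall>i. i + 3 \<le> d \<longrightarrow> t i - t (i + 3) = (q + inverse q + 1) * (t (i + 1) - t (i + 2)))"

section \<open>Eigenvalue gaps as multiples of brackets\<close>

lemma beta_recurrent_diffs:
  assumes "beta_recurrent d q t" and "i + 3 \<le> d"
  shows "(t i - t (i + 1)) + (t (i + 2) - t (i + 3)) = (q + inverse q) * (t (i + 1) - t (i + 2))"
proof -
  have "t i - t (i + 3) = (q + inverse q + 1) * (t (i + 1) - t (i + 2))"
    using assms by (simp add: beta_recurrent_def)
  then show ?thesis by (simp add: algebra_simps)
qed

text \<open>The consecutive differences \<open>D\<close> satisfy a three-term recurrence that is
  symmetric under reflection. Sums of two differences placed symmetrically about \<open>c\<close>
  are therefore determined by \<open>D c\<close> alone, and a gap centred between \<open>c\<close>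
  and \<open>c + 1\<close> is a telescoping sum of such pairs.\<close>

lemma gap_odd:
  assumes q: "q \<noteq> 0" and b: "beta_recurrent d q t"
    and "k \<le> c" and "c + 1 + k \<le> d"
  shows "t (c - k) - t (c + 1 + k) = qbracket q (2 * int k + 1) * (t c - t (c + 1))"
proof -
  define S where "S = (\<lambda>k. qbracket q (2 * k))"
  define l where "l = q + inverse q"
  define D where "D = (\<lambda>i. t i - t (i + 1))"
  have S: "S 0 = 0" "S 1 = 1" by (simp_all add: S_def qbracket_even_0 qbracket_2[OF q])
  have rec: "S (k + 2) = l * S (k + 1) - S k" for k
    using qbracket_even_rec[OF q, of "k + 1"] by (simp add: S_def l_def algebra_simps)
  have Sm: "S (- 1) = - 1" using rec[of "-1"] S by simp (metis minus_minus)
  have S2: "S 2 = l" using rec[of 0] S by simp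
  have Drec: "D i + D (i + 2) = l * D (i + 1)" if "i + 3 \<le> d" for i
    using beta_recurrent_diffs[OF b that] by (simp add: D_def l_def add.assoc eval_nat_numeral)
  \<comment> \<open>The coefficient S(k + 1) - S(k - 1) is q^k + q^(-k), written so that the sum
    over \<open>k\<close> telescopes.\<close>
  have J: "D (c - k) + D (c + k) = (S (int k + 1) - S (int k - 1)) * D c"
    if "k \<le> c" "c + 1 + k \<le> d" for k
    using that
  proof (induction k rule: induct_nat_012)
    case 0
    then show ?case by (simp add: S Sm)
  next
    case 1
    then show ?case using Drec[of "c - 1"] by (simp add: S S2)
  next
    case (ge2 k)
    have "D (c - Suc (Suc k)) + D (c - k) = l * D (c - Suc k)"
      using Drec[of "c - Suc (Suc k)"] ge2.prems by (simp add: Suc_diff_Suc numeral_2_eq_2)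
    moreover have "D (c + k) + D (c + Suc (Suc k)) = l * D (c + Suc k)"
      using Drec[of "c + k"] ge2.prems by simp
    ultimately have "D (c - Suc (Suc k)) + D (c + Suc (Suc k))
      = l * (D (c - Suc k) + D (c + Suc k)) - (D (c - k) + D (c + k))"
      by (simp add: algebra_simps)
    also have "\<dots> = l * ((S (int k + 2) - S (int k)) * D c) - (S (int k + 1) - S (int k - 1)) * D c"
      using ge2 by (simp add: ac_simps)
    also have "\<dots> = ((l * S (int k + 2) - S (int k + 1)) - (l * S (int k) - S (int k - 1))) * D c"
      by (simp add: algebra_simps)
    also have "\<dots> = (S (int k + 3) - S (int k + 1)) * D c"
      using rec[of "int k + 1"] rec[of "int k - 1"] by (simp add: ac_simps)
    finally show ?case by (simp add: ac_simps)
  qed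
  have od: "qbracket q (2 * int k + 1) = S (int k) + S (int k + 1)" for k
    using qbracket_odd[OF q] by (simp add: S_def)
  have "t (c - k) - t (c + 1 + k) = (S (int k) + S (int k + 1)) * D c"
    using assms(3,4)
  proof (induction k)
    case 0
    then show ?case by (simp add: S D_def)
  next
    case (Suc k)
    have "t (c - Suc k) - t (c + 1 + Suc k) = D (c - Suc k) + (t (c - k) - t (c + 1 + k)) + D (c + Suc k)"
      using Suc.prems by (simp add: D_def Suc_diff_Suc)
    also have "\<dots> = (D (c - Suc k) + D (c + Suc k)) + (S (int k) + S (int k + 1)) * D c"
      using Suc by simp
    also have "\<dots> = (S (int k + 2) - S (int k)) * D c + (S (int k) + S (int k + 1)) * D c"
      using J[of "Suc k"] Suc.prems by (simp add: ac_simps)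
    finally show ?case by (simp add: algebra_simps)
  qed
  then show ?thesis unfolding od by (simp add: D_def)
qed

text \<open>The counterpart of \<open>gap_odd\<close> for gaps centred at an index. Here the
  symmetric pairs are multiples of the smallest such gap \<open>Y\<close>, with coefficients S(k +
  1) - S(k).\<close>

lemma gap_even:
  fixes c d k :: nat
  assumes q: "q \<noteq> 0" and b: "beta_recurrent d q t" and "1 \<le> c" and "c + 1 \<le> d"
    and "k \<le> c" and "c + k \<le> d"
  shows "t (c - k) - t (c + k) = qbracket q (2 * int k) * (t (c - 1) - t (c + 1))"
proof -
  define S where "S = (\<lambda>k. qbracket q (2 * k))"
  define l where "l = q + inverse q"
  define D where "D = (\<lambda>i. t i - t (i + 1))"
  define Y where "Y = D (c - 1) + D c"
  have S: "S 0 = 0" "S 1 = 1" by (simp_all add: S_def qbracket_even_0 qbracket_2[OF q])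
  have rec: "S (k + 2) = l * S (k + 1) - S k" for k
    using qbracket_even_rec[OF q, of "k + 1"] by (simp add: S_def l_def algebra_simps)
  have S2: "S 2 = l" using rec[of 0] S by simp
  have Drec: "D i + D (i + 2) = l * D (i + 1)" if "i + 3 \<le> d" for i
    using beta_recurrent_diffs[OF b that] by (simp add: D_def l_def add.assoc eval_nat_numeral)
  have J: "D (c - Suc k) + D (c + k) = (S (int k + 1) - S (int k)) * Y"
    if "Suc k \<le> c" "c + Suc k \<le> d" for k
    using that
  proof (induction k rule: induct_nat_012)
    case 0
    then show ?case by (simp add: S Y_def)
  next
    case 1
    have "D (c - 2) + D c = l * D (c - 1)"
      using Drec[of "c - 2"] 1 by (simp add: numeral_2_eq_2 Suc_diff_Suc)
    moreover have "D (c - 1) + D (c + 1) = l * D c"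
      using Drec[of "c - 1"] 1 by simp
    moreover have "D (c - 2) + D (c + 1) = (D (c - 2) + D c) + (D (c - 1) + D (c + 1)) - Y"
      by (simp add: Y_def)
    ultimately have "D (c - 2) + D (c + 1) = (l - 1) * Y"
      by (simp add: Y_def algebra_simps)
    then show ?case by (simp add: S S2 numeral_2_eq_2)
  next
    case (ge2 k)
    have "D (c - Suc (Suc (Suc k))) + D (c - Suc k) = l * D (c - Suc (Suc k))"
      using Drec[of "c - Suc (Suc (Suc k))"] ge2.prems by (simp add: Suc_diff_Suc numeral_2_eq_2)
    moreover have "D (c + k) + D (c + Suc (Suc k)) = l * D (c + Suc k)"
      using Drec[of "c + k"] ge2.prems by simp
    ultimately have "D (c - Suc (Suc (Suc k))) + D (c + Suc (Suc k))
      = l * (D (c - Suc (Suc k)) + D (c + Suc k)) - (D (c - Suc k) + D (c + k))"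
      by (simp add: algebra_simps)
    also have "\<dots> = l * ((S (int k + 2) - S (int k + 1)) * Y) - (S (int k + 1) - S (int k)) * Y"
      using ge2 by (simp add: ac_simps)
    also have "\<dots> = ((l * S (int k + 2) - S (int k + 1)) - (l * S (int k + 1) - S (int k))) * Y"
      by (simp add: algebra_simps)
    also have "\<dots> = (S (int k + 3) - S (int k + 2)) * Y"
      using rec[of "int k + 1"] rec[of "int k"] by (simp add: ac_simps)
    finally show ?case by (simp add: ac_simps)
  qed
  have "t (c - k) - t (c + k) = S (int k) * Y"
    using assms(5,6)
  proof (induction k)
    case 0
    then show ?case by (simp add: S)
  next
    case (Suc k)
    have "t (c - Suc k) - t (c + Suc k) = D (c - Suc k) + (t (c - k) - t (c + k)) + D (c + k)"
      using Suc.prems by (simp add: D_def Suc_diff_Suc)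
    also have "\<dots> = (D (c - Suc k) + D (c + k)) + S (int k) * Y"
      using Suc by simp
    also have "\<dots> = (S (int k + 1) - S (int k)) * Y + S (int k) * Y"
      using J[of k] Suc.prems by simp
    finally show ?case by (simp add: algebra_simps)
  qed
  then show ?thesis using assms(3) by (simp add: D_def Y_def S_def)
qed

text \<open>Both gaps have the same centre, so both are bracket multiples of the same smallest gap.
  Past the middle the sign changes on both sides, because the bracket is an odd function of its
  integer argument.\<close>

lemma gap_ratio:
  assumes q: "q \<noteq> 0" and b: "beta_recurrent d q t" and "i \<le> n" and "n \<le> d"
  shows "(t i - t (n - i)) * qbracket q (int n) = (t 0 - t n) * qbracket q (int n - 2 * int i)"
proof -
  have *: "(t i - t (n - i)) * qbracket q (int n) = (t 0 - t n) * qbracket q (int n - 2 * int i)"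
    if "2 * i \<le> n" for i
  proof (cases "even n")
    case True
    then obtain c where n: "n = 2 * c" by (elim evenE)
    show ?thesis
    proof (cases "c = 0")
      case True
      then show ?thesis using that n by simp
    next
      case False
      have i: "i \<le> c" using that n by simp
      have "t i - t (n - i) = qbracket q (int n - 2 * int i) * (t (c - 1) - t (c + 1))"
      proof -
        have e: "c - (c - i) = i" "c + (c - i) = n - i" "2 * int (c - i) = int n - 2 * int i"
          "1 \<le> c" "c + 1 \<le> d" "c - i \<le> c" "n - i \<le> d"
          using i n False assms(4) by auto
        show ?thesis using gap_even[OF q b e(4-6)] e(7) unfolding e(1-3) by blast
      qed
      moreover have "t 0 - t n = qbracket q (int n) * (t (c - 1) - t (c + 1))"
        using gap_even[OF q b, of c c] n False assms(4) by (simp flip: mult_2)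
      ultimately show ?thesis by simp
    qed
  next
    case False
    then obtain c where n: "n = 2 * c + 1" by (elim oddE)
    have i: "i \<le> c" using that n by simp
    have "t i - t (n - i) = qbracket q (int n - 2 * int i) * (t c - t (c + 1))"
    proof -
      have e: "c - (c - i) = i" "c + 1 + (c - i) = n - i" "2 * int (c - i) + 1 = int n - 2 * int i"
        "c - i \<le> c" "n - i \<le> d"
        using i n assms(4) by auto
      show ?thesis using gap_odd[OF q b e(4)] e(5) unfolding e(1-3) by blast
    qed
    moreover have "t 0 - t n = qbracket q (int n) * (t c - t (c + 1))"
      using gap_odd[OF q b, of c c] n assms(4) by (simp add: add.commute flip: mult_2)
    ultimately show ?thesis by simp
  qed
  show ?thesis
  proof (cases "2 * i \<le> n")
    case True
    then show ?thesis by (rule *)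
  next
    case False
    then have "(t (n - i) - t i) * qbracket q (int n) = (t 0 - t n) * qbracket q (2 * int i - int n)"
      using *[of "n - i"] assms(3) by (simp add: of_nat_diff algebra_simps)
    moreover have "qbracket q (2 * int i - int n) = - qbracket q (int n - 2 * int i)"
      using qbracket_minus[OF q, of "int n - 2 * int i"] by simp
    ultimately show ?thesis by (simp add: algebra_simps)
  qed
qed

text \<open>The bracket divides the gap \<open>t 0 - t n\<close>, which is nonzero because the
  eigenvalues are distinct.\<close>

lemma qbracket_nonzero:
  assumes q: "q \<noteq> 0" and b: "beta_recurrent d q t" and inj: "inj_on t {0..d}"
    and "1 \<le> n" and "n \<le> d"
  shows "qbracket q (int n) \<noteq> 0"
proof -
  have ne: "t 0 - t n \<noteq> 0" using inj assms(4,5) by (auto dest: inj_onD)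
  show ?thesis
  proof (cases "even n")
    case True
    then obtain c where n: "n = 2 * c" by (elim evenE)
    have "t 0 - t n = qbracket q (int n) * (t (c - 1) - t (c + 1))"
      using gap_even[OF q b, of c c] n assms(4,5) by (simp flip: mult_2)
    then show ?thesis using ne by auto
  next
    case False
    then obtain c where n: "n = 2 * c + 1" by (elim oddE)
    have "t 0 - t n = qbracket q (int n) * (t c - t (c + 1))"
      using gap_odd[OF q b, of c c] n assms(4,5) by (simp add: add.commute flip: mult_2)
    then show ?thesis using ne by auto
  qed
qed

section \<open>Bracket trinomials and Newton coefficients\<close>

lemma qfact_Suc: "qfact q (Suc n) = qfact q n * qbracket q (int (Suc n))"
  by (simp add: qfact_def)

text \<open>The value \<open>0\<close> prescribed at \<open>t = 0\<close> is the natural one: the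
  omitted term carries the factor [t], which vanishes there.\<close>

lemma qtri_recurrence:
  assumes q: "q \<noteq> 0" and nz: "\<And>i. 1 \<le> i \<Longrightarrow> i \<le> r + s + t \<Longrightarrow> qbracket q (int i) \<noteq> 0" and r: "r \<ge> 1"
  shows "qbracket q (int (r + t)) *
      (qtri q (r - 1) (s + 1) t - (if t = 0 then 0 else qtri q r (s + 1) (t - 1)))
    = qbracket q (int r - int t) * qtri q r s t"
proof -
  obtain r' where r': "r = Suc r'" using r by (cases r) auto
  have F: "qfact q n \<noteq> 0" if "n \<le> r + s + t" for n
    using that nz by (auto simp: qfact_def)
  \<comment> \<open>The factor common to the three trinomials; what is left of each is one term of
    \<open>qbracket_triple\<close>, up to the bracket of \<open>r + t\<close>.\<close>
  define M where "M = qfact q (r + s) * qfact q (r' + t) * qfact q (s + t) /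
    (qfact q r * qfact q (s + 1) * qfact q t * qfact q (r + s + t))"
  have a: "qtri q (r - 1) (s + 1) t = M * (qbracket q (int (s + t + 1)) * qbracket q (int r) * qpar q (r - 1) (s + 1) t)"
  proof -
    have "qfact q (s + 1 + t) = qfact q (s + t) * qbracket q (int (s + t + 1))"
      "qfact q r = qfact q r' * qbracket q (int r)" 
      by (simp_all add: qfact_Suc r')
    moreover have "qfact q r' \<noteq> 0" "qbracket q (int r) \<noteq> 0" using F nz[of r] r r' by auto
    ultimately show ?thesis using r' unfolding qtri_def M_def by (simp add: ac_simps)
  qed
  have b: "(if t = 0 then 0 else qtri q r (s + 1) (t - 1))
      = M * (qbracket q (int (r + s + 1)) * qbracket q (int t) * qpar q r (s + 1) (t - 1))"
  proof (cases t)
    case 0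
    then show ?thesis by (simp add: qbracket_even_0)
  next
    case (Suc t')
    have "qfact q (r + (s + 1)) = qfact q (r + s) * qbracket q (int (r + s + 1))"
      "qfact q t = qfact q t' * qbracket q (int t)" 
      by (simp_all add: qfact_Suc Suc)
    moreover have "qfact q t' \<noteq> 0" "qbracket q (int t) \<noteq> 0" using F nz[of t] Suc by auto
    ultimately show ?thesis using r' Suc unfolding qtri_def M_def by (simp add: ac_simps)
  qed
  have c: "qtri q r s t = M * (qbracket q (int (r + t)) * qbracket q (int (s + 1)) * qpar q r s t)"
  proof -
    have *: "qfact q (r + t) = qfact q (r' + t) * qbracket q (int (r + t))"
      "qfact q (s + 1) = qfact q s * qbracket q (int (s + 1))" 
      by (simp_all add: qfact_Suc r')
    have "qfact q s \<noteq> 0" "qbracket q (int (s + 1)) \<noteq> 0" using F nz[of "s + 1"] r r' by auto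
    then show ?thesis unfolding qtri_def M_def * by (simp add: ac_simps)
  qed
  show ?thesis unfolding a b c right_diff_distrib[symmetric] qbracket_triple[OF q r]
    by (simp add: algebra_simps)
qed

lemma qtri_0_mid:
  assumes "\<And>i. 1 \<le> i \<Longrightarrow> i \<le> r + t \<Longrightarrow> qbracket q (int i) \<noteq> 0"
  shows "qtri q r 0 t = 1"
proof -
  have F: "qfact q n \<noteq> 0" if "n \<le> r + t" for n
    using that assms by (auto simp: qfact_def)
  have "qfact q 0 = 1" by (simp add: qfact_def)
  then show ?thesis using F by (simp add: qtri_def qpar_def)
qed

text \<open>The coefficients of \<open>\<Prod>h=d-m+1..d. x - t h\<close> in the Newton basis \<open>\<Prod>h<k. x - t h\<close>.\<close>

fun newton_coeff :: "nat \<Rightarrow> (nat \<Rightarrow> 'c::comm_ring_1) \<Rightarrow> nat \<Rightarrow> nat \<Rightarrow> 'c" where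
  "newton_coeff d t 0 k = (if k = 0 then 1 else 0)"
| "newton_coeff d t (Suc m) k =
     (if k = 0 then 0 else newton_coeff d t m (k - 1)) + (t k - t (d - m)) * newton_coeff d t m k"

lemma newton_coeff_above: "m < k \<Longrightarrow> newton_coeff d t m k = 0"
  by (induction m arbitrary: k) auto

lemma newton_coeff_diag: "newton_coeff d t m m = 1"
  by (induction m) (auto simp: newton_coeff_above)

lemma newton_coeff_to_ac: "to_ac (newton_coeff d t m k) = newton_coeff d (\<lambda>i. to_ac (t i)) m k"
  by (induction m arbitrary: k) auto

text \<open>The new factor is split as x - t(d - m) = (x - t k) + (t k - t(d - m)). The first part
  turns the k-th Newton product into the next one, the second only rescales it.\<close>

lemma newton_expansion:
  assumes "m \<le> d"
  shows "(\<Prod>h=d-m+1..d. x - t h) = (\<Sum>k\<le>m. newton_coeff d t m k * (\<Prod>h<k. x - t h))"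
  using assms
proof (induction m)
  case 0
  then show ?case by simp
next
  case (Suc m)
  let ?c = "newton_coeff d t m" and ?p = "\<lambda>k. \<Prod>h<k. x - t h"
  have "{d - Suc m + 1..d} = insert (d - m) {d - m + 1..d}" using Suc.prems by auto
  then have "(\<Prod>h=d-Suc m+1..d. x - t h) = (x - t (d - m)) * (\<Sum>k\<le>m. ?c k * ?p k)"
    using Suc by simp
  also have "\<dots> = (\<Sum>k\<le>m. ?c k * ?p (Suc k) + (t k - t (d - m)) * ?c k * ?p k)"
    by (simp add: sum_distrib_left algebra_simps)
  also have "\<dots> = (\<Sum>k\<le>m. ?c k * ?p (Suc k)) + (\<Sum>k\<le>m. (t k - t (d - m)) * ?c k * ?p k)"
    by (simp add: sum.distrib)
  also have "(\<Sum>k\<le>m. ?c k * ?p (Suc k)) = (\<Sum>k\<le>Suc m. (if k = 0 then 0 else ?c (k - 1)) * ?p k)"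
    by (subst sum.atMost_Suc_shift) simp
  also have "(\<Sum>k\<le>m. (t k - t (d - m)) * ?c k * ?p k) = (\<Sum>k\<le>Suc m. (t k - t (d - m)) * ?c k * ?p k)"
    by (simp add: newton_coeff_above)
  finally show ?case by (simp add: sum.distrib[symmetric] distrib_right)
qed

text \<open>The arguments of \<open>qtri\<close> are \<open>d - m\<close>, the drop
  \<open>m - k\<close> in degree, and \<open>k\<close>. They always add up to \<open>d\<close>,
  which keeps every bracket in a denominator within the range where \<open>qbracket_nonzero\<close>
  applies.\<close>

lemma newton_coeff_eq_qtri:
  assumes q: "q \<noteq> 0" and b: "beta_recurrent d q t" and inj: "inj_on t {0..d}"
    and "m \<le> d" and "k \<le> m"
  shows "newton_coeff d t m k = (\<Prod>h=d-(m-k)+1..d. t 0 - t h) * qtri q (d - m) (m - k) k"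
  using assms(4,5)
proof (induction m arbitrary: k)
  case 0
  then show ?case using qtri_0_mid[of d 0 q] qbracket_nonzero[OF q b inj] by simp
next
  case (Suc m)
  have nz: "\<And>i. 1 \<le> i \<Longrightarrow> i \<le> d \<Longrightarrow> qbracket q (int i) \<noteq> 0"
    using qbracket_nonzero[OF q b inj] .
  show ?case
  proof (cases "k = Suc m")
    case True
    then show ?thesis using qtri_0_mid[of "d - Suc m" "Suc m" q] nz Suc.prems
      by (simp only: newton_coeff_diag) simp
  next
    case False
    then have km: "k \<le> m" using Suc.prems by simp
    define r s where "r = d - m" and "s = m - k"
    have r: "r \<ge> 1" and rst: "r + s + k = d" using Suc.prems km by (auto simp: r_def s_def)
    define P where "P = (\<Prod>h=d-s+1..d. t 0 - t h)"
    have "{d - (s + 1) + 1..d} = insert (d - s) {d - s + 1..d}" using rst r by auto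
    then have P': "(\<Prod>h=d-(s+1)+1..d. t 0 - t h) = (t 0 - t (d - s)) * P"
      by (simp add: P_def)
    have ds: "d - s = r + k" using rst by simp
    have c1: "newton_coeff d t m k = P * qtri q r s k"
      using Suc.IH[of k] Suc.prems km by (simp add: P_def r_def s_def)
    have c2: "(if k = 0 then 0 else newton_coeff d t m (k - 1)) =
       (t 0 - t (r + k)) * P * (if k = 0 then 0 else qtri q r (s + 1) (k - 1))"
    proof (cases "k = 0")
      case False
      have e: "m - (k - 1) = s + 1" using False km by (simp add: s_def)
      have "newton_coeff d t m (k - 1) = (\<Prod>h=d-(m-(k-1))+1..d. t 0 - t h) * qtri q (d - m) (m - (k - 1)) (k - 1)"
        using Suc.IH[of "k - 1"] Suc.prems km by simp
      then show ?thesis unfolding e P' using False ds by (simp add: r_def)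
    qed simp
    let ?N = "qbracket q (int (r + k))"
    define Z where "Z = (if k = 0 then 0 else qtri q r (s + 1) (k - 1))"
    have rk: "?N \<noteq> 0" using nz[of "r + k"] r rst by simp
    have ratio: "(t k - t r) * ?N = (t 0 - t (r + k)) * qbracket q (int r - int k)"
      using gap_ratio[OF q b, of k "r + k"] rst by (simp add: algebra_simps)
    have tri: "?N * (qtri q (r - 1) (s + 1) k - Z) = qbracket q (int r - int k) * qtri q r s k"
      unfolding Z_def using nz rst by (intro qtri_recurrence[OF q _ r]) simp
    \<comment> \<open>Multiplication by [r + k] makes \<open>gap_ratio\<close> and
      \<open>qtri_recurrence\<close> applicable without quotients; the factor is cancelled
      afterwards, as r + k lies between 1 and d.\<close>
    have "?N * ((t 0 - t (r + k)) * P * Z + (t k - t r) * (P * qtri q r s k))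
       = (t 0 - t (r + k)) * P * (?N * Z) + ((t k - t r) * ?N) * (P * qtri q r s k)"
      by (simp only: algebra_simps)
    also have "\<dots> = (t 0 - t (r + k)) * P * (?N * Z + qbracket q (int r - int k) * qtri q r s k)"
      unfolding ratio by (simp only: algebra_simps)
    also have "\<dots> = ?N * ((t 0 - t (r + k)) * P * qtri q (r - 1) (s + 1) k)"
      unfolding tri[symmetric] by (simp only: algebra_simps)
    finally have "(t 0 - t (r + k)) * P * Z + (t k - t r) * (P * qtri q r s k)
       = (t 0 - t (r + k)) * P * qtri q (r - 1) (s + 1) k"
      using mult_left_cancel[OF rk] by blast
    then have "newton_coeff d t (Suc m) k = (\<Prod>h=d-(s+1)+1..d. t 0 - t h) * qtri q (r - 1) (s + 1) k"
      unfolding P' ds newton_coeff.simps c1 c2 r_def[symmetric] Z_def .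
    moreover have "Suc m - k = s + 1" "d - Suc m = r - 1" using km by (auto simp: s_def r_def)
    ultimately show ?thesis by simp
  qed
qed

section \<open>Bases obtained from a diagonalizable operator\<close>

text \<open>The spanning set \<open>T\<close> bounds the dimension by d + 1, so d + 1 independent
  vectors already span: a vector outside their span would give d + 2 independent ones. Injectivity
  comes from the coefficients \<open>1\<close> and \<open>-1\<close> at two equal vectors.\<close>

lemma is_basisI:
  assumes "vector_space s" and "finite T" and "card T \<le> d + 1" and "module.span s T = UNIV"
    and zero: "\<And>c. (\<Sum>i\<le>d. s (c i) (u i)) = 0 \<Longrightarrow> \<forall>i\<le>d. c i = 0"
  shows "is_basis s d u"
proof -
  interpret vector_space s by fact
  have inj: "inj_on u {0..d}"
  proof (rule inj_onI, rule ccontr)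
    fix i j assume ij: "i \<in> {0..d}" "j \<in> {0..d}" "u i = u j" "i \<noteq> j"
    define c where "c = (\<lambda>k. if k = i then 1 else if k = j then - 1 else (0::'a))"
    have "(\<Sum>k\<le>d. s (c k) (u k)) = (\<Sum>k\<in>{i, j}. s (c k) (u k))"
      by (rule sum.mono_neutral_right) (use ij in \<open>auto simp: c_def\<close>)
    also have "\<dots> = 0" using ij by (simp add: c_def)
    finally show False using zero[of c] ij by (auto simp: c_def)
  qed
  have indep: "\<not> dependent (u ` {0..d})"
  proof
    assume "dependent (u ` {0..d})"
    then obtain c where c: "(\<Sum>v\<in>u ` {0..d}. s (c v) v) = 0" "\<exists>v\<in>u ` {0..d}. c v \<noteq> 0"
      using dependent_finite[of "u ` {0..d}"] by auto
    have "(\<Sum>i\<le>d. s (c (u i)) (u i)) = 0"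
      using c(1) sum.reindex[OF inj, of "\<lambda>v. s (c v) v"] by (simp add: atMost_atLeast0)
    from zero[OF this] c(2) show False by auto
  qed
  have "v \<in> span (u ` {0..d})" for v
  proof (rule ccontr)
    assume v: "v \<notin> span (u ` {0..d})"
    then have "\<not> dependent (insert v (u ` {0..d}))" using indep by (simp add: independent_insert)
    moreover have "insert v (u ` {0..d}) \<subseteq> span T" using assms(4) by simp
    ultimately have "card (insert v (u ` {0..d})) \<le> card T"
      using independent_span_bound[OF assms(2)] by blast
    moreover have "v \<notin> u ` {0..d}" using v span_base by blast
    ultimately show False using card_image[OF inj] assms(3) by simp
  qed
  then show ?thesis using inj indep by (auto simp: is_basis_def)
qed

lemma is_basis_rev:
  assumes "is_basis s d u"
  shows "is_basis s d (\<lambda>i. u (d - i))"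
proof -
  have "inj_on (\<lambda>i. d - i) {0..d}" by (auto intro!: inj_onI)
  moreover have im: "(\<lambda>i. d - i) ` {0..d} = {0..d}"
  proof -
    have "i \<in> (\<lambda>i. d - i) ` {0..d}" if "i \<le> d" for i
      using that by (intro image_eqI[of _ _ "d - i"]) auto
    then show ?thesis by auto
  qed
  ultimately have "inj_on (u \<circ> (\<lambda>i. d - i)) {0..d}"
    using assms by (intro comp_inj_on) (auto simp: is_basis_def)
  moreover have "(\<lambda>i. u (d - i)) ` {0..d} = u ` {0..d}"
    using im by (metis image_image)
  ultimately show ?thesis using assms by (simp add: is_basis_def comp_def)
qed

lemma is_basis_cong:
  assumes "is_basis s d u" and "\<And>i. i \<le> d \<Longrightarrow> v i = u i"
  shows "is_basis s d v"
proof -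
  have "v ` {0..d} = u ` {0..d}" using assms(2) by (auto simp: image_iff)
  moreover have "inj_on v {0..d} \<longleftrightarrow> inj_on u {0..d}" using assms(2) by (intro inj_on_cong) auto
  ultimately show ?thesis using assms(1) by (simp add: is_basis_def)
qed

text \<open>The counterpart of \<open>lin_prod\<close> for an operator on vectors. The last entry of
  the list acts first, which matters when the factors are peeled off one at a time.\<close>

definition lin_ops :: "('k \<Rightarrow> 'v::ab_group_add \<Rightarrow> 'v) \<Rightarrow> ('v \<Rightarrow> 'v) \<Rightarrow> (nat \<Rightarrow> 'k) \<Rightarrow> nat list \<Rightarrow> 'v \<Rightarrow> 'v" where
  "lin_ops s A t hs v = foldr (\<lambda>h v. A v - s (t h) v) hs v"

lemma lin_ops_Nil [simp]: "lin_ops s A t [] v = v"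
  and lin_ops_Cons: "lin_ops s A t (h # hs) v = A (lin_ops s A t hs v) - s (t h) (lin_ops s A t hs v)"
  and lin_ops_append: "lin_ops s A t (hs @ hs') v = lin_ops s A t hs (lin_ops s A t hs' v)"
  by (simp_all add: lin_ops_def)

lemma prod_list_distinct:
  fixes f :: "nat \<Rightarrow> 'c::comm_monoid_mult"
  shows "distinct hs \<Longrightarrow> (\<Prod>h\<leftarrow>hs. f h) = (\<Prod>h\<in>set hs. f h)"
  by (induction hs) auto

text \<open>Models the action of a multiplicity-free element: the \<open>E i\<close> are the
  projections onto its eigenlines. Because only operators are mentioned, the reversed eigenvalue
  order is another instance of the same locale.\<close>

locale spectral = vector_space scale
  for scale :: "'k::field \<Rightarrow> 'v::ab_group_add \<Rightarrow> 'v" +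
  fixes d :: nat and A :: "'v \<Rightarrow> 'v" and E :: "nat \<Rightarrow> 'v \<Rightarrow> 'v" and t :: "nat \<Rightarrow> 'k"
  assumes A_add: "A (u + v) = A u + A v" and A_scale: "A (scale c v) = scale c (A v)"
    and E_add: "E i (u + v) = E i u + E i v" and E_scale: "E i (scale c v) = scale c (E i v)"
    and E_E: "i \<le> d \<Longrightarrow> j \<le> d \<Longrightarrow> E i (E j v) = (if i = j then E i v else 0)"
    and sum_E: "(\<Sum>i\<le>d. E i v) = v"
    and A_E: "i \<le> d \<Longrightarrow> A (E i v) = scale (t i) (E i v)"
    and E_nonzero: "i \<le> d \<Longrightarrow> \<exists>v. E i v \<noteq> 0"
    and E_line: "i \<le> d \<Longrightarrow> E i u = u \<Longrightarrow> u \<noteq> 0 \<Longrightarrow> \<exists>c. E i v = scale c u"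
    and t_inj: "inj_on t {0..d}"
begin

lemma A_zero [simp]: "A 0 = 0" and E_zero [simp]: "E i 0 = 0"
  using A_scale[of 0 0] E_scale[of i 0 0] by simp_all

lemma E_diff: "E i (u - v) = E i u - E i v"
  using E_add[of i "u - v" v] by simp

lemma A_sum: "A (sum f I) = (\<Sum>j\<in>I. A (f j))" and E_sum: "E i (sum f I) = (\<Sum>j\<in>I. E i (f j))"
  by (induction I rule: infinite_finite_induct) (simp_all add: A_add E_add)

lemma E_A: "i \<le> d \<Longrightarrow> E i (A v) = scale (t i) (E i v)"
proof -
  assume i: "i \<le> d"
  have "E i (A v) = E i (A (\<Sum>j\<le>d. E j v))" by (simp add: sum_E)
  also have "\<dots> = (\<Sum>j\<le>d. if i = j then scale (t i) (E i v) else 0)"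
    unfolding A_sum E_sum using i by (intro sum.cong) (auto simp: A_E E_scale E_E)
  finally show ?thesis using i by (simp add: sum.delta)
qed

lemma E_eqI: "(\<And>i. i \<le> d \<Longrightarrow> E i u = E i v) \<Longrightarrow> u = v"
  using sum_E[of u] sum_E[of v] by (metis (no_types, lifting) atMost_iff sum.cong)

lemma t_diff: "i \<le> d \<Longrightarrow> j \<le> d \<Longrightarrow> i \<noteq> j \<Longrightarrow> t i - t j \<noteq> 0"
  using t_inj by (auto dest: inj_onD)

lemma E_ops: "i \<le> d \<Longrightarrow> E i (lin_ops scale A t hs v) = scale (\<Prod>h\<leftarrow>hs. t i - t h) (E i v)"
  by (induction hs) (auto simp: lin_ops_Cons E_diff E_A E_scale scale_left_diff_distrib left_diff_distrib)

lemma E_ops_distinct: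
  "i \<le> d \<Longrightarrow> distinct hs \<Longrightarrow> E i (lin_ops scale A t hs v) = scale (\<Prod>h\<in>set hs. t i - t h) (E i v)"
  by (simp add: E_ops prod_list_distinct)

lemma ops_add: "lin_ops scale A r hs (u + v) = lin_ops scale A r hs u + lin_ops scale A r hs v"
  and ops_scale: "lin_ops scale A r hs (scale c v) = scale c (lin_ops scale A r hs v)"
  by (induction hs) (simp_all add: lin_ops_Cons A_add A_scale scale_right_distrib scale_right_diff_distrib mult.commute)

lemma ops_sum: "lin_ops scale A r hs (sum f I) = (\<Sum>j\<in>I. lin_ops scale A r hs (f j))"
  using ops_scale[of r hs 0 0] by (induction I rule: infinite_finite_induct) (simp_all add: ops_add)

text \<open>The index \<open>n\<close> stands last in the list, so its factor acts first. All
  factors are polynomials in \<open>A\<close> and commute, so it may also act last; this is checked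
  on the components.\<close>

lemma ops_upt_Suc:
  "lin_ops scale A t [0..<Suc n] v = A (lin_ops scale A t [0..<n] v) - scale (t n) (lin_ops scale A t [0..<n] v)"
  by (rule E_eqI) (simp add: E_ops E_diff E_A E_scale scale_left_diff_distrib[symmetric] left_diff_distrib[symmetric] mult.commute)

lemma ops_rev_eq:
  assumes "distinct hs" and "distinct hs'" and "set hs' = (\<lambda>h. d - h) ` set hs" and "set hs \<subseteq> {0..d}"
  shows "lin_ops scale A (\<lambda>i. t (d - i)) hs v = lin_ops scale A t hs' v"
proof (rule E_eqI)
  fix i assume i: "i \<le> d"
  have "E i (lin_ops scale A (\<lambda>i. t (d - i)) hs v) = scale (\<Prod>h\<leftarrow>hs. t i - t (d - h)) (E i v)"
    using i by (induction hs) (auto simp: lin_ops_Cons E_diff E_A E_scale scale_left_diff_distrib left_diff_distrib)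
  also have "(\<Prod>h\<leftarrow>hs. t i - t (d - h)) = (\<Prod>h\<in>set hs. t i - t (d - h))"
    using assms(1) by (simp add: prod_list_distinct)
  also have "\<dots> = (\<Prod>h\<in>set hs'. t i - t h)"
  proof -
    have "inj_on (\<lambda>h. d - h) (set hs)"
      using assms(4) by (intro inj_onI) (metis atLeastAtMost_iff diff_diff_cancel subsetD)
    from prod.reindex[OF this, of "\<lambda>h. t i - t h"] show ?thesis by (simp add: assms(3))
  qed
  also have "scale \<dots> (E i v) = E i (lin_ops scale A t hs' v)"
    using i assms(2) by (simp add: E_ops_distinct)
  finally show "E i (lin_ops scale A (\<lambda>i. t (d - i)) hs v) = E i (lin_ops scale A t hs' v)" .
qed

lemma rev_image_upt: "i \<le> d \<Longrightarrow> set [d + 1 - i..<d + 1] = (\<lambda>h. d - h) ` set [0..<i]"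
proof -
  assume i: "i \<le> d"
  have "h \<in> (\<lambda>h. d - h) ` {0..<i}" if "d + 1 - i \<le> h" "h < d + 1" for h
    using that i by (intro image_eqI[of _ _ "d - h"]) auto
  then show ?thesis using i by auto
qed

lemma ops_rev_initial:
  assumes "i \<le> d"
  shows "lin_ops scale A (\<lambda>i. t (d - i)) [0..<i] v = lin_ops scale A t [d + 1 - i..<d + 1] v"
  by (rule ops_rev_eq) (use assms rev_image_upt[OF assms] in auto)

lemma ops_rev_final:
  assumes "i \<le> d"
  shows "lin_ops scale A (\<lambda>i. t (d - i)) [d + 1 - i..<d + 1] v = lin_ops scale A t [0..<i] v"
proof (rule ops_rev_eq)
  have "(\<lambda>h. d - h) ` set [d + 1 - i..<d + 1] = (\<lambda>h. d - (d - h)) ` set [0..<i]"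
    unfolding rev_image_upt[OF assms] image_image ..
  also have "\<dots> = set [0..<i]" using assms by (auto intro!: image_eqI)
  finally show "set [0..<i] = (\<lambda>h. d - h) ` set [d + 1 - i..<d + 1]" ..
qed (use assms in auto)

lemma spectral_rev: "spectral scale d A (\<lambda>i. E (d - i)) (\<lambda>i. t (d - i))"
proof
  fix v
  have "(\<Sum>i\<le>d. E (d - i) v) = (\<Sum>i\<le>d. E i v)"
    by (rule sum.reindex_bij_witness[of _ "\<lambda>i. d - i" "\<lambda>i. d - i"]) auto
  then show "(\<Sum>i\<le>d. E (d - i) v) = v" by (simp add: sum_E)
next
  show "inj_on (\<lambda>i. t (d - i)) {0..d}"
  proof (rule inj_onI)
    fix i j assume ij: "i \<in> {0..d}" "j \<in> {0..d}" "t (d - i) = t (d - j)"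
    then have "d - i = d - j" using inj_onD[OF t_inj ij(3)] by simp
    then show "i = j" using ij by auto
  qed
qed (auto simp: A_add A_scale E_add E_scale E_E A_E E_nonzero intro: E_line)

lemma finite_span:
  obtains T where "finite T" and "card T \<le> d + 1" and "span T = UNIV"
proof -
  have "\<exists>x. E i x = x \<and> x \<noteq> 0" if "i \<le> d" for i
    using E_nonzero[OF that] E_E[OF that that] by auto
  then obtain x where x: "\<And>i. i \<le> d \<Longrightarrow> E i (x i) = x i \<and> x i \<noteq> 0" by metis
  have "v \<in> span (x ` {0..d})" for v
  proof -
    have "E i v \<in> span (x ` {0..d})" if i: "i \<le> d" for i
    proof -
      obtain c where "E i v = scale c (x i)" using E_line[OF i, of "x i" v] x[OF i] by blast
      then show ?thesis using i by (auto intro!: span_scale intro: span_base)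
    qed
    then have "(\<Sum>i\<le>d. E i v) \<in> span (x ` {0..d})" by (intro span_sum) auto
    then show ?thesis by (simp add: sum_E)
  qed
  moreover have "card (x ` {0..d}) \<le> d + 1" using card_image_le[of "{0..d}" x] by simp
  ultimately show ?thesis using that[of "x ` {0..d}"] by auto
qed

text \<open>Forward substitution: in a vanishing combination, \<open>E i\<close> kills the vectors
  after the i-th, and the coefficients before it are zero by induction.\<close>

lemma triangular_basis:
  assumes "\<And>i. i \<le> d \<Longrightarrow> E i (u i) \<noteq> 0" and "\<And>i j. i \<le> d \<Longrightarrow> j < i \<Longrightarrow> E j (u i) = 0"
  shows "is_basis scale d u"
proof -
  obtain T where T: "finite T" "card T \<le> d + 1" "span T = UNIV" by (rule finite_span)
  show ?thesis
  proof (rule is_basisI[OF vector_space_axioms T])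
    fix c assume c: "(\<Sum>i\<le>d. scale (c i) (u i)) = 0"
    have "c i = 0" if "i \<le> d" for i
      using that
    proof (induction i rule: less_induct)
      case (less i)
      have "0 = E i (\<Sum>k\<le>d. scale (c k) (u k))" by (simp add: c)
      also have "\<dots> = (\<Sum>k\<le>d. scale (c k) (E i (u k)))" by (simp add: E_sum E_scale)
      also have "\<dots> = (\<Sum>k\<le>d. if k = i then scale (c i) (E i (u i)) else 0)"
        using less assms(2) by (intro sum.cong) (auto simp: not_less_iff_gr_or_eq neq_iff)
      also have "\<dots> = scale (c i) (E i (u i))" using less.prems by simp
      finally show ?case using assms(1)[OF less.prems] by simp
    qed
    then show "\<forall>i\<le>d. c i = 0" by blast
  qed
qed

context
  fixes x assumes cyclic: "\<And>i. i \<le> d \<Longrightarrow> E i x \<noteq> 0"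
begin

lemma basis_E: "is_basis scale d (\<lambda>i. E i x)"
  by (rule triangular_basis) (use cyclic in \<open>auto simp: E_E\<close>)

lemma basis_ops: "is_basis scale d (\<lambda>i. lin_ops scale A t [0..<i] x)"
proof (rule triangular_basis)
  fix i assume i: "i \<le> d"
  have "(\<Prod>h\<in>set [0..<i]. t i - t h) \<noteq> 0" using i t_diff by auto
  then show "E i (lin_ops scale A t [0..<i] x) \<noteq> 0"
    using i cyclic by (simp add: E_ops_distinct)
next
  fix i j assume "i \<le> d" "j < i"
  then show "E j (lin_ops scale A t [0..<i] x) = 0"
    by (auto simp: E_ops_distinct intro!: prod_zero)
qed

end

text \<open>Truncated at \<open>n\<close>, the expansion of \<open>E\<^sub>j\<close> in the \<open>\<tau>\<^sub>i\<close> is the Lagrange polynomial of the nodes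
  \<open>t 0, \<dots>, t n\<close>; this is what makes it provable by induction.\<close>

lemma lagrange_partial:
  assumes "j \<le> n" and "n \<le> d"
  shows "(\<Sum>i=j..n. entK t i j * (\<Prod>h<i. y - t h)) = (\<Prod>h\<in>{0..n}-{j}. (y - t h) / (t j - t h))"
  using assms
proof (induction n rule: dec_induct)
  case base
  have "{0..j} - {j} = {..<j}" by auto
  then show ?case by (simp add: entK_def prod_dividef)
next
  case (step n)
  let ?R = "\<lambda>n. \<Prod>h\<in>{0..n}-{j}. (y - t h) / (t j - t h)"
  have ne: "t j - t (Suc n) \<noteq> 0" using step by (intro t_diff) auto
  have s: "{0..Suc n} - {j} = insert (Suc n) ({0..n} - {j})" using step by auto
  have R: "?R (Suc n) = (y - t (Suc n)) / (t j - t (Suc n)) * ?R n"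
    unfolding s by (subst prod.insert) auto
  have K: "entK t (Suc n) j = 1 / (\<Prod>h\<in>{0..n}-{j}. t j - t h) / (t j - t (Suc n))"
  proof -
    have a: "{0..n} - {j} = {..<j} \<union> {j+1..n}" using step by auto
    have "(\<Prod>h\<in>{0..n}-{j}. t j - t h) = (\<Prod>h<j. t j - t h) * (\<Prod>h=j+1..n. t j - t h)"
      unfolding a by (rule prod.union_disjoint) auto
    moreover have "{j+1..Suc n} = insert (Suc n) {j+1..n}" using step by auto
    ultimately show ?thesis by (simp add: entK_def)
  qed
  have P: "(\<Prod>h<Suc n. y - t h) = (y - t j) * (\<Prod>h\<in>{0..n}-{j}. y - t h)"
  proof -
    have "{..<Suc n} = insert j ({0..n} - {j})" using step by auto
    then show ?thesis by (simp only:) (rule prod.insert, auto)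
  qed
  have "entK t (Suc n) j * (\<Prod>h<Suc n. y - t h) = (y - t j) / (t j - t (Suc n)) * ?R n"
    unfolding K P prod_dividef by simp
  moreover have "(\<Sum>i=j..Suc n. entK t i j * (\<Prod>h<i. y - t h))
      = ?R n + entK t (Suc n) j * (\<Prod>h<Suc n. y - t h)"
    using step by simp
  moreover have "?R n + (y - t j) / (t j - t (Suc n)) * ?R n = (y - t (Suc n)) / (t j - t (Suc n)) * ?R n"
    using ne by (simp add: divide_simps) (simp add: algebra_simps)
  ultimately show ?case using R by simp
qed

text \<open>At the full length \<open>n = d\<close> and at a node \<open>y = t k\<close>, the
  Lagrange polynomial of \<open>lagrange_partial\<close> is the Kronecker delta, and so is the
  action of \<open>E j\<close> on the k-th component.\<close>

lemma E_expansion: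
  assumes j: "j \<le> d"
  shows "E j x = (\<Sum>i\<le>d. scale (if j \<le> i then entK t i j else 0) (lin_ops scale A t [0..<i] x))"
proof (rule E_eqI)
  fix k assume k: "k \<le> d"
  have "E k (\<Sum>i\<le>d. scale (if j \<le> i then entK t i j else 0) (lin_ops scale A t [0..<i] x))
    = (\<Sum>i\<le>d. scale ((if j \<le> i then entK t i j else 0) * (\<Prod>h<i. t k - t h)) (E k x))"
    using k by (simp add: E_sum E_scale E_ops_distinct lessThan_atLeast0)
  also have "\<dots> = scale (\<Sum>i\<le>d. (if j \<le> i then entK t i j else 0) * (\<Prod>h<i. t k - t h)) (E k x)"
    by (simp add: scale_sum_left)
  also have "(\<Sum>i\<le>d. (if j \<le> i then entK t i j else 0) * (\<Prod>h<i. t k - t h))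
    = (\<Sum>i=j..d. entK t i j * (\<Prod>h<i. t k - t h))"
    by (rule sum.mono_neutral_cong_right) auto
  also have "\<dots> = (\<Prod>h\<in>{0..d}-{j}. (t k - t h) / (t j - t h))"
    using j by (rule lagrange_partial) simp
  also have "\<dots> = (if j = k then 1 else 0)"
  proof (cases "j = k")
    case True
    then show ?thesis using t_diff[OF k] by (auto intro!: prod.neutral)
  next
    case False
    then have "(\<Prod>h\<in>{0..d}-{j}. (t k - t h) / (t j - t h)) = 0"
      using k by (intro prod_zero) (auto intro!: bexI[of _ k])
    then show ?thesis using False by simp
  qed
  finally show "E k (E j x) = E k (\<Sum>i\<le>d. scale (if j \<le> i then entK t i j else 0) (lin_ops scale A t [0..<i] x))"
    using j k by (simp add: E_E)
qed

lemma ops_expansion: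
  "lin_ops scale A t [0..<j] x = (\<Sum>i\<le>d. scale (if j \<le> i then ent_up t i j else 0) (E i x))"
proof -
  have "lin_ops scale A t [0..<j] x = (\<Sum>i\<le>d. E i (lin_ops scale A t [0..<j] x))"
    by (simp add: sum_E)
  also have "\<dots> = (\<Sum>i\<le>d. scale (if j \<le> i then ent_up t i j else 0) (E i x))"
    by (rule sum.cong) (auto simp: E_ops_distinct ent_up_def lessThan_atLeast0 intro!: prod_zero)
  finally show ?thesis .
qed

lemma ops_final_expansion:
  assumes "j \<le> d"
  shows "lin_ops scale A t [d + 1 - (d - j)..<d + 1] x =
    (\<Sum>i\<le>d. scale (if j \<le> i then newton_coeff d t (d - j) (d - i) else 0) (lin_ops scale A t [0..<d - i] x))"
proof (rule E_eqI)
  fix k assume k: "k \<le> d"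
  have "E k (\<Sum>i\<le>d. scale (if j \<le> i then newton_coeff d t (d - j) (d - i) else 0) (lin_ops scale A t [0..<d - i] x))
    = scale (\<Sum>i\<le>d. (if j \<le> i then newton_coeff d t (d - j) (d - i) else 0) * (\<Prod>h<d - i. t k - t h)) (E k x)"
    using k by (simp add: E_sum E_scale E_ops_distinct lessThan_atLeast0 scale_sum_left)
  also have "(\<Sum>i\<le>d. (if j \<le> i then newton_coeff d t (d - j) (d - i) else 0) * (\<Prod>h<d - i. t k - t h))
    = (\<Sum>i=j..d. newton_coeff d t (d - j) (d - i) * (\<Prod>h<d - i. t k - t h))"
    by (rule sum.mono_neutral_cong_right) auto
  also have "\<dots> = (\<Sum>l\<le>d-j. newton_coeff d t (d - j) l * (\<Prod>h<l. t k - t h))"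
    by (rule sum.reindex_bij_witness[of _ "\<lambda>l. d - l" "\<lambda>i. d - i"]) (use assms in auto)
  also have "\<dots> = (\<Prod>h=d-(d-j)+1..d. t k - t h)"
    by (rule newton_expansion[symmetric]) simp
  also have "\<dots> = (\<Prod>h\<in>set [d + 1 - (d - j)..<d + 1]. t k - t h)"
    using assms by (intro prod.cong) auto
  finally show "E k (lin_ops scale A t [d + 1 - (d - j)..<d + 1] x) =
     E k (\<Sum>i\<le>d. scale (if j \<le> i then newton_coeff d t (d - j) (d - i) else 0) (lin_ops scale A t [0..<d - i] x))"
    using k by (simp only: E_ops_distinct distinct_upt)
qed

end

section \<open>Leonard pairs of operators\<close>

text \<open>The axioms are symmetric in the two operators and invariant under reversal of an order.
  Hence \<open>leonard_dual\<close> and \<open>leonard_rev\<close> carry every result below over to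
  the relatives of a Leonard system.\<close>

locale leonard = a: spectral scale d A E t + b: spectral scale d B F r
  for scale :: "'k::field \<Rightarrow> 'v::ab_group_add \<Rightarrow> 'v" and d A E t B F r +
  assumes E_tridiag: "i \<le> d \<Longrightarrow> j \<le> d \<Longrightarrow> Suc i < j \<or> Suc j < i \<Longrightarrow> E i (B (E j v)) = 0"
    and E_tridiag_nz: "i \<le> d \<Longrightarrow> j \<le> d \<Longrightarrow> Suc i = j \<or> Suc j = i \<Longrightarrow> \<exists>v. E i (B (E j v)) \<noteq> 0"
    and F_tridiag: "i \<le> d \<Longrightarrow> j \<le> d \<Longrightarrow> Suc i < j \<or> Suc j < i \<Longrightarrow> F i (A (F j v)) = 0"
    and F_tridiag_nz: "i \<le> d \<Longrightarrow> j \<le> d \<Longrightarrow> Suc i = j \<or> Suc j = i \<Longrightarrow> \<exists>v. F i (A (F j v)) \<noteq> 0"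
begin

lemma leonard_dual: "leonard scale d B F r A E t"
  by (intro leonard.intro leonard_axioms.intro a.spectral_axioms b.spectral_axioms)
    (fact F_tridiag F_tridiag_nz E_tridiag E_tridiag_nz)+

lemma leonard_rev: "leonard scale d A (\<lambda>i. E (d - i)) (\<lambda>i. t (d - i)) B F r"
  by (intro leonard.intro leonard_axioms.intro a.spectral_rev b.spectral_axioms)
    (use F_tridiag F_tridiag_nz in \<open>auto intro!: E_tridiag E_tridiag_nz\<close>)

text \<open>Tridiagonality means that \<open>A\<close> raises the largest \<open>F\<close>-index
  occurring in a vector by at most one, and that the new top component depends on the old top
  component alone.\<close>

lemma F_A_component:
  assumes "i \<le> d" and "\<And>j. j \<le> d \<Longrightarrow> n < j \<Longrightarrow> F j w = 0" and "n < i"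
  shows "F i (A w) = (if i = Suc n then F i (A (F n w)) else 0)"
proof -
  have "F i (A w) = F i (A (\<Sum>j\<le>d. F j w))" by (simp add: b.sum_E)
  also have "\<dots> = (\<Sum>j\<le>d. F i (A (F j w)))" by (simp add: a.A_sum b.E_sum)
  also have "\<dots> = (\<Sum>j\<le>d. if j = n then (if i = Suc n then F i (A (F n w)) else 0) else 0)"
  proof (rule sum.cong[OF refl])
    fix j assume "j \<in> {..d}"
    then have j: "j \<le> d" by simp
    consider "n < j" | "j = n" | "j < n" by linarith
    then show "F i (A (F j w)) = (if j = n then (if i = Suc n then F i (A (F n w)) else 0) else 0)"
      by cases (use assms j in \<open>auto simp: F_tridiag\<close>)
  qed
  also have "\<dots> = (if i = Suc n then F i (A (F n w)) else 0)" using assms by (simp add: sum.delta)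
  finally show ?thesis .
qed

text \<open>The axiom supplies one vector with nonzero image. Since the image of \<open>F j\<close>
  is a line, every nonzero vector of it will do.\<close>

lemma F_A_F_nonzero:
  assumes "i \<le> d" and "j \<le> d" and "Suc i = j \<or> Suc j = i" and "F j w \<noteq> 0"
  shows "F i (A (F j w)) \<noteq> 0"
proof
  assume 0: "F i (A (F j w)) = 0"
  obtain v where v: "F i (A (F j v)) \<noteq> 0" using F_tridiag_nz assms by blast
  obtain c where "F j v = scale c (F j w)"
    using b.E_line[OF assms(2), of "F j w" v] assms(2,4) by (auto simp: b.E_E)
  then show False using v 0 by (simp add: a.A_scale b.E_scale)
qed

context
  fixes x assumes x_fix: "F 0 x = x" and x_nz: "x \<noteq> 0"
begin

lemma F_x: "i \<le> d \<Longrightarrow> i \<noteq> 0 \<Longrightarrow> F i x = 0"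
  using b.E_E[of i 0 x] x_fix by simp

lemma F_ops_above: "i \<le> d \<Longrightarrow> length hs < i \<Longrightarrow> F i (lin_ops scale A z hs x) = 0"
proof (induction hs arbitrary: i)
  case Nil
  then show ?case by (simp add: F_x)
next
  case (Cons h hs)
  then show ?case
    by (simp add: lin_ops_Cons b.E_diff b.E_scale F_A_component[where n = "length hs"])
qed

lemma F_ops_top: "length hs \<le> d \<Longrightarrow> F (length hs) (lin_ops scale A z hs x) \<noteq> 0"
proof (induction hs)
  case Nil
  then show ?case by (simp add: x_fix x_nz)
next
  case (Cons h hs)
  let ?w = "lin_ops scale A z hs x"
  have "F (Suc (length hs)) (A ?w) = F (Suc (length hs)) (A (F (length hs) ?w))"
    using Cons.prems by (subst F_A_component[where n = "length hs"]) (auto intro: F_ops_above)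
  moreover have "\<dots> \<noteq> 0" using Cons by (intro F_A_F_nonzero) auto
  ultimately show ?case using Cons.prems by (simp add: lin_ops_Cons b.E_diff b.E_scale F_ops_above)
qed

lemma F_ops_top_indep:
  "length hs \<le> d \<Longrightarrow> length hs' = length hs \<Longrightarrow>
     F (length hs) (lin_ops scale A z hs x) = F (length hs) (lin_ops scale A z' hs' x)"
proof (induction hs arbitrary: hs')
  case Nil
  then show ?case by simp
next
  case (Cons h hs)
  obtain h' hs'' where hs': "hs' = h' # hs''" "length hs'' = length hs"
    using Cons.prems(2) by (cases hs') auto
  let ?n = "length hs"
  have top: "F (Suc ?n) (lin_ops scale A y (k # ks) x) = F (Suc ?n) (A (F ?n (lin_ops scale A y ks x)))"
    if "length ks = ?n" for y k ks
    using Cons.prems that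
    by (simp add: lin_ops_Cons b.E_diff b.E_scale F_ops_above F_A_component[where n = ?n])
  have "F ?n (lin_ops scale A z hs x) = F ?n (lin_ops scale A z' hs'' x)"
    by (rule Cons.IH) (use Cons.prems hs' in auto)
  then show ?case unfolding hs'(1) using top[of hs z h] top[of hs'' z' h'] hs'(2) by simp
qed

section \<open>The split basis and the lowering action of the second operator\<close>

abbreviation u where "u n \<equiv> lin_ops scale A t [0..<n] x"

lemma F_u_above: "i \<le> d \<Longrightarrow> n < i \<Longrightarrow> F i (u n) = 0"
  and F_u_top: "n \<le> d \<Longrightarrow> F n (u n) \<noteq> 0"
  using F_ops_above[of i "[0..<n]" t] F_ops_top[of "[0..<n]" t] by auto

text \<open>Elimination from the top: the highest remaining \<open>F\<close>-component lies on a
  line and is removed by a multiple of the vector \<open>u n\<close> with that top index.\<close>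

lemma expand:
  assumes "n \<le> d + 1" and "\<And>k. k \<le> d \<Longrightarrow> n \<le> k \<Longrightarrow> F k v = 0"
  shows "\<exists>c. v = (\<Sum>k<n. scale (c k) (u k))"
  using assms
proof (induction n arbitrary: v)
  case 0
  have "v = 0" by (rule b.E_eqI) (use 0 in auto)
  then show ?case by simp
next
  case (Suc n)
  have n: "n \<le> d" using Suc.prems by simp
  obtain c where c: "F n v = scale c (F n (u n))"
    using b.E_line[OF n, of "F n (u n)" v] F_u_top[OF n] n by (auto simp: b.E_E)
  have "F k (v - scale c (u n)) = 0" if "k \<le> d" "n \<le> k" for k
  proof (cases "k = n")
    case True
    then show ?thesis by (simp add: b.E_diff b.E_scale c)
  next
    case False
    then show ?thesis using that Suc.prems by (simp add: b.E_diff b.E_scale F_u_above)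
  qed
  then obtain c' where c': "v - scale c (u n) = (\<Sum>k<n. scale (c' k) (u k))"
    using Suc.IH[of "v - scale c (u n)"] n by auto
  have "v = (v - scale c (u n)) + scale c (u n)" by simp
  also have "\<dots> = (\<Sum>k<n. scale ((c'(n := c)) k) (u k)) + scale c (u n)"
    unfolding c' by simp
  also have "\<dots> = (\<Sum>k<Suc n. scale ((c'(n := c)) k) (u k))" by simp
  finally show ?case by blast
qed

text \<open>By \<open>expand\<close> every vector is a polynomial in \<open>A\<close> applied to
  \<open>x\<close>. If \<open>E i x\<close> vanished, \<open>E i\<close> would therefore vanish
  identically.\<close>

lemma E_x_nonzero: "i \<le> d \<Longrightarrow> E i x \<noteq> 0"
proof
  assume i: "i \<le> d" and 0: "E i x = 0"
  obtain v where v: "E i v \<noteq> 0" using a.E_nonzero[OF i] by blast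
  obtain c where "v = (\<Sum>k<d+1. scale (c k) (u k))" using expand[of "d + 1" v] by auto
  then have "E i v = 0" using i 0 by (simp add: a.E_add a.E_sum a.E_scale a.E_ops)
  then show False using v by simp
qed

lemma E_u_below: "i \<le> d \<Longrightarrow> i < n \<Longrightarrow> E i (u n) = 0"
  by (auto simp: a.E_ops_distinct intro!: prod_zero)

lemma E_u_diag: "i \<le> d \<Longrightarrow> E i (u i) \<noteq> 0"
  using a.t_diff by (auto simp: a.E_ops_distinct E_x_nonzero)

text \<open>Expanded in the first \<open>n\<close> vectors \<open>u k\<close>, the conditions on the
  \<open>E\<close>-components form a triangular system with nonzero diagonal. Geometrically, the
  flags built from the \<open>F\<close>-lines upwards and from the \<open>E\<close>-lines downwards
  are opposite.\<close>

lemma flags_meet_trivially: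
  assumes "n \<le> d + 1" and "\<And>k. k \<le> d \<Longrightarrow> n \<le> k \<Longrightarrow> F k v = 0"
    and "\<And>h. h < n \<Longrightarrow> E h v = 0"
  shows "v = 0"
proof -
  obtain c where c: "v = (\<Sum>k<n. scale (c k) (u k))" using expand assms(1,2) by blast
  have "c h = 0" if "h < n" for h
    using that
  proof (induction h rule: less_induct)
    case (less h)
    have h: "h \<le> d" using less.prems assms(1) by simp
    have "E h v = (\<Sum>k<n. scale (c k) (E h (u k)))" by (simp add: c a.E_sum a.E_scale)
    also have "\<dots> = (\<Sum>k<n. if k = h then scale (c h) (E h (u h)) else 0)"
    proof (rule sum.cong[OF refl])
      fix k assume "k \<in> {..<n}"
      then show "scale (c k) (E h (u k)) = (if k = h then scale (c h) (E h (u h)) else 0)"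
        using less h E_u_below[of h k] by (cases "k < h"; cases "k = h") auto
    qed
    also have "\<dots> = scale (c h) (E h (u h))" using less.prems by simp
    finally show ?case using assms(3)[OF less.prems] E_u_diag[OF h] by simp
  qed
  then show ?thesis using c by simp
qed

text \<open>Subtracting \<open>r i\<close> removes the top \<open>F\<close>-component, and
  tridiagonality of \<open>B\<close> leaves no \<open>E\<close>-component below
  \<open>i - 1\<close>. After a multiple of \<open>u (i - 1)\<close> is taken away, the rest lies in
  two opposite flags and is zero. The multiple is nonzero because \<open>B\<close> connects
  neighbouring \<open>E\<close>-lines.\<close>

lemma lowering:
  assumes "1 \<le> i" and "i \<le> d"
  shows "\<exists>c. c \<noteq> 0 \<and> B (u i) - scale (r i) (u i) = scale c (u (i - 1))"
proof -
  let ?w = "B (u i) - scale (r i) (u i)"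
  interpret dual: leonard scale d B F r A E t by (rule leonard_dual)
  have E_below: "E h (B (u i)) = (if Suc h = i then E h (B (E i (u i))) else 0)" if "h < i" for h
  proof -
    have h: "h \<le> d" using that assms by simp
    have "E h (B (u i)) = E h (B (\<Sum>j\<le>d. E j (u i)))" by (simp add: a.sum_E)
    also have "\<dots> = (\<Sum>j\<le>d. E h (B (E j (u i))))" by (simp add: a.E_sum b.A_sum)
    also have "\<dots> = (\<Sum>j\<le>d. if j = i then (if Suc h = i then E h (B (E i (u i))) else 0) else 0)"
    proof (rule sum.cong[OF refl])
      fix j assume "j \<in> {..d}"
      then have j: "j \<le> d" by simp
      consider "j < i" | "j = i" | "j > i" by linarith
      then show "E h (B (E j (u i))) = (if j = i then (if Suc h = i then E h (B (E i (u i))) else 0) else 0)"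
        by cases (use that j h E_u_below[of j i] in \<open>auto simp: E_tridiag\<close>)
    qed
    finally show ?thesis using assms by (simp add: sum.delta)
  qed
  have im: "i - 1 \<le> d" "Suc (i - 1) = i" using assms by auto
  have w_nz: "E (i - 1) ?w \<noteq> 0"
  proof -
    have "E (i - 1) (B (E i (u i))) \<noteq> 0"
      using dual.F_A_F_nonzero[of "i - 1" i "u i"] im assms E_u_diag by blast
    then show ?thesis using E_below[of "i - 1"] im assms by (simp add: a.E_diff a.E_scale E_u_below)
  qed
  obtain c where c: "E (i - 1) ?w = scale c (E (i - 1) (u (i - 1)))"
    using a.E_line[OF im(1), of "E (i - 1) (u (i - 1))" ?w] E_u_diag[OF im(1)] im by (auto simp: a.E_E)
  have "?w - scale c (u (i - 1)) = 0"
  proof (rule flags_meet_trivially)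
    show "i \<le> d + 1" using assms by simp
    fix k assume k: "k \<le> d" "i \<le> k"
    have "F k ?w = 0" using k F_u_above[of k i] by (cases "k = i") (auto simp: b.E_diff b.E_A b.E_scale)
    then show "F k (?w - scale c (u (i - 1))) = 0"
      using k im F_u_above[of k "i - 1"] by (simp add: b.E_diff[of k ?w] b.E_scale)
  next
    fix h assume h: "h < i"
    show "E h (?w - scale c (u (i - 1))) = 0"
    proof (cases "Suc h = i")
      case True
      then have "h = i - 1" by simp
      then show ?thesis using c by (simp add: a.E_diff[of _ ?w] a.E_scale)
    next
      case False
      then have "h < i - 1" using h by simp
      then show ?thesis using h assms False E_below[OF h] by (simp add: a.E_diff a.E_scale E_u_below)
    qed
  qed
  then have "?w = scale c (u (i - 1))" by (simp only: right_minus_eq)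
  moreover have "c \<noteq> 0" using w_nz c by auto
  ultimately show ?thesis by blast
qed

text \<open>Applying \<open>A - t (i - 1)\<close> to the relation shows that
  \<open>(A - t (i - 1)) (B - r i)\<close> acts on \<open>u i\<close> as the scalar of the split
  sequence. The one-step form is preferred because it can be iterated.\<close>

definition split_scalars :: "(nat \<Rightarrow> 'k) \<Rightarrow> bool" where
  "split_scalars \<phi> \<longleftrightarrow> (\<forall>i. 1 \<le> i \<longrightarrow> i \<le> d \<longrightarrow>
     \<phi> i \<noteq> 0 \<and> B (u i) - scale (r i) (u i) = scale (\<phi> i) (u (i - 1)))"

text \<open>The vanishing conditions on \<open>v\<close> describe the split space, which contains
  \<open>u i\<close>. There \<open>lowering\<close> provides some nonzero scalar, and since
  \<open>A - t (i - 1)\<close> maps \<open>u (i - 1)\<close> to \<open>u i\<close>, that scalar must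
  be the given one.\<close>

lemma split_scalarsI:
  assumes "\<And>i v. 1 \<le> i \<Longrightarrow> i \<le> d \<Longrightarrow> (\<And>k. k \<le> d \<Longrightarrow> i < k \<Longrightarrow> F k v = 0) \<Longrightarrow>
      (\<And>h. h < i \<Longrightarrow> E h v = 0) \<Longrightarrow>
      A (B v - scale (r i) v) - scale (t (i - 1)) (B v - scale (r i) v) = scale (\<phi> i) v"
  shows "split_scalars \<phi>"
  unfolding split_scalars_def
proof (intro allI impI)
  fix i assume i: "1 \<le> i" "i \<le> d"
  obtain c where c: "c \<noteq> 0" "B (u i) - scale (r i) (u i) = scale c (u (i - 1))"
    using lowering[OF i] by blast
  obtain i' where i': "i = Suc i'" using i by (cases i) auto
  have "A (scale c (u (i - 1))) - scale (t (i - 1)) (scale c (u (i - 1))) = scale (\<phi> i) (u i)"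
    unfolding c(2)[symmetric] by (rule assms) (use i F_u_above E_u_below in auto)
  moreover have "u i = A (u (i - 1)) - scale (t (i - 1)) (u (i - 1))"
    unfolding i' by (simp add: a.ops_upt_Suc del: upt_Suc)
  ultimately have "scale c (u i) = scale (\<phi> i) (u i)"
    by (simp add: a.A_scale a.scale_right_diff_distrib mult.commute)
  moreover have "u i \<noteq> 0" using F_u_top[OF i(2)] by auto
  ultimately have "\<phi> i = c" by simp
  then show "\<phi> i \<noteq> 0 \<and> B (u i) - scale (r i) (u i) = scale (\<phi> i) (u (i - 1))" using c by simp
qed

lemma B_u:
  assumes "split_scalars \<phi>" and "k \<le> d"
  shows "B (u k) = scale (r k) (u k) + (if k = 0 then 0 else scale (\<phi> k) (u (k - 1)))"
proof (cases "k = 0")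
  case True
  then show ?thesis using b.A_E[of 0 x] x_fix by simp
next
  case False
  then have "B (u k) - scale (r k) (u k) = scale (\<phi> k) (u (k - 1))"
    using assms by (simp add: split_scalars_def)
  then show ?thesis using False by (simp add: diff_eq_eq add.commute)
qed

text \<open>The factors with indices d, d - 1, ..., i + 1 act in this order, and each meets exactly
  the vector \<open>u h\<close> that it lowers to a multiple of \<open>u (h - 1)\<close>.\<close>

lemma split_descent:
  assumes \<phi>: "split_scalars \<phi>" and y: "y = scale c (u d)" and "i \<le> d"
  shows "lin_ops scale B r [i+1..<d+1] y = scale (c * (\<Prod>h=i+1..d. \<phi> h)) (u i)"
  using assms(3)
proof (induction i rule: inc_induct)
  case base
  then show ?case by (simp add: y)
next
  case (step n)
  have "[n+1..<d+1] = (n + 1) # [Suc n + 1..<d+1]" using step by (simp add: upt_conv_Cons)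
  moreover have "B (u (Suc n)) - scale (r (Suc n)) (u (Suc n)) = scale (\<phi> (Suc n)) (u n)"
    using \<phi> step by (simp add: split_scalars_def del: upt_Suc)
  moreover have "{n+1..d} = insert (n + 1) {Suc n + 1..d}" using step by auto
  ultimately show ?case using step.IH
    by (simp add: lin_ops_Cons b.A_scale a.scale_right_diff_distrib[symmetric] mult.commute mult.left_commute
        a.scale_left_commute[of "r _"] del: upt_Suc a.scale_scale)
     (simp add: ac_simps)
qed

text \<open>A biorthogonality relation. On \<open>u k\<close> the factor \<open>B - r i\<close>,
  which acts first, gives \<open>r k - r i\<close> times \<open>u k\<close> plus a multiple of
  \<open>u (k - 1)\<close>. By induction only \<open>k = i\<close> and \<open>k = i + 1\<close>
  could contribute, and for \<open>k = i\<close> the coefficient vanishes.\<close>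

lemma E0_ops_u:
  assumes \<phi>: "split_scalars \<phi>" and "i \<le> d" and "k \<le> d"
  shows "E 0 (lin_ops scale B r [0..<i] (u k)) = (if i = k then scale (\<Prod>h=1..i. \<phi> h) (E 0 x) else 0)"
  using assms(2,3)
proof (induction i arbitrary: k)
  case 0
  then show ?case by (auto simp: E_u_below)
next
  case (Suc i)
  let ?g = "\<lambda>v. E 0 (lin_ops scale B r [0..<i] v)"
  have "B (u k) - scale (r i) (u k)
      = scale (r k - r i) (u k) + (if k = 0 then 0 else scale (\<phi> k) (u (k - 1)))"
    unfolding B_u[OF \<phi> Suc.prems(2)] by (simp add: a.scale_left_diff_distrib)
  then have "?g (B (u k) - scale (r i) (u k))
      = ?g (scale (r k - r i) (u k) + (if k = 0 then 0 else scale (\<phi> k) (u (k - 1))))"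
    by (simp only:)
  also have "\<dots> = scale (r k - r i) (?g (u k)) + (if k = 0 then 0 else scale (\<phi> k) (?g (u (k - 1))))"
    using b.ops_scale[of r "[0..<i]" 0 0] by (simp add: b.ops_add b.ops_scale a.E_add a.E_scale)
  also have "\<dots> = (if Suc i = k then scale (\<Prod>h=1..Suc i. \<phi> h) (E 0 x) else 0)"
    using Suc.IH[of k] Suc.IH[of "k - 1"] Suc.prems by (cases k) (auto simp: mult.commute)
  finally show ?case by (simp add: lin_ops_append lin_ops_Cons)
qed

text \<open>The dual system has the same split scalars: the functional \<open>E 0\<close> is a left eigenvector of
  \<open>A\<close>, so \<open>E 0\<close> applied to \<open>(A - t i) w = c w'\<close> determines \<open>c\<close> from the values of \<open>E 0\<close>.\<close>

lemma split_scalars_dual: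
  assumes \<phi>: "split_scalars \<phi>" and y: "E 0 y = y" "y \<noteq> 0"
  shows "leonard.split_scalars scale d B r A t y \<phi>"
proof -
  interpret dual: leonard scale d B F r A E t by (rule leonard_dual)
  let ?w = "\<lambda>i. lin_ops scale B r [0..<i] y"
  obtain c where c: "y = scale c (E 0 x)"
    using a.E_line[of 0 "E 0 x" y] E_x_nonzero[of 0] y by (auto simp: a.E_E)
  then have c0: "c \<noteq> 0" using y by auto
  \<comment> \<open>\<open>E_expansion\<close> writes \<open>E 0 x\<close> in the split basis, and
    biorthogonality selects one term; this is where \<open>entK t i 0\<close> comes from.\<close>
  have Ew: "E 0 (?w i) = scale (c * entK t i 0 * (\<Prod>h=1..i. \<phi> h)) (E 0 x)" if i: "i \<le> d" for i
  proof -
    have "E 0 (?w i) = scale c (\<Sum>k\<le>d. scale (entK t k 0) (E 0 (lin_ops scale B r [0..<i] (u k))))"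
      unfolding c a.E_expansion[of 0 x, simplified]
      by (simp add: b.ops_scale b.ops_sum a.E_sum a.E_scale)
    also have "\<dots> = scale c (\<Sum>k\<le>d. if i = k then scale (entK t i 0 * (\<Prod>h=1..i. \<phi> h)) (E 0 x) else 0)"
      using E0_ops_u[OF \<phi> i] by (intro arg_cong[of _ _ "scale c"] sum.cong) auto
    finally show ?thesis using i by (simp add: mult.assoc)
  qed
  have "\<phi> i \<noteq> 0 \<and> A (?w i) - scale (t i) (?w i) = scale (\<phi> i) (?w (i - 1))" if i: "1 \<le> i" "i \<le> d" for i
  proof -
    obtain c' where c': "A (?w i) - scale (t i) (?w i) = scale c' (?w (i - 1))"
      using dual.lowering[OF y i] by blast
    have "scale ((t 0 - t i) * (c * entK t i 0 * (\<Prod>h=1..i. \<phi> h))) (E 0 x)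
      = E 0 (A (?w i) - scale (t i) (?w i))"
      using i by (simp add: a.E_diff a.E_A a.E_scale Ew a.scale_left_diff_distrib left_diff_distrib)
    also have "\<dots> = scale (c' * (c * entK t (i - 1) 0 * (\<Prod>h=1..i-1. \<phi> h))) (E 0 x)"
      using i by (simp add: c' a.E_scale Ew)
    finally have eq: "(t 0 - t i) * (c * entK t i 0 * (\<Prod>h=1..i. \<phi> h))
        = c' * (c * entK t (i - 1) 0 * (\<Prod>h=1..i-1. \<phi> h))"
      using E_x_nonzero[of 0] by simp
    have ins: "{1..i} = insert i {1..i-1}" using i by auto
    have K: "(t 0 - t i) * entK t i 0 = entK t (i - 1) 0"
      using i a.t_diff[of 0 i] ins by (simp add: entK_def)
    have P: "(\<Prod>h=1..i. \<phi> h) = \<phi> i * (\<Prod>h=1..i-1. \<phi> h)" unfolding ins using i by simp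
    have "t 0 - t h \<noteq> 0" if "h \<in> {1..i-1}" for h
    proof -
      have "h \<le> d" "0 \<noteq> h" using that i by auto
      then show ?thesis using a.t_diff[of 0 h] by simp
    qed
    then have "entK t (i - 1) 0 \<noteq> 0" by (auto simp: entK_def)
    moreover have "(\<Prod>h=1..i-1. \<phi> h) \<noteq> 0" using \<phi> i by (auto simp: split_scalars_def)
    moreover have "\<phi> i * (c * entK t (i - 1) 0 * (\<Prod>h=1..i-1. \<phi> h))
        = c' * (c * entK t (i - 1) 0 * (\<Prod>h=1..i-1. \<phi> h))"
      using eq unfolding P K[symmetric] by (simp only: ac_simps)
    ultimately have "\<phi> i = c'" using c0 by simp
    moreover have "\<phi> i \<noteq> 0" using \<phi> i unfolding split_scalars_def by blast
    ultimately show ?thesis using c' by simp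
  qed
  then show ?thesis unfolding dual.split_scalars_def[OF y] by blast
qed

end

lemma E_ratio:
  assumes "E d y = y" and "y \<noteq> 0" and "i \<le> d"
    and x: "lin_ops scale B r [i+1..<d+1] y = scale c (lin_ops scale A t [0..<i] x)"
    and x': "lin_ops scale B r [0..<d-i] y = scale c' (lin_ops scale A t [0..<i] x')"
  shows "scale c (E i x) = scale c' (E i x')"
proof -
  \<comment> \<open>In this reversed dual system \<open>y\<close> is a starting vector, and
    \<open>E i\<close> is the component of index \<open>d - i\<close>: the top one for any product
    of \<open>d - i\<close> factors, where only the number of factors matters.\<close>
  interpret s: leonard scale d B F r A "\<lambda>i. E (d - i)" "\<lambda>i. t (d - i)"
    by (rule leonard.leonard_dual[OF leonard_rev])
  have "E i (lin_ops scale B r [i+1..<d+1] y) = E i (lin_ops scale B r [0..<d-i] y)"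
    using s.F_ops_top_indep[of y "[i+1..<d+1]" "[0..<d-i]" r r] assms(1,2,3) by (simp del: upt_Suc)
  then have "scale (\<Prod>h\<in>set [0..<i]. t i - t h) (scale c (E i x))
      = scale (\<Prod>h\<in>set [0..<i]. t i - t h) (scale c' (E i x'))"
    unfolding x x' using assms(3) by (simp add: a.E_scale a.E_ops_distinct mult.commute)
  moreover have "(\<Prod>h\<in>set [0..<i]. t i - t h) \<noteq> 0" using a.t_diff assms(3) by auto
  ultimately show ?thesis using a.scale_left_imp_eq by blast
qed

end

section \<open>The matrix algebra and its irreducible module\<close>

lemma aeval_eq_sum:
  assumes "vector_space scl" and "degree p \<le> N"
  shows "aeval scl p a = (\<Sum>i\<le>N. scl (poly.coeff p i) (a ^ i))"
proof -
  interpret vector_space scl by fact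
  show ?thesis unfolding aeval_def
    by (rule sum.mono_neutral_left) (use assms(2) in \<open>auto simp: coeff_eq_0\<close>)
qed

lemma aeval_diff:
  assumes "vector_space scl"
  shows "aeval scl (p - q) a = aeval scl p a - aeval scl q a"
proof -
  interpret vector_space scl by fact
  let ?N = "max (degree p) (degree q)"
  have "degree (p - q) \<le> ?N" by (rule degree_diff_le_max)
  then show ?thesis
    by (simp add: aeval_eq_sum[OF assms, where N = ?N] scale_left_diff_distrib sum_subtractf)
qed

lemma aeval_smult:
  assumes "vector_space scl"
  shows "aeval scl (smult c p) a = scl c (aeval scl p a)"
proof -
  interpret vector_space scl by fact
  show ?thesis
    by (simp add: aeval_eq_sum[OF assms, where N = "degree p"] degree_smult_le scale_sum_right)
qed

locale algebra_over =
  fixes scl :: "'k::field \<Rightarrow> 'a::ring_1 \<Rightarrow> 'a"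
  assumes is_alg: "is_algebra scl"
begin

sublocale alg: vector_space scl
  using is_alg by (simp add: is_algebra_def)

lemma scl_mult_left: "scl c a * b = scl c (a * b)"
  using is_alg unfolding is_algebra_def by metis

lemma scl_mult_right: "a * scl c b = scl c (a * b)"
  using is_alg unfolding is_algebra_def by metis

lemma aeval_linear_mult: "aeval scl ([:- c, 1:] * p) a = (a - scl c 1) * aeval scl p a"
proof -
  have 1: "aeval scl (pCons 0 p) a = a * aeval scl p a"
  proof -
    have "aeval scl (pCons 0 p) a = (\<Sum>i\<le>Suc (degree p). scl (poly.coeff (pCons 0 p) i) (a ^ i))"
      by (rule aeval_eq_sum[OF alg.vector_space_axioms]) (simp add: degree_pCons_le)
    also have "\<dots> = a * aeval scl p a"
      by (subst sum.atMost_Suc_shift) (simp add: aeval_def sum_distrib_left scl_mult_right)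
    finally show ?thesis .
  qed
  have "[:- c, 1:] * p = pCons 0 p - smult c p" by simp
  then show ?thesis
    by (simp add: aeval_diff aeval_smult alg.vector_space_axioms 1 left_diff_distrib scl_mult_left)
qed

definition is_min_poly :: "'a \<Rightarrow> 'k poly \<Rightarrow> bool" where
  "is_min_poly a p \<longleftrightarrow> lead_coeff p = 1 \<and> aeval scl p a = 0 \<and>
     (\<forall>r. r \<noteq> 0 \<longrightarrow> aeval scl r a = 0 \<longrightarrow> degree p \<le> degree r)"

text \<open>An annihilating polynomial of least degree, made monic, gives existence. Two monic ones
  would differ by an annihilating polynomial of smaller degree, so the description in
  \<open>min_poly\<close> is unique.\<close>

lemma is_min_poly_min_poly:
  assumes "p \<noteq> 0" and "aeval scl p a = 0"
  shows "is_min_poly a (min_poly scl a)"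
proof -
  define Q where "Q = (\<lambda>r. r \<noteq> 0 \<and> aeval scl r a = 0)"
  define m where "m = arg_min degree Q"
  have m: "Q m" "\<And>r. Q r \<Longrightarrow> degree m \<le> degree r"
    unfolding m_def using assms arg_min_natI[of Q p degree] arg_min_nat_le[of Q _ degree] by (auto simp: Q_def)
  define M where "M = smult (1 / lead_coeff m) m"
  have "is_min_poly a M"
    using m by (auto simp: is_min_poly_def M_def Q_def aeval_smult alg.vector_space_axioms)
  moreover have "r = M" if r: "is_min_poly a r" for r
  proof (rule ccontr)
    assume ne: "r \<noteq> M"
    have nz: "r \<noteq> 0" "M \<noteq> 0" using r \<open>is_min_poly a M\<close> by (auto simp: is_min_poly_def)
    have deg: "degree r = degree M"
      using r \<open>is_min_poly a M\<close> nz by (meson is_min_poly_def le_antisym)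
    have 0: "r - M \<noteq> 0" "aeval scl (r - M) a = 0"
      using ne r \<open>is_min_poly a M\<close> by (auto simp: is_min_poly_def aeval_diff alg.vector_space_axioms)
    have "poly.coeff (r - M) (degree r) = 0"
      using r \<open>is_min_poly a M\<close> deg by (auto simp: is_min_poly_def)
    moreover have "degree (r - M) \<le> degree r" using deg degree_diff_le_max[of r M] by simp
    moreover have "degree r \<le> degree (r - M)" using r 0 by (auto simp: is_min_poly_def)
    ultimately have "lead_coeff (r - M) = 0" by (metis le_antisym)
    then have "r - M = 0" by (simp only: leading_coeff_0_iff)
    then show False using 0(1) by blast
  qed
  ultimately have "\<exists>!p. is_min_poly a p" by blast
  then show ?thesis
    unfolding min_poly_def is_min_poly_def[symmetric] by (rule theI')
qed

lemma annihilating_poly_exists: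
  assumes "finite T" and "alg.span T = UNIV"
  shows "\<exists>p. p \<noteq> 0 \<and> aeval scl p a = 0"
proof -
  define N where "N = card T"
  let ?f = "\<lambda>k. a ^ k"
  obtain c :: "nat \<Rightarrow> 'k" where c: "(\<Sum>k\<le>N. scl (c k) (a ^ k)) = 0" "\<exists>k\<le>N. c k \<noteq> 0"
  proof (cases "inj_on ?f {..N}")
    case True
    have "alg.dependent (?f ` {..N})"
    proof (rule ccontr)
      assume "\<not> alg.dependent (?f ` {..N})"
      then have "card (?f ` {..N}) \<le> card T"
        using alg.independent_span_bound[OF assms(1), of "?f ` {..N}"] assms(2) by simp
      then show False using card_image[OF True] by (simp add: N_def)
    qed
    then obtain g where g: "(\<Sum>v\<in>?f ` {..N}. scl (g v) v) = 0" "\<exists>v\<in>?f ` {..N}. g v \<noteq> 0"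
      using alg.dependent_finite[of "?f ` {..N}"] by auto
    show ?thesis
      by (rule that[of "\<lambda>k. g (a ^ k)"]) (use g sum.reindex[OF True, of "\<lambda>v. scl (g v) v"] in auto)
  next
    \<comment> \<open>If two powers coincide, the set of powers no longer records the relation
      between them, so the relation is given by hand.\<close>
    case False
    then obtain i j where ij: "i \<le> N" "j \<le> N" "i \<noteq> j" "a ^ i = a ^ j" by (auto simp: inj_on_def)
    define c where "c = (\<lambda>k. if k = i then 1 else if k = j then - 1 else (0::'k))"
    have "(\<Sum>k\<le>N. scl (c k) (a ^ k)) = (\<Sum>k\<in>{i, j}. scl (c k) (a ^ k))"
      by (rule sum.mono_neutral_right) (use ij in \<open>auto simp: c_def\<close>)
    also have "\<dots> = 0" using ij by (simp add: c_def)
    finally have "(\<Sum>k\<le>N. scl (c k) (a ^ k)) = 0" .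
    moreover have "c i \<noteq> 0" by (simp add: c_def)
    ultimately show ?thesis using ij(1) by (intro that[of c]) auto
  qed
  define p where "p = (\<Sum>k\<le>N. monom (c k) k)"
  have cf: "poly.coeff p k = (if k \<le> N then c k else 0)" for k
    by (simp add: p_def coeff_sum)
  have "degree p \<le> N" by (rule degree_le) (simp add: cf)
  then have "aeval scl p a = (\<Sum>k\<le>N. scl (c k) (a ^ k))"
    by (simp add: aeval_eq_sum[OF alg.vector_space_axioms] cf)
  moreover have "p \<noteq> 0" using c(2) cf by (metis coeff_0)
  ultimately show ?thesis using c(1) by auto
qed

end

lemma poly_map_to_ac: "poly (map_poly to_ac p) (to_ac x) = to_ac (poly p x)"
  by (induction p) (simp_all add: map_poly_pCons)

locale irreducible_matrix_module = algebra_over scl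
  for scl :: "'k::field \<Rightarrow> 'a::ring_1 \<Rightarrow> 'a" +
  fixes d :: nat and act :: "'a \<Rightarrow> 'v::ab_group_add \<Rightarrow> 'v"
  assumes iso: "iso_to_Mat (d + 1) scl" and irred: "irreducible_module act"
begin

abbreviation sv :: "'k \<Rightarrow> 'v \<Rightarrow> 'v" where "sv \<equiv> vscl scl act"

lemma act_add_right: "act a (u + v) = act a u + act a v"
  and act_add_left: "act (a + b) v = act a v + act b v"
  and act_mult: "act (a * b) v = act a (act b v)"
  and act_1: "act 1 v = v"
  using irred by (auto simp: irreducible_module_def left_module_def)

lemma act_zero_right [simp]: "act a 0 = 0" and act_zero_left [simp]: "act 0 v = 0"
  using act_add_right[of a 0 0] act_add_left[of 0 0 v] by simp_all

lemma act_diff_left: "act (a - b) v = act a v - act b v"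
  using act_add_left[of "a - b" b v] by simp

lemma act_sum_left: "act (sum f I) v = (\<Sum>i\<in>I. act (f i) v)"
  and act_sum_right: "act a (sum g I) = (\<Sum>i\<in>I. act a (g i))"
  by (induction I rule: infinite_finite_induct) (simp_all add: act_add_left act_add_right)

lemma act_scl: "act (scl c a) v = sv c (act a v)"
  unfolding vscl_def act_mult[symmetric] by (simp add: scl_mult_left)

lemma act_vscl: "act a (sv c v) = sv c (act a v)"
  unfolding vscl_def act_mult[symmetric] by (simp add: scl_mult_left scl_mult_right)

lemma act_lin_prod: "act (lin_prod scl a \<xi> hs) v = lin_ops sv (act a) \<xi> hs v"
  by (induction hs) (simp_all add: lin_prod_def lin_ops_Cons act_mult act_diff_left act_scl act_1)

sublocale mv: vector_space sv
proof
  fix c c' :: 'k and u v :: 'v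
  show "sv c (u + v) = sv c u + sv c v" by (simp add: vscl_def act_add_right)
  show "sv (c + c') v = sv c v + sv c' v" by (simp add: vscl_def alg.scale_left_distrib act_add_left)
  show "sv c (sv c' v) = sv (c * c') v" by (simp add: vscl_def scl_mult_left flip: act_mult)
  show "sv 1 v = v" by (simp add: vscl_def act_1)
qed

section \<open>Matrix units and the structure of the irreducible module\<close>

definition mat_iso :: "'a \<Rightarrow> 'k mat" where
  "mat_iso = (SOME \<Psi>. bij_betw \<Psi> UNIV (carrier_mat (d+1) (d+1)) \<and> \<Psi> 1 = 1\<^sub>m (d+1) \<and>
     (\<forall>a b. \<Psi> (a + b) = \<Psi> a + \<Psi> b) \<and> (\<forall>a b. \<Psi> (a * b) = \<Psi> a * \<Psi> b) \<and>
     (\<forall>c a. \<Psi> (scl c a) = c \<cdot>\<^sub>m \<Psi> a))"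

lemma mat_iso:
  "bij_betw mat_iso UNIV (carrier_mat (d+1) (d+1))" "mat_iso 1 = 1\<^sub>m (d+1)"
  "mat_iso (a + b) = mat_iso a + mat_iso b" "mat_iso (a * b) = mat_iso a * mat_iso b"
  "mat_iso (scl c a) = c \<cdot>\<^sub>m mat_iso a"
  using someI_ex[OF iso[unfolded iso_to_Mat_def]] unfolding mat_iso_def[symmetric] by auto

lemma mat_iso_carrier: "mat_iso a \<in> carrier_mat (d+1) (d+1)"
  using mat_iso(1) by (auto simp: bij_betw_def)

lemma mat_iso_dim [simp]: "dim_row (mat_iso a) = d + 1" "dim_col (mat_iso a) = d + 1"
  using mat_iso_carrier[of a] by auto

lemma mat_iso_eqI:
  assumes "\<And>i j. i \<le> d \<Longrightarrow> j \<le> d \<Longrightarrow> mat_iso a $$ (i, j) = mat_iso b $$ (i, j)"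
  shows "a = b"
proof -
  have "mat_iso a = mat_iso b" by (rule eq_matI) (use assms in auto)
  then show ?thesis using mat_iso(1) by (auto simp: bij_betw_def dest: injD)
qed

lemma mat_iso_entry_scl: "i \<le> d \<Longrightarrow> j \<le> d \<Longrightarrow> mat_iso (scl c a) $$ (i, j) = c * mat_iso a $$ (i, j)"
  by (simp add: mat_iso(5))

lemma mat_iso_entry_sum:
  "i \<le> d \<Longrightarrow> j \<le> d \<Longrightarrow> mat_iso (sum f I) $$ (i, j) = (\<Sum>k\<in>I. mat_iso (f k) $$ (i, j))"
proof (induction I rule: infinite_finite_induct)
  case (insert k I)
  then show ?case by (simp add: mat_iso(3))
qed (use mat_iso_entry_scl[of i j 0 0] in auto)

lemma mat_iso_entry_mult:
  "i \<le> d \<Longrightarrow> j \<le> d \<Longrightarrow>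
     mat_iso (a * b) $$ (i, j) = (\<Sum>k\<le>d. mat_iso a $$ (i, k) * mat_iso b $$ (k, j))"
  by (simp add: mat_iso(4) scalar_prod_def atLeast0LessThan lessThan_Suc_atMost)

definition unit_el :: "nat \<Rightarrow> nat \<Rightarrow> 'a" where
  "unit_el i j = inv_into UNIV mat_iso (mat (d+1) (d+1) (\<lambda>(k, l). if k = i \<and> l = j then 1 else 0))"

lemma unit_el_entry:
  "k \<le> d \<Longrightarrow> l \<le> d \<Longrightarrow> mat_iso (unit_el i j) $$ (k, l) = (if k = i \<and> l = j then 1 else 0)"
proof -
  have "mat (d+1) (d+1) (\<lambda>(k, l). if k = i \<and> l = j then 1 else 0) \<in> range mat_iso"
    using mat_iso(1) by (auto simp: bij_betw_def)
  then have "mat_iso (unit_el i j) = mat (d+1) (d+1) (\<lambda>(k, l). if k = i \<and> l = j then 1 else 0)"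
    unfolding unit_el_def by (rule f_inv_into_f)
  then show "k \<le> d \<Longrightarrow> l \<le> d \<Longrightarrow> ?thesis" by simp
qed

text \<open>Matrix units isolate a single entry. The spanning set of the algebra, its faithfulness
  on the module, and the bound on the dimension of the module all follow from this.\<close>

lemma unit_el_sandwich:
  assumes "i \<le> d" "j \<le> d"
  shows "unit_el k i * a * unit_el j l = scl (mat_iso a $$ (i, j)) (unit_el k l)"
proof (rule mat_iso_eqI)
  fix m n assume mn: "m \<le> d" "n \<le> d"
  have row: "mat_iso (unit_el k i * a) $$ (m, p) = (if m = k then mat_iso a $$ (i, p) else 0)" if "p \<le> d" for p
  proof -
    have "mat_iso (unit_el k i * a) $$ (m, p)
        = (\<Sum>x\<le>d. if x = i then (if m = k then mat_iso a $$ (i, p) else 0) else 0)"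
      unfolding mat_iso_entry_mult[OF mn(1) that]
      by (rule sum.cong) (use mn in \<open>auto simp: unit_el_entry\<close>)
    then show ?thesis using assms by simp
  qed
  have "mat_iso (unit_el k i * a * unit_el j l) $$ (m, n)
      = (\<Sum>x\<le>d. if x = j then (if m = k \<and> n = l then mat_iso a $$ (i, j) else 0) else 0)"
    unfolding mat_iso_entry_mult[OF mn]
    by (rule sum.cong) (use mn row in \<open>auto simp: unit_el_entry\<close>)
  then show "mat_iso (unit_el k i * a * unit_el j l) $$ (m, n)
      = mat_iso (scl (mat_iso a $$ (i, j)) (unit_el k l)) $$ (m, n)"
    using assms mn by (simp add: mat_iso_entry_scl unit_el_entry)
qed

lemma sum_unit_el: "(\<Sum>i\<le>d. unit_el i i) = 1"
proof (rule mat_iso_eqI)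
  fix i j assume ij: "i \<le> d" "j \<le> d"
  have "mat_iso (\<Sum>i\<le>d. unit_el i i) $$ (i, j) = (\<Sum>k\<le>d. if k = i then (if i = j then 1 else 0) else 0)"
    unfolding mat_iso_entry_sum[OF ij]
    by (rule sum.cong) (use ij in \<open>auto simp: unit_el_entry\<close>)
  then show "mat_iso (\<Sum>i\<le>d. unit_el i i) $$ (i, j) = mat_iso 1 $$ (i, j)"
    using ij by (simp add: mat_iso(2))
qed

lemma span_unit_el: "alg.span ((\<lambda>(i, j). unit_el i j) ` ({..d} \<times> {..d})) = UNIV"
proof -
  have "a \<in> alg.span ((\<lambda>(i, j). unit_el i j) ` ({..d} \<times> {..d}))" for a
  proof -
    have "a = (\<Sum>i\<le>d. unit_el i i) * a * (\<Sum>j\<le>d. unit_el j j)" by (simp add: sum_unit_el)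
    also have "\<dots> = (\<Sum>i\<le>d. \<Sum>j\<le>d. unit_el i i * a * unit_el j j)"
      by (simp add: sum_distrib_left sum_distrib_right) (rule sum.swap)
    also have "\<dots> \<in> alg.span ((\<lambda>(i, j). unit_el i j) ` ({..d} \<times> {..d}))"
      by (intro alg.span_sum) (auto simp: unit_el_sandwich intro!: alg.span_scale intro: alg.span_base)
    finally show ?thesis .
  qed
  then show ?thesis by auto
qed

text \<open>The diagonal units sum to 1, so one of them does not kill a given nonzero vector;
  another unit moves the result into the image of \<open>unit_el 0 0\<close>. By irreducibility the
  vector obtained generates the module.\<close>

lemma cyclic_generator:
  obtains w where "w \<noteq> 0" and "act (unit_el 0 0) w = w" and "\<And>v. \<exists>a. v = act a w"
proof -
  obtain v :: 'v where v: "v \<noteq> 0" using irred by (auto simp: irreducible_module_def)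
  have "\<exists>i\<le>d. act (unit_el i i) v \<noteq> 0"
  proof (rule ccontr)
    assume "\<not> ?thesis"
    then have "act (\<Sum>i\<le>d. unit_el i i) v = 0" by (simp add: act_sum_left)
    then show False using v by (simp add: sum_unit_el act_1)
  qed
  then obtain i where i: "i \<le> d" "act (unit_el i i) v \<noteq> 0" by blast
  have e: "unit_el k i * unit_el i l = unit_el k l" if "i \<le> d" for i k l
    using unit_el_sandwich[OF that that, of k 1 l] that by (simp add: mat_iso(2))
  define w where "w = act (unit_el 0 i) v"
  have "act (unit_el i 0) w = act (unit_el i i) v"
    unfolding w_def act_mult[symmetric] by (simp add: e)
  then have w: "w \<noteq> 0" using i by auto
  have fix_w: "act (unit_el 0 0) w = w"
    unfolding w_def act_mult[symmetric] by (simp add: e)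
  have "submodule act (range (\<lambda>a. act a w))"
    unfolding submodule_def
  proof (intro conjI ballI allI)
    show "0 \<in> range (\<lambda>a. act a w)" by (rule image_eqI[of _ _ 0]) auto
    show "u + u' \<in> range (\<lambda>a. act a w)" if "u \<in> range (\<lambda>a. act a w)" "u' \<in> range (\<lambda>a. act a w)" for u u'
      using that by (auto simp flip: act_add_left)
    show "act b u \<in> range (\<lambda>a. act a w)" if "u \<in> range (\<lambda>a. act a w)" for b u
      using that by (auto simp flip: act_mult)
  qed
  moreover have "w \<in> range (\<lambda>a. act a w)" by (rule image_eqI[of _ _ 1]) (simp_all add: act_1)
  ultimately have "range (\<lambda>a. act a w) = UNIV" using irred w by (auto simp: irreducible_module_def)
  then show ?thesis using w fix_w by (intro that[of w]) auto
qed

lemma faithful: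
  assumes "\<And>v. act a v = 0"
  shows "a = 0"
proof (rule mat_iso_eqI)
  fix i j assume ij: "i \<le> d" "j \<le> d"
  obtain w where w: "w \<noteq> 0" "act (unit_el 0 0) w = w" by (rule cyclic_generator)
  have "sv (mat_iso a $$ (i, j)) w = act (unit_el 0 i * a * unit_el j 0) w"
    unfolding unit_el_sandwich[OF ij] by (simp add: act_scl w)
  also have "\<dots> = 0" by (simp add: act_mult assms)
  finally have "mat_iso a $$ (i, j) = 0" using w by simp
  moreover have "mat_iso 0 $$ (i, j) = 0" using mat_iso_entry_scl[OF ij, of 0 0] by simp
  ultimately show "mat_iso a $$ (i, j) = mat_iso 0 $$ (i, j)" by simp
qed

text \<open>Multiplying by \<open>unit_el 0 0\<close> on the right keeps only the first column of
  \<open>a\<close>, hence d + 1 vectors suffice. This bound later makes d + 1 independent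
  eigenvectors a basis.\<close>

lemma module_span:
  obtains T where "finite T" and "card T \<le> d + 1" and "mv.span T = UNIV"
proof -
  obtain w where "w \<noteq> 0" and w: "act (unit_el 0 0) w = w" "\<And>v. \<exists>a. v = act a w"
    using cyclic_generator by metis
  let ?T = "(\<lambda>i. act (unit_el i 0) w) ` {..d}"
  have "v \<in> mv.span ?T" for v
  proof -
    obtain a where a: "v = act a w" using w(2) by blast
    have "v = act ((\<Sum>i\<le>d. unit_el i i) * a * unit_el 0 0) w" by (simp add: a sum_unit_el act_mult w(1))
    also have "\<dots> = (\<Sum>i\<le>d. act (unit_el i i * a * unit_el 0 0) w)"
      by (simp add: sum_distrib_right act_sum_left)
    also have "\<dots> = (\<Sum>i\<le>d. sv (mat_iso a $$ (i, 0)) (act (unit_el i 0) w))"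
      by (rule sum.cong) (simp_all add: unit_el_sandwich act_scl)
    also have "\<dots> \<in> mv.span ?T"
      by (intro mv.span_sum mv.span_scale mv.span_base) auto
    finally show ?thesis .
  qed
  moreover have "card ?T \<le> d + 1" using card_image_le[of "{..d}"] by (metis card_atMost finite_atMost Suc_eq_plus1)
  ultimately show ?thesis by (intro that[of ?T]) auto
qed

text \<open>Divide the minimal polynomial by the linear factor of the root. By minimality the
  quotient does not annihilate \<open>a\<close>, so by faithfulness it sends some vector to a
  nonzero one, which the linear factor then kills.\<close>

lemma eigenvector_exists:
  assumes "to_ac \<xi> \<in> eigenvalues scl a"
  shows "\<exists>v. v \<noteq> 0 \<and> act a v = sv \<xi> v"
proof -
  let ?p = "min_poly scl a"
  have "finite ((\<lambda>(i, j). unit_el i j) ` ({..d} \<times> {..d}))" by simp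
  then obtain p where "p \<noteq> 0" "aeval scl p a = 0"
    using annihilating_poly_exists[OF _ span_unit_el] by blast
  then have mp: "is_min_poly a ?p" by (rule is_min_poly_min_poly)
  have "poly ?p \<xi> = 0" using assms by (simp add: eigenvalues_def poly_map_to_ac)
  then obtain r where r: "?p = [:- \<xi>, 1:] * r" unfolding poly_eq_0_iff_dvd by (elim dvdE)
  have r0: "r \<noteq> 0" using mp r by (auto simp: is_min_poly_def)
  then have "degree r < degree ?p" unfolding r by (subst degree_mult_eq) auto
  then have "aeval scl r a \<noteq> 0" using mp r0 by (auto simp: is_min_poly_def)
  then obtain u where u: "act (aeval scl r a) u \<noteq> 0" using faithful by blast
  have "act ((a - scl \<xi> 1) * aeval scl r a) u = 0"
    using mp unfolding aeval_linear_mult[symmetric] r[symmetric] by (simp add: is_min_poly_def)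
  then have "act a (act (aeval scl r a) u) = sv \<xi> (act (aeval scl r a) u)"
    by (simp add: act_mult act_diff_left act_scl act_1)
  then show ?thesis using u by blast
qed

lemma act_prim_idem:
  assumes "act a v = sv (\<xi> k) v" and "inj_on \<xi> {0..d}" and "i \<le> d" and "k \<le> d"
  shows "act (prim_idem d scl a \<xi> i) v = (if i = k then v else 0)"
proof -
  have *: "act (prod_list (map (\<lambda>j. scl (1 / (\<xi> i - \<xi> j)) (a - scl (\<xi> j) 1)) js)) v
     = sv (\<Prod>j\<leftarrow>js. (\<xi> k - \<xi> j) / (\<xi> i - \<xi> j)) v" for js
    by (induction js) (simp_all add: act_1 act_mult act_vscl act_scl act_diff_left assms(1)
        mv.scale_left_diff_distrib[symmetric] mult.commute)
  let ?js = "[j \<leftarrow> [0..<d+1]. j \<noteq> i]"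
  have "(\<Prod>j\<leftarrow>?js. (\<xi> k - \<xi> j) / (\<xi> i - \<xi> j)) = (\<Prod>j\<in>set ?js. (\<xi> k - \<xi> j) / (\<xi> i - \<xi> j))"
    by (intro prod_list_distinct) (simp del: upt_Suc)
  also have "\<dots> = (if i = k then 1 else 0)"
  proof (cases "i = k")
    case True
    have "\<xi> k - \<xi> j \<noteq> 0" if "j \<in> set ?js" for j
      using that assms(2,4) True by (auto dest: inj_onD simp del: upt_Suc)
    then show ?thesis using True by (auto intro!: prod.neutral)
  next
    case False
    then have "k \<in> set ?js" using assms(4) by (simp del: upt_Suc)
    then have "(\<Prod>j\<in>set ?js. (\<xi> k - \<xi> j) / (\<xi> i - \<xi> j)) = 0"
      by (intro prod_zero) auto
    then show ?thesis using False by simp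
  qed
  finally show ?thesis unfolding prim_idem_def * by simp
qed

text \<open>The primitive idempotents act as 0 or 1 on the chosen eigenvectors. This separates the
  coefficients of a linear combination, so the eigenvectors form a basis, and the axioms are read
  off in its coordinates.\<close>

lemma eigenvalue_seq_spectral:
  assumes seq: "eigenvalue_seq d scl a F \<xi>"
  shows "spectral sv d (act a) (\<lambda>i. act (F i)) \<xi>"
proof -
  have inj: "inj_on \<xi> {0..d}" using seq by (simp add: eigenvalue_seq_def)
  have "\<exists>v. v \<noteq> 0 \<and> act a v = sv (\<xi> i) v" if "i \<le> d" for i
    using seq that by (intro eigenvector_exists) (auto simp: eigenvalue_seq_def)
  then obtain x where x: "\<And>i. i \<le> d \<Longrightarrow> x i \<noteq> 0 \<and> act a (x i) = sv (\<xi> i) (x i)" by metis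
  have F_x: "act (F i) (x k) = (if i = k then x k else 0)" if "i \<le> d" "k \<le> d" for i k
    using act_prim_idem[OF _ inj that, of a "x k"] x that seq by (simp add: eigenvalue_seq_def)
  have F_comb: "act (F i) (\<Sum>k\<le>d. sv (c k) (x k)) = sv (c i) (x i)" if "i \<le> d" for i c
  proof -
    have "act (F i) (\<Sum>k\<le>d. sv (c k) (x k)) = (\<Sum>k\<le>d. if k = i then sv (c i) (x i) else 0)"
      unfolding act_sum_right by (rule sum.cong) (use that F_x in \<open>auto simp: act_vscl\<close>)
    then show ?thesis using that by simp
  qed
  obtain T where T: "finite T" "card T \<le> d + 1" "mv.span T = UNIV" by (rule module_span)
  have basis: "is_basis sv d x"
  proof (rule is_basisI[OF mv.vector_space_axioms T])
    fix c assume 0: "(\<Sum>i\<le>d. sv (c i) (x i)) = 0"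
    have "sv (c i) (x i) = 0" if "i \<le> d" for i using F_comb[OF that, of c] 0 by simp
    then show "\<forall>i\<le>d. c i = 0" using x by auto
  qed
  have comb: "\<exists>c. v = (\<Sum>k\<le>d. sv (c k) (x k))" for v
  proof -
    have "v \<in> mv.span (x ` {0..d})" using basis by (simp add: is_basis_def)
    then obtain g where "v = (\<Sum>u\<in>x ` {0..d}. sv (g u) u)" using mv.span_finite[of "x ` {0..d}"] by auto
    also have "\<dots> = (\<Sum>k\<le>d. sv (g (x k)) (x k))"
      using sum.reindex[of x "{0..d}" "\<lambda>u. sv (g u) u"] basis by (simp add: is_basis_def atMost_atLeast0)
    finally show ?thesis by (intro exI[of _ "\<lambda>k. g (x k)"])
  qed
  show ?thesis
  proof
    fix i v u c
    show "act a (u + v) = act a u + act a v" by (rule act_add_right)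
    show "act a (sv c v) = sv c (act a v)" by (rule act_vscl)
    show "act (F i) (u + v) = act (F i) u + act (F i) v" by (rule act_add_right)
    show "act (F i) (sv c v) = sv c (act (F i) v)" by (rule act_vscl)
    show "inj_on \<xi> {0..d}" by (rule inj)
    obtain cv where cv: "v = (\<Sum>k\<le>d. sv (cv k) (x k))" using comb by blast
    show "(\<Sum>i\<le>d. act (F i) v) = v" by (simp add: cv F_comb)
    { fix j assume ij: "i \<le> d" "j \<le> d"
      have "act (F i) (act (F j) v) = act (F i) (sv (cv j) (x j))" using ij by (simp add: cv F_comb)
      then show "act (F i) (act (F j) v) = (if i = j then act (F i) v else 0)"
        using ij by (simp add: act_vscl F_x cv F_comb) }
    assume i: "i \<le> d"
    show "act a (act (F i) v) = sv (\<xi> i) (act (F i) v)"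
      using i x by (simp add: cv F_comb act_vscl mv.scale_left_commute)
    show "\<exists>v. act (F i) v \<noteq> 0" using F_x[OF i i] x[OF i] by (intro exI[of _ "x i"]) simp
    assume u: "act (F i) u = u" "u \<noteq> 0"
    obtain cu where "u = (\<Sum>k\<le>d. sv (cu k) (x k))" using comb by blast
    then have "u = sv (cu i) (x i)" using u(1) F_comb[OF i, of cu] by simp
    moreover have "cu i \<noteq> 0" using calculation u(2) by auto
    ultimately have "act (F i) v = sv (cv i / cu i) u" using i by (simp add: cv F_comb)
    then show "\<exists>c. act (F i) v = sv c u" by blast
  qed
qed

lemma leonard_system_leonard:
  assumes L: "leonard_system d scl A E As Es"
    and "eigenvalue_seq d scl A E \<theta>" and "eigenvalue_seq d scl As Es \<theta>s"
  shows "leonard sv d (act A) (\<lambda>i. act (E i)) \<theta> (act As) (\<lambda>i. act (Es i)) \<theta>s"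
proof (intro leonard.intro leonard_axioms.intro eigenvalue_seq_spectral assms(2,3))
  fix i j v assume ij: "i \<le> d" "j \<le> d"
  { assume "Suc i < j \<or> Suc j < i"
    then have "\<bar>int i - int j\<bar> > 1" by auto
    then have "E i * As * E j = 0" "Es i * A * Es j = 0"
      using L ij unfolding leonard_system_def by blast+
    then show "act (E i) (act As (act (E j) v)) = 0" "act (Es i) (act A (act (Es j) v)) = 0"
      by (simp_all flip: act_mult mult.assoc) }
  assume "Suc i = j \<or> Suc j = i"
  then have "\<bar>int i - int j\<bar> = 1" by auto
  then have ne: "E i * As * E j \<noteq> 0" "Es i * A * Es j \<noteq> 0"
    using L ij unfolding leonard_system_def by blast+
  show "\<exists>v. act (E i) (act As (act (E j) v)) \<noteq> 0"
    using faithful[of "E i * As * E j"] ne(1) by (auto simp: act_mult)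
  show "\<exists>v. act (Es i) (act A (act (Es j) v)) \<noteq> 0"
    using faithful[of "Es i * A * Es j"] ne(2) by (auto simp: act_mult)
qed

lemma first_split_seq_split_scalars:
  assumes L: "leonard sv d (act A) (\<lambda>i. act (E i)) \<theta> (act As) (\<lambda>i. act (Es i)) \<theta>s"
    and \<phi>: "first_split_seq d scl act A E \<theta> As Es \<theta>s \<phi>"
    and x: "act (Es 0) x = x" "x \<noteq> 0"
  shows "leonard.split_scalars sv d (act A) \<theta> (act As) \<theta>s x \<phi>"
proof -
  interpret leonard sv d "act A" "\<lambda>i. act (E i)" \<theta> "act As" "\<lambda>i. act (Es i)" \<theta>s by fact
  show ?thesis
  proof (rule split_scalarsI[OF x])
    fix i v assume i: "1 \<le> i" "i \<le> d"
      and above: "\<And>k. k \<le> d \<Longrightarrow> i < k \<Longrightarrow> act (Es k) v = 0"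
      and below: "\<And>h. h < i \<Longrightarrow> act (E h) v = 0"
    \<comment> \<open>Membership in a sum of images asks for a vector in each summand; the constant
      choice \<open>v\<close> works, because the missing components vanish.\<close>
    have "v = (\<Sum>h\<in>{0..i}. act (Es h) v)"
    proof -
      have "(\<Sum>h\<in>{0..i}. act (Es h) v) = (\<Sum>h\<le>d. act (Es h) v)"
        by (rule sum.mono_neutral_left) (use i above in auto)
      then show ?thesis by (simp add: b.sum_E)
    qed
    moreover have "v = (\<Sum>h\<in>{i..d}. act (E h) v)"
    proof -
      have "(\<Sum>h\<in>{i..d}. act (E h) v) = (\<Sum>h\<le>d. act (E h) v)"
        by (rule sum.mono_neutral_left) (use i below in auto)
      then show ?thesis by (simp add: a.sum_E)
    qed
    ultimately have "v \<in> split_space d act E Es i"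
      unfolding split_space_def sum_of_images_def by auto
    then have "act ((A - scl (\<theta> (i - 1)) 1) * (As - scl (\<theta>s i) 1)) v = sv (\<phi> i) v"
      using \<phi> i unfolding first_split_seq_def by auto
    then show "act A (act As v - sv (\<theta>s i) v) - sv (\<theta> (i - 1)) (act As v - sv (\<theta>s i) v) = sv (\<phi> i) v"
      by (simp add: act_mult act_diff_left act_scl act_1)
  qed
qed

end

section \<open>Transition matrices\<close>

definition tau_op :: "('k \<Rightarrow> 'v::ab_group_add \<Rightarrow> 'v) \<Rightarrow> ('v \<Rightarrow> 'v) \<Rightarrow> (nat \<Rightarrow> 'k) \<Rightarrow> nat \<Rightarrow> 'v \<Rightarrow> 'v" where
  "tau_op s A t i = lin_ops s A t [0..<i]"

definition sigma_op ::
  "('k \<Rightarrow> 'v::ab_group_add \<Rightarrow> 'v) \<Rightarrow> nat \<Rightarrow> ('v \<Rightarrow> 'v) \<Rightarrow> (nat \<Rightarrow> 'k) \<Rightarrow> nat \<Rightarrow> 'v \<Rightarrow> 'v" where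
  "sigma_op s d A t i = lin_ops s A t [d + 1 - i..<d + 1]"

lemma sigma_op_diff: "i \<le> d \<Longrightarrow> sigma_op s d A t (d - i) = lin_ops s A t [i + 1..<d + 1]"
  by (simp add: sigma_op_def Suc_diff_diff del: upt_Suc)

lemma transition_matrix_diagonal:
  assumes "vector_space s" and "is_basis s d u" and "is_basis s d v"
    and "\<And>i. i \<le> d \<Longrightarrow> v i = s (D i) (u i)"
  shows "transition_matrix s d u v (mat (d + 1) (d + 1) (\<lambda>(i, j). if i = j then D i else 0))"
proof -
  interpret vector_space s by fact
  have "v j = (\<Sum>i\<le>d. s (mat (d + 1) (d + 1) (\<lambda>(i, j). if i = j then D i else 0) $$ (i, j)) (u i))"
    if j: "j \<le> d" for j
  proof -
    have "(\<Sum>i\<le>d. s (mat (d + 1) (d + 1) (\<lambda>(i, j). if i = j then D i else 0) $$ (i, j)) (u i))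
      = (\<Sum>i\<le>d. if i = j then s (D j) (u j) else 0)"
      by (rule sum.cong) (use j in auto)
    then show ?thesis using assms(4) j by simp
  qed
  then show ?thesis using assms(2,3) by (simp add: transition_matrix_def)
qed

lemma transition_matrix_reversal:
  assumes "vector_space s" and "is_basis s d u" and "is_basis s d v"
    and "\<And>i. i \<le> d \<Longrightarrow> v i = u (d - i)"
  shows "transition_matrix s d u v (mat (d + 1) (d + 1) (\<lambda>(i, j). if i + j = d then 1 else 0))"
proof -
  interpret vector_space s by fact
  have "v j = (\<Sum>i\<le>d. s (mat (d + 1) (d + 1) (\<lambda>(i, j). if i + j = d then 1 else 0) $$ (i, j)) (u i))"
    if j: "j \<le> d" for j
  proof -
    have "(\<Sum>i\<le>d. s (mat (d + 1) (d + 1) (\<lambda>(i, j). if i + j = d then 1 else 0) $$ (i, j)) (u i))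
      = (\<Sum>i\<le>d. if i = d - j then u (d - j) else 0)"
      by (rule sum.cong) (use j in auto)
    then show ?thesis using assms(4) j by simp
  qed
  then show ?thesis using assms(2,3) by (simp add: transition_matrix_def)
qed

text \<open>The tabulated entries lie in the algebraic closure, where \<open>q\<close> lives, while
  the matrix must have entries in the base field; hence the comparison after embedding.\<close>

definition lower_transition ::
  "('k::field \<Rightarrow> 'v::ab_group_add \<Rightarrow> 'v) \<Rightarrow> nat \<Rightarrow> (nat \<Rightarrow> 'v) \<Rightarrow> (nat \<Rightarrow> 'v) \<Rightarrow>
     (nat \<Rightarrow> nat \<Rightarrow> 'k alg_closure) \<Rightarrow> bool" where
  "lower_transition s d u v L \<longleftrightarrow> (\<exists>T. transition_matrix s d u v T \<and>
     map_mat to_ac T = mat (d + 1) (d + 1) (\<lambda>(i, j). if j \<le> i then L i j else 0))"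

lemma lower_transitionI:
  assumes "is_basis s d u" and "is_basis s d v"
    and "\<And>j. j \<le> d \<Longrightarrow> v j = (\<Sum>i\<le>d. s (if j \<le> i then T i j else 0) (u i))"
    and "\<And>i j. i \<le> d \<Longrightarrow> j \<le> i \<Longrightarrow> to_ac (T i j) = L i j"
  shows "lower_transition s d u v L"
  unfolding lower_transition_def
proof (intro exI conjI)
  let ?T = "mat (d + 1) (d + 1) (\<lambda>(i, j). if j \<le> i then T i j else 0)"
  show "map_mat to_ac ?T = mat (d + 1) (d + 1) (\<lambda>(i, j). if j \<le> i then L i j else 0)"
    by (rule eq_matI) (use assms(4) in auto)
  have "v j = (\<Sum>i\<le>d. s (?T $$ (i, j)) (u i))" if "j \<le> d" for j
    unfolding assms(3)[OF that] by (rule sum.cong) (use that in auto)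
  then show "transition_matrix s d u v ?T" using assms(1,2) by (simp add: transition_matrix_def)
qed

text \<open>Agreement is asked for indices up to \<open>d\<close> only: formulas of a reversed
  system contain the truncated \<open>d - i\<close> and match the original ones in that
  range.\<close>

lemma lower_transition_cong:
  assumes "lower_transition s d u v L" and "\<And>i. i \<le> d \<Longrightarrow> u' i = u i" and "\<And>i. i \<le> d \<Longrightarrow> v' i = v i"
    and "\<And>i j. i \<le> d \<Longrightarrow> j \<le> i \<Longrightarrow> L' i j = L i j"
  shows "lower_transition s d u' v' L'"
proof -
  obtain T where T: "transition_matrix s d u v T"
    "map_mat to_ac T = mat (d + 1) (d + 1) (\<lambda>(i, j). if j \<le> i then L i j else 0)"
    using assms(1) by (auto simp: lower_transition_def)
  have "is_basis s d u'" "is_basis s d v'"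
    using T(1) assms(2,3) by (auto simp: transition_matrix_def intro: is_basis_cong)
  moreover have "v' j = (\<Sum>i\<le>d. s (T $$ (i, j)) (u' i))" if "j \<le> d" for j
    using T(1) that assms(2,3) by (simp add: transition_matrix_def)
  ultimately have "transition_matrix s d u' v' T" using T(1) by (simp add: transition_matrix_def)
  moreover have "map_mat to_ac T = mat (d + 1) (d + 1) (\<lambda>(i, j). if j \<le> i then L' i j else 0)"
    unfolding T(2) by (rule eq_matI) (use assms(4) in auto)
  ultimately show ?thesis by (auto simp: lower_transition_def)
qed

lemma beta_recurrent_rev:
  assumes "beta_recurrent d q t"
  shows "beta_recurrent d q (\<lambda>i. t (d - i))"
  unfolding beta_recurrent_def
proof (intro allI impI)
  fix i assume i: "i + 3 \<le> d"
  define j where "j = d - (i + 3)"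
  have "d - i = j + 3" "d - (i + 1) = j + 2" "d - (i + 2) = j + 1" using i by (auto simp: j_def)
  moreover have "t j - t (j + 3) = (q + inverse q + 1) * (t (j + 1) - t (j + 2))"
  proof -
    have "j + 3 \<le> d" using i by (simp add: j_def)
    then show ?thesis using assms unfolding beta_recurrent_def by blast
  qed
  ultimately show "t (d - i) - t (d - (i + 3)) = (q + inverse q + 1) * (t (d - (i + 1)) - t (d - (i + 2)))"
    unfolding j_def[symmetric] by (simp add: algebra_simps)
qed

context spectral
begin

lemma tau_op_rev: "i \<le> d \<Longrightarrow> tau_op scale A (\<lambda>i. t (d - i)) i = sigma_op scale d A t i"
  by (rule ext) (simp only: tau_op_def sigma_op_def ops_rev_initial)

lemma sigma_op_rev: "i \<le> d \<Longrightarrow> sigma_op scale d A (\<lambda>i. t (d - i)) i = tau_op scale A t i"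
  by (rule ext) (simp only: tau_op_def sigma_op_def ops_rev_final)

context
  fixes x assumes cyclic: "\<And>i. i \<le> d \<Longrightarrow> E i x \<noteq> 0"
begin

lemma basis_tau: "is_basis scale d (\<lambda>i. tau_op scale A t i x)"
  unfolding tau_op_def by (rule basis_ops[OF cyclic])

lemma basis_sigma: "is_basis scale d (\<lambda>i. sigma_op scale d A t i x)"
proof -
  interpret rev: spectral scale d A "\<lambda>i. E (d - i)" "\<lambda>i. t (d - i)" by (rule spectral_rev)
  have "is_basis scale d (\<lambda>i. tau_op scale A (\<lambda>i. t (d - i)) i x)"
    by (rule rev.basis_tau) (simp add: cyclic)
  then show ?thesis by (rule is_basis_cong) (simp add: tau_op_rev)
qed

lemma lower_tau_E:
  "lower_transition scale d (\<lambda>i. tau_op scale A t i x) (\<lambda>i. E i x) (\<lambda>i j. to_ac (entK t i j))"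
  by (rule lower_transitionI[where T = "entK t", OF basis_tau basis_E[OF cyclic]])
    (simp_all only: tau_op_def E_expansion)

lemma lower_E_tau:
  "lower_transition scale d (\<lambda>i. E i x) (\<lambda>i. tau_op scale A t i x) (\<lambda>i j. to_ac (ent_up t i j))"
  by (rule lower_transitionI[where T = "ent_up t", OF basis_E[OF cyclic] basis_tau])
    (simp_all only: tau_op_def ops_expansion)

text \<open>Both bases are listed backwards, so that expanding a product in those of no larger
  degree gives a lower triangular matrix. The matrix is built from \<open>newton_coeff\<close>,
  which stays in the base field; only its closed form involves \<open>q\<close>.\<close>

lemma lower_tau_sigma:
  assumes "q \<noteq> 0" and "beta_recurrent d q (\<lambda>i. to_ac (t i))"
  shows "lower_transition scale d (\<lambda>i. tau_op scale A t (d - i) x) (\<lambda>i. sigma_op scale d A t (d - i) x)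
    (entN d q t)"
proof (rule lower_transitionI[where T = "\<lambda>i j. newton_coeff d t (d - j) (d - i)",
      OF is_basis_rev[OF basis_tau] is_basis_rev[OF basis_sigma]])
  show "sigma_op scale d A t (d - j) x =
     (\<Sum>i\<le>d. scale (if j \<le> i then newton_coeff d t (d - j) (d - i) else 0) (tau_op scale A t (d - i) x))"
    if "j \<le> d" for j
    unfolding sigma_op_def tau_op_def by (rule ops_final_expansion[OF that])
next
  fix i j assume ij: "i \<le> d" "j \<le> i"
  have inj: "inj_on (\<lambda>i. to_ac (t i)) {0..d}" using t_inj by (auto simp: inj_on_def)
  have "to_ac (newton_coeff d t (d - j) (d - i)) = newton_coeff d (\<lambda>i. to_ac (t i)) (d - j) (d - i)"
    by (rule newton_coeff_to_ac)
  also have "\<dots> = (\<Prod>h=d-((d-j)-(d-i))+1..d. to_ac (t 0) - to_ac (t h)) *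
      qtri q (d - (d - j)) ((d - j) - (d - i)) (d - i)"
    by (rule newton_coeff_eq_qtri[OF assms inj]) (use ij in auto)
  also have "\<dots> = entN d q t i j"
  proof -
    have "d - ((d - j) - (d - i)) + 1 = d - i + j + 1" "d - (d - j) = j" "(d - j) - (d - i) = i - j"
      using ij by auto
    then show ?thesis by (simp add: entN_def to_ac_prod)
  qed
  finally show "to_ac (newton_coeff d t (d - j) (d - i)) = entN d q t i j" .
qed

end

context
  fixes x assumes cyclic: "\<And>i. i \<le> d \<Longrightarrow> E i x \<noteq> 0"
begin

lemma lower_sigma_E:
  "lower_transition scale d (\<lambda>i. sigma_op scale d A t i x) (\<lambda>i. E (d - i) x) (\<lambda>i j. to_ac (entK' d t i j))"
proof -
  interpret rev: spectral scale d A "\<lambda>i. E (d - i)" "\<lambda>i. t (d - i)" by (rule spectral_rev)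
  show ?thesis
  proof (rule lower_transition_cong[OF rev.lower_tau_E])
    fix i j assume ij: "i \<le> d" "j \<le> i"
    have "(\<Prod>h<j. t (d - j) - t (d - h)) = (\<Prod>h=d-j+1..d. t (d - j) - t h)"
      by (rule prod.reindex_bij_witness[of _ "\<lambda>h. d - h" "\<lambda>h. d - h"]) (use ij in auto)
    moreover have "(\<Prod>h=j+1..i. t (d - j) - t (d - h)) = (\<Prod>h\<in>{d-i..<d-j}. t (d - j) - t h)"
      by (rule prod.reindex_bij_witness[of _ "\<lambda>h. d - h" "\<lambda>h. d - h"]) (use ij in auto)
    ultimately show "to_ac (entK' d t i j) = to_ac (entK (\<lambda>i. t (d - i)) i j)"
      by (simp only: entK_def entK'_def)
  qed (use cyclic in \<open>simp_all add: tau_op_rev\<close>)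
qed

lemma lower_E_sigma:
  "lower_transition scale d (\<lambda>i. E (d - i) x) (\<lambda>i. sigma_op scale d A t i x) (\<lambda>i j. to_ac (ent_down d t i j))"
proof -
  interpret rev: spectral scale d A "\<lambda>i. E (d - i)" "\<lambda>i. t (d - i)" by (rule spectral_rev)
  show ?thesis
  proof (rule lower_transition_cong[OF rev.lower_E_tau])
    fix i j assume ij: "i \<le> d" "j \<le> i"
    have "(\<Prod>h<j. t (d - i) - t (d - h)) = (\<Prod>h=d-j+1..d. t (d - i) - t h)"
      by (rule prod.reindex_bij_witness[of _ "\<lambda>h. d - h" "\<lambda>h. d - h"]) (use ij in auto)
    then show "to_ac (ent_down d t i j) = to_ac (ent_up (\<lambda>i. t (d - i)) i j)"
      by (simp only: ent_up_def ent_down_def)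
  qed (use cyclic in \<open>simp_all add: tau_op_rev\<close>)
qed

lemma lower_sigma_tau:
  assumes "q \<noteq> 0" and "beta_recurrent d q (\<lambda>i. to_ac (t i))"
  shows "lower_transition scale d (\<lambda>i. sigma_op scale d A t (d - i) x) (\<lambda>i. tau_op scale A t (d - i) x)
    (entM d q t)"
proof -
  interpret rev: spectral scale d A "\<lambda>i. E (d - i)" "\<lambda>i. t (d - i)" by (rule spectral_rev)
  show ?thesis
  proof (rule lower_transition_cong[OF rev.lower_tau_sigma])
    show "beta_recurrent d q (\<lambda>i. to_ac (t (d - i)))"
      using beta_recurrent_rev[OF assms(2)] .
    fix i j assume ij: "i \<le> d" "j \<le> i"
    have "(\<Prod>h=d-i+j+1..d. t d - t (d - h)) = (\<Prod>h<i-j. t d - t h)"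
      by (rule prod.reindex_bij_witness[of _ "\<lambda>h. d - h" "\<lambda>h. d - h"]) (use ij in auto)
    then show "entM d q t i j = entN d q (\<lambda>i. t (d - i)) i j"
      by (simp add: entM_def entN_def)
  qed (use cyclic assms in \<open>simp_all add: tau_op_rev sigma_op_rev\<close>)
qed

end

end

context leonard
begin

lemma E_ratio_explicit:
  assumes "E d y = y" and "y \<noteq> 0" and i: "i \<le> d"
    and x: "sigma_op scale d B r (d - i) y = scale c (tau_op scale A t i x)"
    and x': "tau_op scale B r (d - i) y = scale c' (tau_op scale A t i x')" and "c' \<noteq> 0"
  shows "E i x' = scale (c / c') (E i x)"
proof -
  have "scale c (E i x) = scale c' (E i x')"
    by (rule E_ratio[OF assms(1-3)]) (use x x' i in \<open>simp_all only: sigma_op_diff tau_op_def\<close>)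
  then have "scale (1 / c') (scale c (E i x)) = scale (1 / c') (scale c' (E i x'))" by simp
  then show ?thesis using assms(6) by simp
qed

end

section \<open>Assembling the 24 arrangements\<close>

lemma lower_transition_entries:
  assumes "lower_transition s d u v L" and "\<And>i j. L' i j = L i j"
  shows "lower_transition s d u v L'"
  by (rule lower_transition_cong[OF assms(1)]) (simp_all only: assms(2))

lemma (in vector_space) scale_cross:
  assumes "scale a u = scale b v" and "b \<noteq> 0"
  shows "v = scale (a / b) u"
proof -
  have "scale (1 / b) (scale a u) = scale (1 / b) (scale b v)" by (simp only: assms(1))
  then show ?thesis using assms(2) by simp
qed

lemma (in vector_space) scale_solve:
  assumes "v = scale c u" and "c * c' = 1"
  shows "u = scale c' v"
  using assms by (simp add: mult.commute)

lemma sym4_arrangement_cases: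
  assumes "distinct [w, x, y, z]"
    and "P Sds S0 S0s Sd" "P S0 Sds S0s Sd" "P Sds S0 Sd S0s" "P S0 Sds Sd S0s"
    and "P Sd S0s S0 Sds" "P S0s Sd S0 Sds" "P Sd S0s Sds S0" "P S0s Sd Sds S0"
    and "P Sd Sds S0 S0s" "P Sds Sd S0 S0s" "P Sd Sds S0s S0" "P Sds Sd S0s S0"
    and "P S0 S0s Sd Sds" "P S0s S0 Sd Sds" "P S0 S0s Sds Sd" "P S0s S0 Sds Sd"
    and "P Sds S0s S0 Sd" "P S0s Sds S0 Sd" "P Sds S0s Sd S0" "P S0s Sds Sd S0"
    and "P Sd S0 S0s Sds" "P S0 Sd S0s Sds" "P Sd S0 Sds S0s" "P S0 Sd Sds S0s"
  shows "P w x y z"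
  using assms(1) by (cases w; cases x; cases y; cases z) (simp_all add: assms(2-))

theorem theorem15p2:
  fixes d :: nat
    and scl :: "'k::field \<Rightarrow> 'a::ring_1 \<Rightarrow> 'a"
    and act :: "'a \<Rightarrow> 'v::ab_group_add \<Rightarrow> 'v"
    and A As :: 'a and E Es :: "nat \<Rightarrow> 'a"
    and \<theta> \<theta>s \<phi>1 \<phi>2 :: "nat \<Rightarrow> 'k"
    and \<eta>0 \<eta>d \<eta>s0 \<eta>sd :: 'v
    and \<epsilon>0 \<epsilon>d \<epsilon>s0 \<epsilon>sd p1 p2 :: 'k
    and q :: "'k alg_closure"
    and B :: "sym4 \<times> sym4 \<times> sym4 \<times> sym4 \<Rightarrow> nat \<Rightarrow> 'v"
    and w x y z :: sym4
  assumes "is_algebra scl" and "iso_to_Mat (d + 1) scl"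
    and "irreducible_module act"
    and "leonard_system d scl A E As Es"
    and "eigenvalue_seq d scl A E \<theta>" and "eigenvalue_seq d scl As Es \<theta>s"
    and "first_split_seq d scl act A E \<theta> As Es \<theta>s \<phi>1"
    and "second_split_seq d scl act A E \<theta> As Es \<theta>s \<phi>2"
    and "p1 = (\<Prod>h=1..d. \<phi>1 h)" and "p2 = (\<Prod>h=1..d. \<phi>2 h)"
    and "\<eta>0 \<in> range (act (E 0))" and "\<eta>0 \<noteq> 0"
    and "\<eta>d \<in> range (act (E d))" and "\<eta>d \<noteq> 0"
    and "\<eta>s0 \<in> range (act (Es 0))" and "\<eta>s0 \<noteq> 0"
    and "\<eta>sd \<in> range (act (Es d))" and "\<eta>sd \<noteq> 0"
    and "\<epsilon>0 \<noteq> 0" and "\<epsilon>d \<noteq> 0" and "\<epsilon>s0 \<noteq> 0" and "\<epsilon>sd \<noteq> 0"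
    and "vscl scl act (1 / \<epsilon>s0) (act (lin_prod scl A \<theta> [0..<d]) \<eta>s0) = vscl scl act (1 / \<epsilon>d) \<eta>d"
    and "vscl scl act (1 / \<epsilon>sd) (act (lin_prod scl A \<theta> [0..<d]) \<eta>sd) = vscl scl act (1 / \<epsilon>d) \<eta>d"
    and "vscl scl act (1 / \<epsilon>0) (act (lin_prod scl As \<theta>s [1..<d+1]) \<eta>0) = vscl scl act (1 / \<epsilon>s0) \<eta>s0"
    and "vscl scl act (1 / \<epsilon>d) (act (lin_prod scl As \<theta>s [1..<d+1]) \<eta>d) = vscl scl act (p1 / \<epsilon>s0) \<eta>s0"
    and "vscl scl act (1 / \<epsilon>0) (act (lin_prod scl As \<theta>s [0..<d]) \<eta>0) = vscl scl act (1 / \<epsilon>sd) \<eta>sd"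
    and "vscl scl act (1 / \<epsilon>d) (act (lin_prod scl As \<theta>s [0..<d]) \<eta>d) = vscl scl act (p2 / \<epsilon>sd) \<eta>sd"
    and "vscl scl act (1 / \<epsilon>s0) (act (lin_prod scl A \<theta> [1..<d+1]) \<eta>s0) = vscl scl act (p2 / \<epsilon>0) \<eta>0"
    and "vscl scl act (1 / \<epsilon>sd) (act (lin_prod scl A \<theta> [1..<d+1]) \<eta>sd) = vscl scl act (p1 / \<epsilon>0) \<eta>0"
    and "q \<noteq> 0"
    and "\<And>i. d \<ge> 3 \<Longrightarrow> 2 \<le> i \<Longrightarrow> i \<le> d - 1 \<Longrightarrow>
           q + inverse q + 1 = to_ac ((\<theta> (i - 2) - \<theta> (i + 1)) / (\<theta> (i - 1) - \<theta> i)) \<and>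
           q + inverse q + 1 = to_ac ((\<theta>s (i - 2) - \<theta>s (i + 1)) / (\<theta>s (i - 1) - \<theta>s i))"
    and "B = basis24 d scl act A E \<theta> As Es \<theta>s \<eta>0 \<eta>d \<eta>s0 \<eta>sd"
    and "distinct [w, x, y, z]"
  shows "transition_matrix (vscl scl act) d (B (w, x, y, z)) (B (w, x, z, y))
           (mat (d + 1) (d + 1) (\<lambda>(i, j). if i + j = d then 1 else 0)) \<and>
         transition_matrix (vscl scl act) d (B (w, x, y, z)) (B (x, w, y, z))
           (mat (d + 1) (d + 1) (\<lambda>(i, j). if i = j
              then diag_entry d \<phi>1 \<phi>2 \<epsilon>0 \<epsilon>d \<epsilon>s0 \<epsilon>sd (w, x, y, z) i else 0)) \<and>
         (\<exists>T. transition_matrix (vscl scl act) d (B (w, x, y, z)) (B (w, y, x, z)) T \<and>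
              map_mat to_ac T = mat (d + 1) (d + 1) (\<lambda>(i, j). if j \<le> i
                then lower_entry d q \<theta> \<theta>s (w, x, y, z) i j else 0))"
proof -
  interpret m: irreducible_matrix_module scl d act
    by unfold_locales (fact assms(1-3))+
  let ?sv = "vscl scl act"
  note vs = m.mv.vector_space_axioms
  \<comment> \<open>Starting vectors must be fixed by the idempotent of index 0. For the two vectors
    belonging to the index \<open>d\<close> this is arranged by reversing an order, which accounts
    for the number of interpretations.\<close>
  interpret L: leonard ?sv d "act A" "\<lambda>i. act (E i)" \<theta> "act As" "\<lambda>i. act (Es i)" \<theta>s
    by (rule m.leonard_system_leonard[OF assms(4-6)])
  interpret Ld: leonard ?sv d "act As" "\<lambda>i. act (Es i)" \<theta>s "act A" "\<lambda>i. act (E i)" \<theta>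
    by (rule L.leonard_dual)
  interpret Lr: leonard ?sv d "act A" "\<lambda>i. act (E (d - i))" "\<lambda>i. \<theta> (d - i)" "act As" "\<lambda>i. act (Es i)" \<theta>s
    by (rule L.leonard_rev)
  interpret Lrd: leonard ?sv d "act As" "\<lambda>i. act (Es i)" \<theta>s "act A" "\<lambda>i. act (E (d - i))" "\<lambda>i. \<theta> (d - i)"
    by (rule Lr.leonard_dual)
  interpret Ldr: leonard ?sv d "act As" "\<lambda>i. act (Es (d - i))" "\<lambda>i. \<theta>s (d - i)" "act A" "\<lambda>i. act (E i)" \<theta>
    by (rule Ld.leonard_rev)
  interpret Ldrd: leonard ?sv d "act A" "\<lambda>i. act (E i)" \<theta> "act As" "\<lambda>i. act (Es (d - i))" "\<lambda>i. \<theta>s (d - i)"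
    by (rule Ldr.leonard_dual)
  have \<eta>0: "act (E 0) \<eta>0 = \<eta>0" and \<eta>d: "act (E d) \<eta>d = \<eta>d"
    and \<eta>s0: "act (Es 0) \<eta>s0 = \<eta>s0" and \<eta>sd: "act (Es d) \<eta>sd = \<eta>sd"
    using assms(11,13,15,17) by (auto simp: L.a.E_E L.b.E_E)
  have \<eta>d': "act (E (d - 0)) \<eta>d = \<eta>d" and \<eta>sd': "act (Es (d - 0)) \<eta>sd = \<eta>sd"
    using \<eta>d \<eta>sd by simp_all
  note E_s0 = L.E_x_nonzero[OF \<eta>s0 assms(16)] and E_sd = Ldrd.E_x_nonzero[OF \<eta>sd' assms(18)]
    and Es_0 = Ld.E_x_nonzero[OF \<eta>0 assms(12)] and Es_d = Lrd.E_x_nonzero[OF \<eta>d' assms(14)]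

  \<comment> \<open>Each split sequence is needed at two starting vectors: at
    \<open>\<eta>s0\<close>, where it is defined, and at \<open>\<eta>0\<close> or
    \<open>\<eta>d\<close> in the dual of the given or of the reversed system.\<close>
  have split1: "L.split_scalars \<eta>s0 \<phi>1"
    by (rule m.first_split_seq_split_scalars[OF L.leonard_axioms assms(7) \<eta>s0 assms(16)])
  have split2: "Lr.split_scalars \<eta>s0 \<phi>2"
    by (rule m.first_split_seq_split_scalars[OF Lr.leonard_axioms assms(8)[unfolded second_split_seq_def] \<eta>s0 assms(16)])
  have split1d: "Ld.split_scalars \<eta>0 \<phi>1"
    by (rule L.split_scalars_dual[OF \<eta>s0 assms(16) split1 \<eta>0 assms(12)])
  have split2d: "Lrd.split_scalars \<eta>d \<phi>2"
    by (rule Lr.split_scalars_dual[OF \<eta>s0 assms(16) split2 \<eta>d' assms(14)])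

  define g1 where "g1 = (\<lambda>i. \<Prod>h=1..i. \<phi>1 h)"
  define g2 where "g2 = (\<lambda>i. \<Prod>h=1..i. \<phi>2 h)"
  define r1 where "r1 = (\<lambda>i. \<Prod>h=d-i+1..d. \<phi>1 h)"
  define r2 where "r2 = (\<lambda>i. \<Prod>h=d-i+1..d. \<phi>2 h)"
  have p: "p1 = g1 d" "p2 = g2 d" by (simp_all add: assms(9,10) g1_def g2_def)
  have \<phi>_nz: "\<phi>1 i \<noteq> 0" "\<phi>2 i \<noteq> 0" if "1 \<le> i" "i \<le> d" for i
    using split1 split2 that
    unfolding L.split_scalars_def[OF \<eta>s0 assms(16)] Lr.split_scalars_def[OF \<eta>s0 assms(16)] by blast+
  have g_nz: "g1 i \<noteq> 0" "g2 i \<noteq> 0" "r1 i \<noteq> 0" "r2 i \<noteq> 0" if "i \<le> d" for i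
    using that \<phi>_nz by (auto simp: g1_def g2_def r1_def r2_def)
  have tail: "(\<Prod>h=i+1..d. f h) = (\<Prod>h=1..d. f h) / (\<Prod>h=1..i. f h)"
    if "i \<le> d" "\<And>i. 1 \<le> i \<Longrightarrow> i \<le> d \<Longrightarrow> f i \<noteq> 0" for i and f :: "nat \<Rightarrow> 'k"
  proof -
    have "{1..d} = {1..i} \<union> {i+1..d}" using that(1) by auto
    then have "(\<Prod>h=1..d. f h) = (\<Prod>h=1..i. f h) * (\<Prod>h=i+1..d. f h)"
      by (simp only:) (rule prod.union_disjoint, auto)
    moreover have "(\<Prod>h=1..i. f h) \<noteq> 0" using that by auto
    ultimately show ?thesis by simp
  qed
  have tails: "(\<Prod>h=i+1..d. \<phi>1 h) = g1 d / g1 i" "(\<Prod>h=i+1..d. \<phi>2 h) = g2 d / g2 i" if "i \<le> d" for i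
    using tail[OF that, of \<phi>1] tail[OF that, of \<phi>2] \<phi>_nz by (simp_all add: g1_def g2_def)
  have GR: "g1 (d - i) = g1 d / r1 i" "g2 (d - i) = g2 d / r2 i"
    "r1 (d - i) = g1 d / g1 i" "r2 (d - i) = g2 d / g2 i" if i: "i \<le> d" for i
    using tails[of "d - i"] tails[OF i] g_nz[of "d - i"] g_nz[OF i] i by (simp_all add: r1_def r2_def field_simps)
  note nz = g_nz g_nz[OF order_refl] assms(19-22)

  \<comment> \<open>The relations \<open>e1\<close> to \<open>e4\<close> turn a normalisation of the
    \<epsilon>'s into a statement that one \<eta> is a multiple of the last vector of a split basis,
    and let \<open>split_descent\<close> lower it. Variants ending in \<open>_inv\<close> solve for
    the other vector, those in \<open>_rev\<close> replace \<open>i\<close> by \<open>d - i\<close>,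
    exchanging initial and final products.\<close>
  have e1: "sigma_op ?sv d (act As) \<theta>s (d - i) \<eta>d = ?sv ((1 / g1 i) * (\<epsilon>d * g1 d / \<epsilon>s0)) (tau_op ?sv (act A) \<theta> i \<eta>s0)" if i: "i \<le> d" for i
  proof -
    have "\<eta>d = ?sv ((1 / \<epsilon>s0) / (1 / \<epsilon>d)) (lin_ops ?sv (act A) \<theta> [0..<d] \<eta>s0)"
      using assms(23) nz unfolding m.act_lin_prod by (intro m.mv.scale_cross) simp_all
    from L.split_descent[OF \<eta>s0 assms(16) split1 this i] show ?thesis
      unfolding sigma_op_diff[OF i] tau_op_def tails[OF i] by (simp del: upt_Suc add: mult.commute)
  qed
  have e2: "sigma_op ?sv d (act A) \<theta> (d - i) \<eta>sd = ?sv ((1 / g1 i) * (\<epsilon>sd * g1 d / \<epsilon>0)) (tau_op ?sv (act As) \<theta>s i \<eta>0)" if i: "i \<le> d" for i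
  proof -
    have "\<eta>sd = ?sv ((1 / \<epsilon>0) / (1 / \<epsilon>sd)) (lin_ops ?sv (act As) \<theta>s [0..<d] \<eta>0)"
      using assms(27) nz unfolding m.act_lin_prod by (intro m.mv.scale_cross) simp_all
    from Ld.split_descent[OF \<eta>0 assms(12) split1d this i] show ?thesis
      unfolding sigma_op_diff[OF i] tau_op_def tails[OF i] by (simp del: upt_Suc add: mult.commute)
  qed
  have e3: "sigma_op ?sv d (act As) \<theta>s (d - i) \<eta>0 = ?sv ((1 / g2 i) * (\<epsilon>0 / \<epsilon>s0)) (sigma_op ?sv d (act A) \<theta> i \<eta>s0)" if i: "i \<le> d" for i
  proof -
    have *: "\<eta>0 = ?sv ((1 / \<epsilon>s0) / (g2 d / \<epsilon>0)) (sigma_op ?sv d (act A) \<theta> d \<eta>s0)"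
      using assms(29) nz unfolding m.act_lin_prod p sigma_op_def by (intro m.mv.scale_cross) simp_all
    then have "\<eta>0 = ?sv ((1 / \<epsilon>s0) / (g2 d / \<epsilon>0)) (lin_ops ?sv (act A) (\<lambda>i. \<theta> (d - i)) [0..<d] \<eta>s0)"
      unfolding L.a.tau_op_rev[OF order_refl, symmetric] tau_op_def .
    from Lr.split_descent[OF \<eta>s0 assms(16) split2 this i]
    have "sigma_op ?sv d (act As) \<theta>s (d - i) \<eta>0 = ?sv ((1 / \<epsilon>s0) / (g2 d / \<epsilon>0) * (g2 d / g2 i)) (sigma_op ?sv d (act A) \<theta> i \<eta>s0)"
      unfolding sigma_op_diff[OF i] tails[OF i] L.a.tau_op_rev[OF i, symmetric] tau_op_def .
    moreover have "(1 / \<epsilon>s0) / (g2 d / \<epsilon>0) * (g2 d / g2 i) = (1 / g2 i) * (\<epsilon>0 / \<epsilon>s0)"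
      using nz i by simp
    ultimately show ?thesis by (simp only:)
  qed
  have e4: "tau_op ?sv (act A) \<theta> (d - i) \<eta>sd = ?sv ((1 / g2 i) * (\<epsilon>sd / \<epsilon>d)) (tau_op ?sv (act As) \<theta>s i \<eta>d)" if i: "i \<le> d" for i
  proof -
    have "\<eta>sd = ?sv ((1 / \<epsilon>d) / (g2 d / \<epsilon>sd)) (lin_ops ?sv (act As) \<theta>s [0..<d] \<eta>d)"
      using assms(28) nz unfolding m.act_lin_prod p by (intro m.mv.scale_cross) simp_all
    from Lrd.split_descent[OF \<eta>d' assms(14) split2d this i]
    have "tau_op ?sv (act A) \<theta> (d - i) \<eta>sd = ?sv ((1 / \<epsilon>d) / (g2 d / \<epsilon>sd) * (g2 d / g2 i)) (tau_op ?sv (act As) \<theta>s i \<eta>d)"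
      unfolding sigma_op_diff[OF i, symmetric] tails[OF i] L.a.sigma_op_rev[OF diff_le_self] tau_op_def .
    moreover have "(1 / \<epsilon>d) / (g2 d / \<epsilon>sd) * (g2 d / g2 i) = (1 / g2 i) * (\<epsilon>sd / \<epsilon>d)"
      using nz i by simp
    ultimately show ?thesis by (simp only:)
  qed
  have e4_inv: "tau_op ?sv (act As) \<theta>s i \<eta>d = ?sv (g2 i * (\<epsilon>d / \<epsilon>sd)) (tau_op ?sv (act A) \<theta> (d - i) \<eta>sd)" if i: "i \<le> d" for i
    by (rule m.mv.scale_solve[OF e4[OF i]]) (use nz i in simp)
  have e4_rev: "tau_op ?sv (act A) \<theta> i \<eta>sd = ?sv (r2 i * (\<epsilon>sd / (\<epsilon>d * g2 d))) (tau_op ?sv (act As) \<theta>s (d - i) \<eta>d)" if i: "i \<le> d" for i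
  proof -
    have *: "(1 / g2 (d - i)) * (\<epsilon>sd / \<epsilon>d) = r2 i * (\<epsilon>sd / (\<epsilon>d * g2 d))" using nz i by (simp add: GR field_simps)
    show ?thesis using e4[of "d - i"] unfolding * diff_diff_cancel[OF i] by simp
  qed
  have e4_rev_inv: "tau_op ?sv (act As) \<theta>s (d - i) \<eta>d = ?sv ((1 / r2 i) * (\<epsilon>d * g2 d / \<epsilon>sd)) (tau_op ?sv (act A) \<theta> i \<eta>sd)" if i: "i \<le> d" for i
    by (rule m.mv.scale_solve[OF e4_rev[OF i]]) (use nz i in simp)
  \<comment> \<open>Both relations compared here start from \<open>\<eta>d\<close>: its image under
    the final product in \<open>As\<close> leads to \<open>\<eta>s0\<close>, that under the initial
    product to \<open>\<eta>sd\<close>. For \<open>e6\<close> the vector \<open>\<eta>sd\<close>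
    plays this part in the dual system.\<close>
  have e5: "act (E i) \<eta>sd = ?sv ((r2 i / g1 i) * (\<epsilon>sd * g1 d / (\<epsilon>s0 * g2 d))) (act (E i) \<eta>s0)" if i: "i \<le> d" for i
  proof -
    have "act (E i) \<eta>sd = ?sv ((1 / g1 i) * (\<epsilon>d * g1 d / \<epsilon>s0) / ((1 / r2 i) * (\<epsilon>d * g2 d / \<epsilon>sd))) (act (E i) \<eta>s0)"
      by (rule L.E_ratio_explicit[OF \<eta>d assms(14) i e1[OF i] e4_rev_inv[OF i]]) (use nz i in simp)
    moreover have "(1 / g1 i) * (\<epsilon>d * g1 d / \<epsilon>s0) / ((1 / r2 i) * (\<epsilon>d * g2 d / \<epsilon>sd))
        = (r2 i / g1 i) * (\<epsilon>sd * g1 d / (\<epsilon>s0 * g2 d))"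
      using nz i by simp
    ultimately show ?thesis by (simp only:)
  qed
  have e6: "act (Es i) \<eta>d = ?sv ((g2 i / g1 i) * (\<epsilon>d * g1 d / \<epsilon>0)) (act (Es i) \<eta>0)" if i: "i \<le> d" for i
  proof -
    have "act (Es i) \<eta>d = ?sv ((1 / g1 i) * (\<epsilon>sd * g1 d / \<epsilon>0) / ((1 / g2 i) * (\<epsilon>sd / \<epsilon>d))) (act (Es i) \<eta>0)"
      by (rule Ld.E_ratio_explicit[OF \<eta>sd assms(18) i e2[OF i] e4[OF i]]) (use nz i in simp)
    moreover have "(1 / g1 i) * (\<epsilon>sd * g1 d / \<epsilon>0) / ((1 / g2 i) * (\<epsilon>sd / \<epsilon>d))
        = (g2 i / g1 i) * (\<epsilon>d * g1 d / \<epsilon>0)"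
      using nz i by simp
    ultimately show ?thesis by (simp only:)
  qed
  have e1_inv: "tau_op ?sv (act A) \<theta> i \<eta>s0 = ?sv (g1 i * (\<epsilon>s0 / (\<epsilon>d * g1 d))) (sigma_op ?sv d (act As) \<theta>s (d - i) \<eta>d)" if i: "i \<le> d" for i
    by (rule m.mv.scale_solve[OF e1[OF i]]) (use nz i in simp)
  have e1_rev: "sigma_op ?sv d (act As) \<theta>s i \<eta>d = ?sv (r1 i * (\<epsilon>d / \<epsilon>s0)) (tau_op ?sv (act A) \<theta> (d - i) \<eta>s0)" if i: "i \<le> d" for i
  proof -
    have *: "(1 / g1 (d - i)) * (\<epsilon>d * g1 d / \<epsilon>s0) = r1 i * (\<epsilon>d / \<epsilon>s0)" using nz i by (simp add: GR field_simps)
    show ?thesis using e1[of "d - i"] unfolding * diff_diff_cancel[OF i] by simp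
  qed
  have e1_rev_inv: "tau_op ?sv (act A) \<theta> (d - i) \<eta>s0 = ?sv ((1 / r1 i) * (\<epsilon>s0 / \<epsilon>d)) (sigma_op ?sv d (act As) \<theta>s i \<eta>d)" if i: "i \<le> d" for i
    by (rule m.mv.scale_solve[OF e1_rev[OF i]]) (use nz i in simp)
  have e2_inv: "tau_op ?sv (act As) \<theta>s i \<eta>0 = ?sv (g1 i * (\<epsilon>0 / (\<epsilon>sd * g1 d))) (sigma_op ?sv d (act A) \<theta> (d - i) \<eta>sd)" if i: "i \<le> d" for i
    by (rule m.mv.scale_solve[OF e2[OF i]]) (use nz i in simp)
  have e2_rev: "sigma_op ?sv d (act A) \<theta> i \<eta>sd = ?sv (r1 i * (\<epsilon>sd / \<epsilon>0)) (tau_op ?sv (act As) \<theta>s (d - i) \<eta>0)" if i: "i \<le> d" for i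
  proof -
    have *: "(1 / g1 (d - i)) * (\<epsilon>sd * g1 d / \<epsilon>0) = r1 i * (\<epsilon>sd / \<epsilon>0)" using nz i by (simp add: GR field_simps)
    show ?thesis using e2[of "d - i"] unfolding * diff_diff_cancel[OF i] by simp
  qed
  have e2_rev_inv: "tau_op ?sv (act As) \<theta>s (d - i) \<eta>0 = ?sv ((1 / r1 i) * (\<epsilon>0 / \<epsilon>sd)) (sigma_op ?sv d (act A) \<theta> i \<eta>sd)" if i: "i \<le> d" for i
    by (rule m.mv.scale_solve[OF e2_rev[OF i]]) (use nz i in simp)
  have e3_inv: "sigma_op ?sv d (act A) \<theta> i \<eta>s0 = ?sv (g2 i * (\<epsilon>s0 / \<epsilon>0)) (sigma_op ?sv d (act As) \<theta>s (d - i) \<eta>0)" if i: "i \<le> d" for i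
    by (rule m.mv.scale_solve[OF e3[OF i]]) (use nz i in simp)
  have e3_rev: "sigma_op ?sv d (act As) \<theta>s i \<eta>0 = ?sv (r2 i * (\<epsilon>0 / (\<epsilon>s0 * g2 d))) (sigma_op ?sv d (act A) \<theta> (d - i) \<eta>s0)" if i: "i \<le> d" for i
  proof -
    have *: "(1 / g2 (d - i)) * (\<epsilon>0 / \<epsilon>s0) = r2 i * (\<epsilon>0 / (\<epsilon>s0 * g2 d))" using nz i by (simp add: GR field_simps)
    show ?thesis using e3[of "d - i"] unfolding * diff_diff_cancel[OF i] by simp
  qed
  have e3_rev_inv: "sigma_op ?sv d (act A) \<theta> (d - i) \<eta>s0 = ?sv ((1 / r2 i) * (\<epsilon>s0 * g2 d / \<epsilon>0)) (sigma_op ?sv d (act As) \<theta>s i \<eta>0)" if i: "i \<le> d" for i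
    by (rule m.mv.scale_solve[OF e3_rev[OF i]]) (use nz i in simp)
  have e5_inv: "act (E i) \<eta>s0 = ?sv ((g1 i / r2 i) * (\<epsilon>s0 * g2 d / (\<epsilon>sd * g1 d))) (act (E i) \<eta>sd)" if i: "i \<le> d" for i
    by (rule m.mv.scale_solve[OF e5[OF i]]) (use nz i in simp)
  have e5_rev: "act (E (d - i)) \<eta>sd = ?sv ((r1 i / g2 i) * (\<epsilon>sd / \<epsilon>s0)) (act (E (d - i)) \<eta>s0)" if i: "i \<le> d" for i
  proof -
    have *: "(r2 (d - i) / g1 (d - i)) * (\<epsilon>sd * g1 d / (\<epsilon>s0 * g2 d)) = (r1 i / g2 i) * (\<epsilon>sd / \<epsilon>s0)" using nz i by (simp add: GR field_simps)
    show ?thesis using e5[of "d - i"] unfolding * diff_diff_cancel[OF i] by simp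
  qed
  have e5_rev_inv: "act (E (d - i)) \<eta>s0 = ?sv ((g2 i / r1 i) * (\<epsilon>s0 / \<epsilon>sd)) (act (E (d - i)) \<eta>sd)" if i: "i \<le> d" for i
    by (rule m.mv.scale_solve[OF e5_rev[OF i]]) (use nz i in simp)
  have e6_inv: "act (Es i) \<eta>0 = ?sv ((g1 i / g2 i) * (\<epsilon>0 / (\<epsilon>d * g1 d))) (act (Es i) \<eta>d)" if i: "i \<le> d" for i
    by (rule m.mv.scale_solve[OF e6[OF i]]) (use nz i in simp)
  have e6_rev: "act (Es (d - i)) \<eta>d = ?sv ((r1 i / r2 i) * (\<epsilon>d * g2 d / \<epsilon>0)) (act (Es (d - i)) \<eta>0)" if i: "i \<le> d" for i
  proof -
    have *: "(g2 (d - i) / g1 (d - i)) * (\<epsilon>d * g1 d / \<epsilon>0) = (r1 i / r2 i) * (\<epsilon>d * g2 d / \<epsilon>0)" using nz i by (simp add: GR field_simps)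
    show ?thesis using e6[of "d - i"] unfolding * diff_diff_cancel[OF i] by simp
  qed
  have e6_rev_inv: "act (Es (d - i)) \<eta>0 = ?sv ((r2 i / r1 i) * (\<epsilon>0 / (\<epsilon>d * g2 d))) (act (Es (d - i)) \<eta>d)" if i: "i \<le> d" for i
    by (rule m.mv.scale_solve[OF e6_rev[OF i]]) (use nz i in simp)
  have rec: "beta_recurrent d q (\<lambda>i. to_ac (\<theta> i))" "beta_recurrent d q (\<lambda>i. to_ac (\<theta>s i))"
  proof -
    have "to_ac (t i) - to_ac (t (i + 3)) = (q + inverse q + 1) * (to_ac (t (i + 1)) - to_ac (t (i + 2)))"
      if t: "inj_on t {0..d}" "q + inverse q + 1 = to_ac ((t i - t (i + 3)) / (t (i + 1) - t (i + 2)))" and i: "i + 3 \<le> d"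
      for t i
    proof -
      have "t (i + 1) - t (i + 2) \<noteq> 0" using t(1) i by (auto dest: inj_onD)
      then have "to_ac (t (i + 1) - t (i + 2)) \<noteq> 0" by simp
      then show ?thesis unfolding t(2) by (simp only: to_ac_divide to_ac_diff) simp
    qed
    moreover have "q + inverse q + 1 = to_ac ((\<theta> i - \<theta> (i + 3)) / (\<theta> (i + 1) - \<theta> (i + 2)))"
      "q + inverse q + 1 = to_ac ((\<theta>s i - \<theta>s (i + 3)) / (\<theta>s (i + 1) - \<theta>s (i + 2)))" if "i + 3 \<le> d" for i
    proof -
      have "i + 2 - 2 = i" "i + 2 + 1 = i + 3" "i + 2 - 1 = i + 1" by simp_all
      moreover have "3 \<le> d" "2 \<le> i + 2" "i + 2 \<le> d - 1" using that by auto
      ultimately show "q + inverse q + 1 = to_ac ((\<theta> i - \<theta> (i + 3)) / (\<theta> (i + 1) - \<theta> (i + 2)))"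
        "q + inverse q + 1 = to_ac ((\<theta>s i - \<theta>s (i + 3)) / (\<theta>s (i + 1) - \<theta>s (i + 2)))"
        using assms(32)[of "i + 2"] by metis+
    qed
    ultimately show "beta_recurrent d q (\<lambda>i. to_ac (\<theta> i))" "beta_recurrent d q (\<lambda>i. to_ac (\<theta>s i))"
      using L.a.t_inj L.b.t_inj unfolding beta_recurrent_def by blast+
  qed

  have B:
    "B (Sds, S0, S0s, Sd) = (\<lambda>i. tau_op ?sv (act A) \<theta> i \<eta>s0)"
    "B (S0, Sds, S0s, Sd) = (\<lambda>i. sigma_op ?sv d (act As) \<theta>s (d - i) \<eta>d)"
    "B (Sds, S0, Sd, S0s) = (\<lambda>i. tau_op ?sv (act A) \<theta> (d - i) \<eta>s0)"
    "B (S0, Sds, Sd, S0s) = (\<lambda>i. sigma_op ?sv d (act As) \<theta>s i \<eta>d)"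
    "B (Sd, S0s, S0, Sds) = (\<lambda>i. tau_op ?sv (act As) \<theta>s i \<eta>0)"
    "B (S0s, Sd, S0, Sds) = (\<lambda>i. sigma_op ?sv d (act A) \<theta> (d - i) \<eta>sd)"
    "B (Sd, S0s, Sds, S0) = (\<lambda>i. tau_op ?sv (act As) \<theta>s (d - i) \<eta>0)"
    "B (S0s, Sd, Sds, S0) = (\<lambda>i. sigma_op ?sv d (act A) \<theta> i \<eta>sd)"
    "B (Sd, Sds, S0, S0s) = (\<lambda>i. sigma_op ?sv d (act As) \<theta>s i \<eta>0)"
    "B (Sds, Sd, S0, S0s) = (\<lambda>i. sigma_op ?sv d (act A) \<theta> (d - i) \<eta>s0)"
    "B (Sd, Sds, S0s, S0) = (\<lambda>i. sigma_op ?sv d (act As) \<theta>s (d - i) \<eta>0)"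
    "B (Sds, Sd, S0s, S0) = (\<lambda>i. sigma_op ?sv d (act A) \<theta> i \<eta>s0)"
    "B (S0, S0s, Sd, Sds) = (\<lambda>i. tau_op ?sv (act As) \<theta>s i \<eta>d)"
    "B (S0s, S0, Sd, Sds) = (\<lambda>i. tau_op ?sv (act A) \<theta> (d - i) \<eta>sd)"
    "B (S0, S0s, Sds, Sd) = (\<lambda>i. tau_op ?sv (act As) \<theta>s (d - i) \<eta>d)"
    "B (S0s, S0, Sds, Sd) = (\<lambda>i. tau_op ?sv (act A) \<theta> i \<eta>sd)"
    "B (Sds, S0s, S0, Sd) = (\<lambda>i. act (E i) \<eta>s0)"
    "B (S0s, Sds, S0, Sd) = (\<lambda>i. act (E i) \<eta>sd)"
    "B (Sds, S0s, Sd, S0) = (\<lambda>i. act (E (d - i)) \<eta>s0)"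
    "B (S0s, Sds, Sd, S0) = (\<lambda>i. act (E (d - i)) \<eta>sd)"
    "B (Sd, S0, S0s, Sds) = (\<lambda>i. act (Es i) \<eta>0)"
    "B (S0, Sd, S0s, Sds) = (\<lambda>i. act (Es i) \<eta>d)"
    "B (Sd, S0, Sds, S0s) = (\<lambda>i. act (Es (d - i)) \<eta>0)"
    "B (S0, Sd, Sds, S0s) = (\<lambda>i. act (Es (d - i)) \<eta>d)"
    unfolding assms(33) by (rule ext, simp only: basis24.simps Let_def prod.case sym4.case tau_op_def sigma_op_def m.act_lin_prod)+
  have fold_g: "\<And>i. (\<Prod>h=1..i. \<phi>1 h) = g1 i" "\<And>i. (\<Prod>h=1..i. \<phi>2 h) = g2 i"
    "\<And>i. (\<Prod>h=d-i+1..d. \<phi>1 h) = r1 i" "\<And>i. (\<Prod>h=d-i+1..d. \<phi>2 h) = r2 i"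
    by (simp_all only: g1_def g2_def r1_def r2_def)
  note bases = L.a.basis_tau[OF E_s0]
    L.a.basis_sigma[OF E_s0]
    L.a.basis_E[OF E_s0]
    L.a.basis_tau[OF E_sd]
    L.a.basis_sigma[OF E_sd]
    L.a.basis_E[OF E_sd]
    L.b.basis_tau[OF Es_0]
    L.b.basis_sigma[OF Es_0]
    L.b.basis_E[OF Es_0]
    L.b.basis_tau[OF Es_d]
    L.b.basis_sigma[OF Es_d]
    L.b.basis_E[OF Es_d]
  note lowers = L.a.lower_tau_E[OF E_s0]
    L.a.lower_E_tau[OF E_s0]
    L.a.lower_sigma_E[OF E_s0]
    L.a.lower_E_sigma[OF E_s0]
    L.a.lower_tau_sigma[OF E_s0 assms(31) rec(1)]
    L.a.lower_sigma_tau[OF E_s0 assms(31) rec(1)]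
    L.a.lower_tau_E[OF E_sd]
    L.a.lower_E_tau[OF E_sd]
    L.a.lower_sigma_E[OF E_sd]
    L.a.lower_E_sigma[OF E_sd]
    L.a.lower_tau_sigma[OF E_sd assms(31) rec(1)]
    L.a.lower_sigma_tau[OF E_sd assms(31) rec(1)]
    L.b.lower_tau_E[OF Es_0]
    L.b.lower_E_tau[OF Es_0]
    L.b.lower_sigma_E[OF Es_0]
    L.b.lower_E_sigma[OF Es_0]
    L.b.lower_tau_sigma[OF Es_0 assms(31) rec(2)]
    L.b.lower_sigma_tau[OF Es_0 assms(31) rec(2)]
    L.b.lower_tau_E[OF Es_d]
    L.b.lower_E_tau[OF Es_d]
    L.b.lower_sigma_E[OF Es_d]
    L.b.lower_E_sigma[OF Es_d]
    L.b.lower_tau_sigma[OF Es_d assms(31) rec(2)]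
    L.b.lower_sigma_tau[OF Es_d assms(31) rec(2)]
  \<comment> \<open>The scalars were kept in the shape of the entries in \<open>diag_entry\<close>,
    so that after the products are named by \<open>fold_g\<close> each case is closed by one of
    these facts.\<close>
  note rows = e1 e1_inv e1_rev e1_rev_inv e2 e2_inv e2_rev e2_rev_inv e3 e3_inv e3_rev e3_rev_inv e4 e4_inv e4_rev e4_rev_inv e5 e5_inv e5_rev e5_rev_inv e6 e6_inv e6_rev e6_rev_inv
  have diff_cancel: "d - (d - i) = i" if "i \<le> d" for i using that by simp
  have basis: "is_basis ?sv d (B (w, x, y, z))" if "distinct [w, x, y, z]" for w x y z
    by (rule sym4_arrangement_cases[OF that]; simp only: B; (rule bases | (rule is_basis_rev, rule bases)))
  have reversal: "B (w, x, z, y) i = B (w, x, y, z) (d - i)" if "distinct [w, x, y, z]" and "i \<le> d" for w x y z i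
    by (rule sym4_arrangement_cases[OF that(1)]; simp only: B diff_cancel[OF that(2)])
  have diagonal: "B (x, w, y, z) i = ?sv (diag_entry d \<phi>1 \<phi>2 \<epsilon>0 \<epsilon>d \<epsilon>s0 \<epsilon>sd (w, x, y, z) i) (B (w, x, y, z) i)"
    if "distinct [w, x, y, z]" and i: "i \<le> d" for w x y z i
    by (rule sym4_arrangement_cases[OF that(1)];
        simp only: B diag_entry.simps Let_def prod.case sym4.case fold_g; rule rows[OF i])
  have lower: "lower_transition ?sv d (B (w, x, y, z)) (B (w, y, x, z)) (lower_entry d q \<theta> \<theta>s (w, x, y, z))"
    if "distinct [w, x, y, z]" for w x y z
    by (rule sym4_arrangement_cases[OF that]; simp only: B; rule lower_transition_entries, rule lowers)
      (simp_all only: lower_entry.simps prod.case sym4.case)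
  have d': "distinct [w, x, z, y]" "distinct [x, w, y, z]" using assms(34) by auto
  show ?thesis
  proof (intro conjI)
    show "transition_matrix ?sv d (B (w, x, y, z)) (B (w, x, z, y))
        (mat (d + 1) (d + 1) (\<lambda>(i, j). if i + j = d then 1 else 0))"
      by (rule transition_matrix_reversal[OF vs basis[OF assms(34)] basis[OF d'(1)] reversal[OF assms(34)]])
    show "transition_matrix ?sv d (B (w, x, y, z)) (B (x, w, y, z))
        (mat (d + 1) (d + 1) (\<lambda>(i, j). if i = j then diag_entry d \<phi>1 \<phi>2 \<epsilon>0 \<epsilon>d \<epsilon>s0 \<epsilon>sd (w, x, y, z) i else 0))"
      by (rule transition_matrix_diagonal[OF vs basis[OF assms(34)] basis[OF d'(2)] diagonal[OF assms(34)]])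
    show "\<exists>T. transition_matrix ?sv d (B (w, x, y, z)) (B (w, y, x, z)) T \<and>
        map_mat to_ac T = mat (d + 1) (d + 1) (\<lambda>(i, j). if j \<le> i then lower_entry d q \<theta> \<theta>s (w, x, y, z) i j else 0)"
      using lower[OF assms(34)] by (simp only: lower_transition_def)
  qed
qed

end
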